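(* Let $\mathcal X=[0,1]^d$. (i) Let $(\mu,\nu)\in\mathcal P^2_{\mathsf{KL}}(\mathcal X)$ be such that $f_{\mathsf{KL}}=\log\frac{d\mu}{d\nu}\in\mathsf C(\mathcal X)$, let $\phi\in\{\phi_{\mathsf S},\phi_{\mathsf R}\}$ and $0<\rho<1$. For any sequence $(k_n)_{n\in\mathbb N}$ with $k_n\to\infty$ and $k_n\le\frac14(1-\rho)\log n$, with $\mathcal G_n=\mathcal G^*_{k_n}(\phi)$, $$\hat{\mathsf D}_{\mathcal G_n}(X^n,Y^n)\xrightarrow[n\to\infty]{}\mathsf D_{\mathsf{KL}}(\mu\|\nu)\quad\mathbb P\text{-a.s.}$$ (ii) For every $M\ge0$ there is a constant $C_M$ depending only on $M$ such that, with $m_k=(\log\log k)\vee 1$ and $\mathcal G_k=\mathcal G_k^{\mathsf R}(m_k)$, for all $k,n\in\mathbb N$, $$\sup_{(\mu,\nu)\in\mathcal P^2_{\mathsf{KL}}(M,\mathcal X)}\mathbb E\Big[\big|\hat{\mathsf D}_{\mathcal G_k}(X^n,Y^n)-\mathsf D_{\mathsf{KL}}(\mu\|\nu)\big|\Big]\le C_M\Big(d^{1/2}k^{-1/2}+d^{3/2}(\log k)^7n^{-1/2}\Big).$$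
   Context: $\mathsf D_{\mathsf{KL}}(\mu\|\nu)=\mathbb E_\mu[\log\frac{d\mu}{d\nu}]$ if $\mu\ll\nu$ and $\infty$ otherwise. $\mathcal P^2_{\mathsf{KL}}(\mathcal X)$ is the set of pairs of Borel probability measures on $\mathcal X$ with $\mu\ll\nu$ and $\mathsf D_{\mathsf{KL}}(\mu\|\nu)<\infty$. $\mathcal P^2_{\mathsf{KL}}(M,\mathcal X)$ is the set of $(\mu,\nu)\in\mathcal P^2_{\mathsf{KL}}(\mathcal X)$ with $c^\star_{\mathsf{KB}}(f_{\mathsf{KL}},\mathcal X)\vee\mathsf D_{\mathsf{KL}}(\mu\|\nu)\le M$, where $f_{\mathsf{KL}}=\log\frac{d\mu}{d\nu}$ (pointwise conditions on $f_{\mathsf{KL}}$ refer to a suitable version of the density). $\mathsf C(\mathcal X)$: continuous real functions on $\mathcal X$. For $k=1$, $m_1=1$. Klusowski–Barron coefficient: $\|\mathcal X\|:=\sup_{x\in\mathcal X}\|x\|_\infty$. For $\tilde f:\mathbb R^d\to\mathbb R$ with a Fourier representation $\tilde f(x)=\int_{\mathbb R^d}e^{i\omega\cdot x}F(d\omega)$, $F$ a complex Borel measure with magnitude $|F|$, let $S_m(\tilde f)=\int_{\mathbb R^d}\|\omega\|_1^m|F|(d\omega)$. For $f:\mathcal X\to\mathbb R$, $c^\star_{\mathsf{KB}}(f,\mathcal X)$ is the infimum of $c\ge0$ such that some such $\tilde f$ satisfies $\tilde f|_{\mathcal X}=f$, $\|\mathcal X\|S_2(\tilde f)\le c$, $|\tilde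 f(0)|\le c$ and $\|\nabla\tilde f(0)\|_1\le c$. Neural networks: $\mathcal G_k(a_1,a_2,a_3,a_4,\phi)$ is the set of $g(x)=\sum_{i=1}^k\beta_i\phi(w_i\cdot x+b_i)+w_0\cdot x+b_0$ on $\mathbb R^d$ with $\|w_i\|_1\vee|b_i|\le a_1$, $|\beta_i|\le a_2$ ($1\le i\le k$), $|b_0|\le a_3$, $\|w_0\|_1\le a_4$. $\phi_{\mathsf S}(z)=(1+e^{-z})^{-1}$, $\phi_{\mathsf R}(z)=\max\{z,0\}$, $\mathcal G_k^{\mathsf R}(a)=\mathcal G_k(1,2k^{-1}a,a,a,\phi_{\mathsf R})$, $\mathcal G_k^*(\phi)=\mathcal G_k(1,1,1,0,\phi)$. Estimator: $\hat{\mathsf D}_{\mathcal G}(X^n,Y^n)=\sup_{g\in\mathcal G}\frac1n\sum_{i=1}^n\big[g(X_i)-(e^{g(Y_i)}-1)\big]$, where $(X_i)$ are i.i.d. from $\mu$ and $(Y_i)$ i.i.d. from $\nu$ (independent samples). *)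

theory Defs
  imports "HOL-Probability.Probability"
begin

text \<open>
  The dimension \<open>d\<close> has to be quantified inside the statement (the constants must not depend on
  it), so points of \<open>\<real>\<^sup>d\<close> are functions on \<open>nat\<close> that are extensional on \<open>{..<d}\<close>.  As the real
  line is second countable, the product sigma-algebra below is the Borel sigma-algebra of \<open>\<real>\<^sup>d\<close>;
  likewise, on sets of extensional functions the product topology of \<open>nat \<Rightarrow> real\<close> induces the
  Euclidean one, so \<open>continuous_on\<close> has its usual meaning there.
\<close>

definition euc :: "nat \<Rightarrow> (nat \<Rightarrow> real) measure" where
  "euc d = (\<Pi>\<^sub>M i\<in>{..<d}. borel)"

definition cube :: "nat \<Rightarrow> (nat \<Rightarrow> real) set" where
  "cube d = (\<Pi>\<^sub>E i\<in>{..<d}. {0..1})"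

definition origin :: "nat \<Rightarrow> nat \<Rightarrow> real" where
  "origin d = (\<lambda>i\<in>{..<d}. 0)"

definition dotp :: "nat \<Rightarrow> (nat \<Rightarrow> real) \<Rightarrow> (nat \<Rightarrow> real) \<Rightarrow> real" where
  "dotp d w x = (\<Sum>i<d. w i * x i)"

definition norm1 :: "nat \<Rightarrow> (nat \<Rightarrow> real) \<Rightarrow> real" where
  "norm1 d w = (\<Sum>i<d. \<bar>w i\<bar>)"

definition set_norm :: "nat \<Rightarrow> (nat \<Rightarrow> real) set \<Rightarrow> ennreal" where
  "set_norm d S = (SUP x\<in>S. SUP i\<in>{..<d}. ennreal \<bar>x i\<bar>)"

definition borel_prob :: "nat \<Rightarrow> (nat \<Rightarrow> real) set \<Rightarrow> (nat \<Rightarrow> real) measure \<Rightarrow> bool" where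
  "borel_prob d S \<mu> \<longleftrightarrow> prob_space \<mu> \<and> sets \<mu> = sets (restrict_space (euc d) S)"


section \<open>Kullback--Leibler divergence\<close>

text \<open>
  The reference measure is the first argument of \<^const>\<open>KL_divergence\<close>, \<^const>\<open>RN_deriv\<close> and
  \<^const>\<open>absolutely_continuous\<close>.  The negative part of the log-density is always integrable with
  respect to \<open>\<mu>\<close>, so a log-density that is not integrable has expectation \<open>\<infinity>\<close>.
\<close>

definition KL :: "'a measure \<Rightarrow> 'a measure \<Rightarrow> ereal" where
  "KL \<mu> \<nu> =
     (if absolutely_continuous \<nu> \<mu> \<and> integrable \<mu> (entropy_density (exp 1) \<nu> \<mu>)
      then ereal (KL_divergence (exp 1) \<nu> \<mu>) else \<infinity>)"

definition log_density_version :: "'a measure \<Rightarrow> 'a measure \<Rightarrow> ('a \<Rightarrow> real) \<Rightarrow> bool" where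
  "log_density_version \<mu> \<nu> f \<longleftrightarrow> (AE x in \<nu>. RN_deriv \<nu> \<mu> x = ennreal (exp (f x)))"

definition KL_pairs ::
    "nat \<Rightarrow> (nat \<Rightarrow> real) set \<Rightarrow> ((nat \<Rightarrow> real) measure \<times> (nat \<Rightarrow> real) measure) set" where
  "KL_pairs d S = {(\<mu>, \<nu>). borel_prob d S \<mu> \<and> borel_prob d S \<nu> \<and>
     absolutely_continuous \<nu> \<mu> \<and> KL \<mu> \<nu> < \<infinity>}"


section \<open>Complex measures and the Klusowski--Barron coefficient\<close>

definition complex_measure :: "'a measure \<Rightarrow> ('a set \<Rightarrow> complex) \<Rightarrow> bool" where
  "complex_measure B F \<longleftrightarrow>
     (\<forall>A :: nat \<Rightarrow> 'a set. range A \<subseteq> sets B \<longrightarrow> disjoint_family A \<longrightarrow>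
        (\<lambda>i. F (A i)) sums F (\<Union>i. A i))"

definition total_variation :: "'a measure \<Rightarrow> ('a set \<Rightarrow> complex) \<Rightarrow> 'a measure" where
  "total_variation B F = measure_of (space B) (sets B)
     (\<lambda>E. SUP A\<in>{A :: nat \<Rightarrow> 'a set. range A \<subseteq> sets B \<and> disjoint_family A \<and> (\<Union>i. A i) = E}.
        \<Sum>i. ennreal (cmod (F (A i))))"

text \<open>
  Integration against a complex measure goes through the polar decomposition \<open>dF = h d|F|\<close>, with
  \<open>|h| = 1\<close>; such an \<open>h\<close> exists and is unique up to \<open>|F|\<close>-null sets.
\<close>

definition polar_density :: "'a measure \<Rightarrow> ('a set \<Rightarrow> complex) \<Rightarrow> 'a \<Rightarrow> complex" where
  "polar_density B F = (SOME h. h \<in> borel_measurable B \<and> (\<forall>w\<in>space B. cmod (h w) = 1) \<and>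
     (\<forall>A\<in>sets B. F A = (LINT w:A|total_variation B F. h w)))"

definition complex_measure_integral ::
    "'a measure \<Rightarrow> ('a set \<Rightarrow> complex) \<Rightarrow> ('a \<Rightarrow> complex) \<Rightarrow> complex" where
  "complex_measure_integral B F g = (LINT w|total_variation B F. g w * polar_density B F w)"

definition fourier_rep ::
    "nat \<Rightarrow> ((nat \<Rightarrow> real) \<Rightarrow> real) \<Rightarrow> ((nat \<Rightarrow> real) set \<Rightarrow> complex) \<Rightarrow> bool" where
  "fourier_rep d f F \<longleftrightarrow> complex_measure (euc d) F \<and>
     (\<forall>x\<in>space (euc d). complex_of_real (f x) =
        complex_measure_integral (euc d) F (\<lambda>w. exp (\<i> * complex_of_real (dotp d w x))))"

definition fourier_moment :: "nat \<Rightarrow> nat \<Rightarrow> ((nat \<Rightarrow> real) set \<Rightarrow> complex) \<Rightarrow> ennreal" where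
  "fourier_moment d m F = (\<integral>\<^sup>+w. ennreal (norm1 d w ^ m) \<partial>total_variation (euc d) F)"

definition gradient_at_origin :: "nat \<Rightarrow> ((nat \<Rightarrow> real) \<Rightarrow> real) \<Rightarrow> (nat \<Rightarrow> real) \<Rightarrow> bool" where
  "gradient_at_origin d f v \<longleftrightarrow>
     (\<forall>i<d. ((\<lambda>t. f ((origin d)(i := t))) has_real_derivative v i) (at 0))"

text \<open>The infimum is taken in \<^typ>\<open>ereal\<close>, so the coefficient is \<open>\<infinity>\<close> if no extension exists.\<close>

definition KB_coeff :: "nat \<Rightarrow> (nat \<Rightarrow> real) set \<Rightarrow> ((nat \<Rightarrow> real) \<Rightarrow> real) \<Rightarrow> ereal" where
  "KB_coeff d S f = Inf {ereal c | c. 0 \<le> c \<and>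
     (\<exists>h F v. fourier_rep d h F \<and> (\<forall>x\<in>S. h x = f x) \<and>
        set_norm d S * fourier_moment d 2 F \<le> ennreal c \<and>
        \<bar>h (origin d)\<bar> \<le> c \<and>
        gradient_at_origin d h v \<and> norm1 d v \<le> c)}"

definition KL_pairs_bounded ::
    "real \<Rightarrow> nat \<Rightarrow> (nat \<Rightarrow> real) set \<Rightarrow>
     ((nat \<Rightarrow> real) measure \<times> (nat \<Rightarrow> real) measure) set" where
  "KL_pairs_bounded M d S = {(\<mu>, \<nu>) \<in> KL_pairs d S.
     \<exists>f. log_density_version \<mu> \<nu> f \<and> max (KB_coeff d S f) (KL \<mu> \<nu>) \<le> ereal M}"


section \<open>Neural networks and the estimator\<close>

definition nets ::
    "nat \<Rightarrow> nat \<Rightarrow> real \<Rightarrow> real \<Rightarrow> real \<Rightarrow> real \<Rightarrow> (real \<Rightarrow> real) \<Rightarrow> ((nat \<Rightarrow> real) \<Rightarrow> real) set" where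
  "nets d k a1 a2 a3 a4 \<phi> =
     {(\<lambda>x. (\<Sum>i=1..k. \<beta> i * \<phi> (dotp d (w i) x + b i)) + dotp d w0 x + b0) | \<beta> w b w0 b0.
        (\<forall>i\<in>{1..k}. max (norm1 d (w i)) \<bar>b i\<bar> \<le> a1 \<and> \<bar>\<beta> i\<bar> \<le> a2) \<and>
        \<bar>b0\<bar> \<le> a3 \<and> norm1 d w0 \<le> a4}"

definition sigmoid :: "real \<Rightarrow> real" where
  "sigmoid z = 1 / (1 + exp (- z))"

definition relu :: "real \<Rightarrow> real" where
  "relu z = max z 0"

definition nets_relu :: "nat \<Rightarrow> nat \<Rightarrow> real \<Rightarrow> ((nat \<Rightarrow> real) \<Rightarrow> real) set" where
  "nets_relu d k a = nets d k 1 (2 * inverse (real k) * a) a a relu"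

definition nets_star :: "nat \<Rightarrow> nat \<Rightarrow> (real \<Rightarrow> real) \<Rightarrow> ((nat \<Rightarrow> real) \<Rightarrow> real) set" where
  "nets_star d k \<phi> = nets d k 1 1 1 0 \<phi>"

definition growth :: "nat \<Rightarrow> real" where
  "growth k = (if k = 1 then 1 else max (ln (ln (real k))) 1)"

definition KL_estimator :: "('a \<Rightarrow> real) set \<Rightarrow> nat \<Rightarrow> (nat \<Rightarrow> 'a) \<Rightarrow> (nat \<Rightarrow> 'a) \<Rightarrow> real" where
  "KL_estimator G n x y = (SUP g\<in>G. (1 / real n) * (\<Sum>i<n. g (x i) - (exp (g (y i)) - 1)))"

definition iid_samples ::
    "'w measure \<Rightarrow> 'a measure \<Rightarrow> 'a measure \<Rightarrow> (nat \<Rightarrow> 'w \<Rightarrow> 'a) \<Rightarrow> (nat \<Rightarrow> 'w \<Rightarrow> 'a) \<Rightarrow> bool" where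
  "iid_samples P \<mu> \<nu> X Y \<longleftrightarrow> prob_space P \<and>
     prob_space.indep_vars P (case_sum (\<lambda>_. \<mu>) (\<lambda>_. \<nu>)) (case_sum X Y) (UNIV :: (nat + nat) set) \<and>
     (\<forall>i. distr P \<mu> (X i) = \<mu>) \<and> (\<forall>i. distr P \<nu> (Y i) = \<nu>)"

text \<open>The joint law of \<open>n\<close> i.i.d. draws from \<open>\<mu>\<close> and, independently, \<open>n\<close> i.i.d. draws from \<open>\<nu>\<close>.\<close>

definition sample_law ::
    "nat \<Rightarrow> 'a measure \<Rightarrow> 'a measure \<Rightarrow> ((nat \<Rightarrow> 'a) \<times> (nat \<Rightarrow> 'a)) measure" where
  "sample_law n \<mu> \<nu> = (\<Pi>\<^sub>M i\<in>{..<n}. \<mu>) \<Otimes>\<^sub>M (\<Pi>\<^sub>M i\<in>{..<n}. \<nu>)"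

end

theory Submission
  imports Defs "HOL-Real_Asymp.Real_Asymp"
begin

text \<open>
  Put \<open>J(g) = \<integral> g d\<mu> - \<integral> (exp g - 1) d\<nu>\<close>.  For bounded measurable \<open>g\<close> one has \<open>J(g) \<le> D(\<mu> \<parallel> \<nu>)\<close>, and a
  \<open>g\<close> within \<open>\<delta>\<close> of the log-density \<open>f\<close> loses at most \<open>\<delta> + (exp \<delta> - 1)\<close> (\<open>gain_le\<close>, \<open>gain_ge\<close>).  The
  estimator is the supremum over a class of networks of the empirical version of \<open>J\<close>, so its error is
  at most the price of approximating \<open>f\<close> by one network of the class plus the largest deviation, over
  the class, of two empirical means: that of \<open>g\<close> under \<open>\<mu>\<close> and that of \<open>exp g\<close> under \<open>\<nu>\<close>
  (\<open>estimator_error\<close>).  In both parts the class is replaced by a finite net in the uniform norm, which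
  turns all suprema into maxima.

  \<^bold>\<open>Risk bound.\<close>  A function with a finite Klusowski--Barron coefficient is \<open>x \<mapsto> \<integral> cos (\<omega> \<cdot> x + \<zeta>(\<omega>)) dT(\<omega>)\<close>
  for a finite measure \<open>T\<close>; this needs the polar decomposition of a complex measure, hence the
  countable additivity and finiteness of its total variation (\<open>polar_decomposition\<close>).  Taylor's formula
  with integral remainder writes the cosine as an affine function plus an integral of ReLU units whose
  total weight is the second moment of \<open>T\<close> (\<open>cos_relu_representation\<close>).  Sampling \<open>n\<close> units from the
  normalized weight leaves an error \<open>O(sqrt (d / n))\<close>, uniformly on the cube (\<open>ridge_pair_sampling\<close>):
  symmetrization bounds the expected maximal deviation by a random-sign average, the contraction
  principle removes the ReLU, and what remains is the \<open>\<ell>\<^sub>1\<close>-norm of a random sum of vectors.  No union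
  bound is taken, so there is no logarithm.  The same two tools bound the deviations of the two
  empirical means (\<open>nets_relu_deviation\<close>); contracting the exponential on the range \<open>[-6 a, 6 a]\<close> of the
  networks costs a factor \<open>exp (6 a)\<close>, and with \<open>a = log log k\<close> this is \<open>(log k)\<^sup>6\<close>; the size \<open>a\<close> of the
  class itself contributes the seventh power.  The constant in the bound may depend on \<open>M\<close> in any way,
  so one may assume \<open>log log k \<ge> 2 (M + 1)\<close>, which makes the class large enough to contain the sampled
  network.

  \<^bold>\<open>Consistency.\<close>  Networks with inner weights bounded by \<open>1\<close> are dense in the continuous functions on the
  cube (\<open>nets_star_dense\<close>): their closed span contains every \<open>cos (v \<cdot> x + \<zeta>)\<close>, for the ReLU because this
  is a Fourier integral with respect to a point mass, for the sigmoid because differentiating in the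
  bias produces all powers of \<open>\<sigma>(w \<cdot> x)\<close> and hence all continuous functions of \<open>w \<cdot> x\<close>; then the
  Stone--Weierstrass theorem applies.  The networks in the \<open>n\<close>-th class satisfy
  \<open>exp g = O(n\<^bsup>(1 - \<rho>) / 2\<^esup>)\<close>, and \<open>n\<^bsup>O(log n)\<^esup>\<close> of them form a net of mesh \<open>O(log n / n)\<close>.
  Hoeffding's inequality and a union bound give summable probabilities for a maximal deviation above
  \<open>n\<^bsup>- \<rho> / 4\<^esup>\<close>, and the Borel--Cantelli lemma concludes.
\<close>

section \<open>Polar decomposition of complex measures\<close>

lemma complex_measure_sums:
  assumes "complex_measure B F" "range A \<subseteq> sets B" "disjoint_family A"
  shows "(\<lambda>i. F (A i)) sums F (\<Union>i. A i)"
  using assms unfolding complex_measure_def by blast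

lemma complex_measure_empty:
  assumes "complex_measure B F"
  shows "F {} = 0"
proof -
  have "(\<lambda>i::nat. F {}) sums F (\<Union>i::nat. {})"
    by (rule complex_measure_sums[OF assms]) (auto simp: disjoint_family_on_def)
  then have "(\<lambda>i::nat. F {}) \<longlonglongrightarrow> 0"
    by (intro summable_LIMSEQ_zero) (auto simp: sums_iff)
  then show ?thesis by (simp add: LIMSEQ_const_iff)
qed

lemma complex_measure_Un:
  assumes F: "complex_measure B F" and "X \<in> sets B" "Y \<in> sets B" "X \<inter> Y = {}"
  shows "F (X \<union> Y) = F X + F Y"
proof -
  define A where "A i = (if i = 0 then X else if i = 1 then Y else {})" for i :: nat
  have "(\<lambda>i. F (A i)) sums F (\<Union>i. A i)"
    using assms by (intro complex_measure_sums[OF F]) (auto simp: A_def disjoint_family_on_def)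
  moreover have "(\<lambda>i. F (A i)) sums (\<Sum>i\<in>{0,1}. F (A i))"
    by (rule sums_finite) (auto simp: A_def complex_measure_empty[OF F])
  moreover have "(\<Union>i. A i) = X \<union> Y"
    by (auto simp: A_def split: if_splits intro: exI[of _ "0::nat"] exI[of _ "1::nat"])
  ultimately show ?thesis by (simp add: sums_unique2 A_def)
qed

lemma complex_measure_UN:
  assumes F: "complex_measure B F" and "finite S" "\<And>j. C j \<in> sets B" "disjoint_family C"
  shows "F (\<Union>j\<in>S. C j) = (\<Sum>j\<in>S. F (C j))"
  using assms(2)
proof (induction S rule: finite_induct)
  case empty
  then show ?case by (simp add: complex_measure_empty[OF F])
next
  case (insert x S)
  have "C x \<inter> C j = {}" if "j \<in> S" for j
    using insert.hyps that by (intro disjoint_family_onD[OF assms(4)]) auto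
  then have "C x \<inter> (\<Union>j\<in>S. C j) = {}" by blast
  then have "F (C x \<union> (\<Union>j\<in>S. C j)) = F (C x) + F (\<Union>j\<in>S. C j)"
    using assms(3) insert.hyps by (intro complex_measure_Un[OF F]) auto
  then show ?case using insert by simp
qed

definition partitions :: "'a measure \<Rightarrow> 'a set \<Rightarrow> (nat \<Rightarrow> 'a set) set" where
  "partitions B E = {A. range A \<subseteq> sets B \<and> disjoint_family A \<and> (\<Union>i. A i) = E}"

text \<open>The set function underlying \<^const>\<open>total_variation\<close>, before it is known to be a measure.\<close>

definition variation :: "'a measure \<Rightarrow> ('a set \<Rightarrow> complex) \<Rightarrow> 'a set \<Rightarrow> ennreal" where
  "variation B F E = (SUP A\<in>partitions B E. \<Sum>i. ennreal (cmod (F (A i))))"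

lemma variation_upper:
  "A \<in> partitions B E \<Longrightarrow> (\<Sum>i. ennreal (cmod (F (A i)))) \<le> variation B F E"
  unfolding variation_def by (rule SUP_upper)

lemma trivial_partition:
  "E \<in> sets B \<Longrightarrow> (\<lambda>i. if i = 0 then E else {}) \<in> partitions B E"
  by (auto simp: partitions_def disjoint_family_on_def split: if_splits)

lemma suminf_first: "(\<And>i. i > 0 \<Longrightarrow> f i = 0) \<Longrightarrow> (\<Sum>i. f i :: ennreal) = f 0"
  by (subst suminf_finite[of "{0}"]) auto

lemma norm_le_variation:
  assumes "complex_measure B F" "E \<in> sets B"
  shows "ennreal (cmod (F E)) \<le> variation B F E"
proof -
  have "(\<Sum>i. ennreal (cmod (F (if i = (0::nat) then E else {})))) = ennreal (cmod (F E))"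
    by (subst suminf_first) (simp_all add: complex_measure_empty[OF assms(1)])
  then show ?thesis
    using variation_upper[OF trivial_partition[OF assms(2)], of F] by simp
qed

lemma variation_empty:
  assumes "complex_measure B F"
  shows "variation B F {} = 0"
proof -
  have "(\<Sum>i. ennreal (cmod (F (A i)))) = 0" if "A \<in> partitions B {}" for A
  proof -
    have "A i = {}" for i using that by (auto simp: partitions_def)
    then show ?thesis by (simp add: complex_measure_empty[OF assms])
  qed
  then show ?thesis unfolding variation_def
    by (intro antisym SUP_least zero_le) (simp only: order_refl)
qed

lemma variation_mono:
  assumes F: "complex_measure B F" and "D \<in> sets B" "E \<in> sets B" "D \<subseteq> E"
  shows "variation B F D \<le> variation B F E"
  unfolding variation_def[of B F D]
proof (rule SUP_least)
  fix C assume C: "C \<in> partitions B D"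
  have Cs: "\<And>i. C i \<in> sets B" "\<And>i. C i \<subseteq> D" using C by (auto simp: partitions_def)
  let ?C = "\<lambda>i. case i of 0 \<Rightarrow> E - D | Suc i \<Rightarrow> C i"
  have "disjoint_family ?C"
    unfolding disjoint_family_on_def
  proof (intro ballI impI)
    fix m n :: nat assume "m \<noteq> n"
    then show "?C m \<inter> ?C n = {}"
      using C Cs(2) by (cases m; cases n) (auto simp: partitions_def disjoint_family_on_def)
  qed
  moreover have "(\<Union>i. ?C i) = E"
  proof -
    have "(\<Union>i. ?C i) = ?C 0 \<union> (\<Union>i. ?C (Suc i))"
      by (metis UNIV_nat_eq UN_insert image_image)
    also have "(\<Union>i. ?C (Suc i)) = D" using C by (auto simp: partitions_def)
    finally show ?thesis using assms(4) by auto
  qed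
  moreover have "range ?C \<subseteq> sets B"
    using assms(2,3) Cs(1) by (auto split: nat.splits)
  ultimately have P: "?C \<in> partitions B E" by (simp add: partitions_def)
  have "(\<Sum>i. ennreal (cmod (F (C i)))) \<le> (\<Sum>i. ennreal (cmod (F (?C i))))"
    by (subst suminf_offset[of "\<lambda>i. ennreal (cmod (F (?C i)))" 1]) (auto)
  also have "\<dots> \<le> variation B F E" by (rule variation_upper[OF P])
  finally show "(\<Sum>i. ennreal (cmod (F (C i)))) \<le> variation B F E" .
qed

lemma ennreal_norm_le_suminf_norm:
  fixes f :: "nat \<Rightarrow> complex"
  assumes "f sums s"
  shows "ennreal (cmod s) \<le> (\<Sum>i. ennreal (cmod (f i)))"
proof (cases "summable (\<lambda>i. cmod (f i))")
  case True
  then have "(\<Sum>i. ennreal (cmod (f i))) = ennreal (\<Sum>i. cmod (f i))"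
    by (intro suminf_ennreal2) auto
  moreover have "cmod s \<le> (\<Sum>i. cmod (f i))"
    using summable_norm[OF True] assms by (simp add: sums_iff)
  ultimately show ?thesis by (simp add: ennreal_leI)
next
  case False
  then have "(\<Sum>i. ennreal (cmod (f i))) = \<top>"
    by (intro summable_iff_suminf_neq_top) auto
  then show ?thesis by (simp only: top_greatest)
qed

lemma suminf_ennreal_swap:
  fixes f :: "nat \<Rightarrow> nat \<Rightarrow> ennreal"
  shows "(\<Sum>i. \<Sum>j. f i j) = (\<Sum>j. \<Sum>i. f i j)"
  using nn_integral_suminf[of "\<lambda>j i. f i j" "count_space UNIV"]
  by (simp add: nn_integral_count_space_nat)

text \<open>For \<open>\<ge>\<close>, a partition of the union is cut along the \<open>E\<^sub>i\<close>; for \<open>\<le>\<close>, nearly optimal partitions of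
  the \<open>E\<^sub>i\<close> are merged into one partition of the union.\<close>

lemma variation_suminf:
  assumes F: "complex_measure B F" and E: "range E \<subseteq> sets B" "disjoint_family E"
  shows "(\<Sum>i. variation B F (E i)) = variation B F (\<Union>i. E i)"
proof (rule antisym)
  have Es: "\<And>i. E i \<in> sets B" using E(1) by auto
  let ?U = "\<Union>i. E i"
  have U: "?U \<in> sets B" using Es by auto
  show "variation B F ?U \<le> (\<Sum>i. variation B F (E i))"
    unfolding variation_def[of B F ?U]
  proof (rule SUP_least)
    fix C assume C: "C \<in> partitions B ?U"
    have Cs: "\<And>i. C i \<in> sets B" using C by (auto simp: partitions_def)
    have "(\<Sum>j. ennreal (cmod (F (C j)))) \<le> (\<Sum>j. \<Sum>i. ennreal (cmod (F (C j \<inter> E i))))"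
    proof (rule suminf_le)
      fix j
      have "disjoint_family (\<lambda>i. C j \<inter> E i)"
        by (rule disjoint_family_on_bisimulation[OF E(2)]) auto
      then have "(\<lambda>i. F (C j \<inter> E i)) sums F (\<Union>i. C j \<inter> E i)"
        using Es Cs by (intro complex_measure_sums[OF F]) auto
      moreover have "(\<Union>i. C j \<inter> E i) = C j" using C by (auto simp: partitions_def)
      ultimately show "ennreal (cmod (F (C j))) \<le> (\<Sum>i. ennreal (cmod (F (C j \<inter> E i))))"
        using ennreal_norm_le_suminf_norm by metis
    qed auto
    also have "\<dots> = (\<Sum>i. \<Sum>j. ennreal (cmod (F (C j \<inter> E i))))" by (rule suminf_ennreal_swap)
    also have "\<dots> \<le> (\<Sum>i. variation B F (E i))"
    proof (rule suminf_le)
      fix i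
      have "(\<lambda>j. C j \<inter> E i) \<in> partitions B (E i)"
        unfolding partitions_def
      proof (intro CollectI conjI)
        have "disjoint_family C" using C by (simp add: partitions_def)
        then show "disjoint_family (\<lambda>j. C j \<inter> E i)"
          by (rule disjoint_family_on_bisimulation) auto
        have "E i \<subseteq> (\<Union>j. C j)" using C by (auto simp: partitions_def)
        then show "(\<Union>j. C j \<inter> E i) = E i" by blast
      qed (use Es Cs in auto)
      then show "(\<Sum>j. ennreal (cmod (F (C j \<inter> E i)))) \<le> variation B F (E i)"
        by (rule variation_upper)
    qed auto
    finally show "(\<Sum>j. ennreal (cmod (F (C j)))) \<le> (\<Sum>i. variation B F (E i))" .
  qed
  show "(\<Sum>i. variation B F (E i)) \<le> variation B F ?U"
  proof (cases "variation B F ?U = \<infinity>")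
    case False
    show ?thesis
    proof (rule ennreal_le_epsilon)
      fix e :: real assume e: "0 < e"
      have fin: "variation B F (E i) \<noteq> \<infinity>" for i
        using variation_mono[OF F Es[of i] U UN_upper] False by (auto simp: top_unique)
      have "\<exists>G\<in>partitions B (E i).
          variation B F (E i) < (\<Sum>j. ennreal (cmod (F (G j)))) + ennreal (e * (1/2)^Suc i)" for i
        using trivial_partition[OF Es[of i]] fin[of i] e
        by (intro SUP_approx_ennreal) (auto simp: variation_def)
      then obtain G where G: "\<And>i. G i \<in> partitions B (E i)"
        and le: "\<And>i. variation B F (E i) < (\<Sum>j. ennreal (cmod (F (G i j)))) + ennreal (e * (1/2)^Suc i)"
        by metis
      let ?H = "\<lambda>n. case prod_decode n of (i, j) \<Rightarrow> G i j"
      have H: "?H \<in> partitions B ?U"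
        unfolding partitions_def
      proof (intro CollectI conjI)
        have "G i j \<in> sets B" for i j using G[of i] by (auto simp: partitions_def)
        then show "range ?H \<subseteq> sets B" by (auto split: prod.splits)
        show "disjoint_family ?H"
          unfolding disjoint_family_on_def
        proof (intro ballI impI)
          fix m n :: nat assume "m \<noteq> n"
          obtain i j i' j' where d: "prod_decode m = (i, j)" "prod_decode n = (i', j')"
            by (metis surj_pair)
          have ne: "(i, j) \<noteq> (i', j')" using d \<open>m \<noteq> n\<close> by (metis prod_decode_inverse)
          have sub: "G i j \<subseteq> E i" "G i' j' \<subseteq> E i'" using G by (auto simp: partitions_def)
          show "?H m \<inter> ?H n = {}"
          proof (cases "i = i'")
            case True
            then have "j \<noteq> j'" using ne by simp
            moreover have "disjoint_family (G i)" using G[of i] by (simp add: partitions_def)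
            ultimately have "G i j \<inter> G i j' = {}" by (intro disjoint_family_onD) auto
            then show ?thesis using True d by simp
          next
            case False
            then have "E i \<inter> E i' = {}" by (intro disjoint_family_onD[OF E(2)]) auto
            then show ?thesis using sub d by auto
          qed
        qed
        have "(\<Union>n. ?H n) = (\<Union>p\<in>range prod_decode. case p of (i, j) \<Rightarrow> G i j)" by (auto)
        also have "\<dots> = (\<Union>i. \<Union>j. G i j)" by (auto simp: surj_prod_decode)
        also have "\<dots> = ?U" using G by (auto simp: partitions_def)
        finally show "(\<Union>n. ?H n) = ?U" .
      qed
      have "(\<Sum>i. variation B F (E i))
          \<le> (\<Sum>i. (\<Sum>j. ennreal (cmod (F (G i j)))) + ennreal (e * (1/2)^Suc i))"
        using le by (intro suminf_le) (auto intro: less_imp_le)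
      also have "\<dots> = (\<Sum>i. \<Sum>j. ennreal (cmod (F (G i j)))) + (\<Sum>i. ennreal (e * (1/2)^Suc i))"
        by (subst suminf_add) auto
      also have "(\<Sum>i. ennreal (e * (1/2)^Suc i)) = ennreal e"
        using sums_mult[OF power_half_series, of e] e
        by (intro suminf_ennreal_eq) auto
      also have "(\<Sum>i. \<Sum>j. ennreal (cmod (F (G i j)))) = (\<Sum>n. ennreal (cmod (F (?H n))))"
        by (subst suminf_ennreal_2dimen[symmetric,
              where f = "\<lambda>p. ennreal (cmod (F (case p of (i, j) \<Rightarrow> G i j)))"]) (auto)
      also have "\<dots> \<le> variation B F ?U" by (rule variation_upper[OF H])
      finally show "(\<Sum>i. variation B F (E i)) \<le> variation B F ?U + ennreal e"
        by (simp add: add_mono)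
    qed
  qed auto
qed

lemma sets_total_variation [measurable_cong, simp]: "sets (total_variation B F) = sets B"
  by (simp add: total_variation_def)

lemma space_total_variation [simp]: "space (total_variation B F) = space B"
  by (simp add: total_variation_def)

lemma emeasure_total_variation:
  assumes F: "complex_measure B F" and E: "E \<in> sets B"
  shows "emeasure (total_variation B F) E = variation B F E"
proof (rule emeasure_measure_of)
  show "total_variation B F = measure_of (space B) (sets B) (variation B F)"
    by (simp add: total_variation_def variation_def[abs_def] partitions_def)
  show "sets B \<subseteq> Pow (space B)" using sets.space_closed .
  show "E \<in> sets (total_variation B F)" using E by simp
  show "positive (sets (total_variation B F)) (variation B F)"
    by (simp add: positive_def variation_empty[OF F])
  show "countably_additive (sets (total_variation B F)) (variation B F)"
    by (auto simp: countably_additive_def intro!: variation_suminf[OF F])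
qed

text \<open>One of the four sums over the positive and negative parts of the real and imaginary parts
  carries a quarter of the total modulus.\<close>

lemma subset_sum_norm_ge:
  fixes z :: "nat \<Rightarrow> complex"
  assumes "finite S"
  shows "\<exists>T\<subseteq>S. (\<Sum>j\<in>S. cmod (z j)) \<le> 4 * cmod (\<Sum>j\<in>T. z j)"
proof -
  let ?T = "\<lambda>p. {j\<in>S. 0 \<le> p (z j)}"
  have *: "(\<Sum>j\<in>S. max 0 (p (z j))) \<le> cmod (\<Sum>j\<in>?T p. z j)"
    if p: "linear p" "\<And>w. \<bar>p w\<bar> \<le> cmod w" for p :: "complex \<Rightarrow> real"
  proof -
    have "(\<Sum>j\<in>S. max 0 (p (z j))) = (\<Sum>j\<in>?T p. p (z j))"
      using assms by (intro sum.mono_neutral_cong_right) (auto simp: max_def)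
    also have "\<dots> = p (\<Sum>j\<in>?T p. z j)" by (simp add: linear_sum[OF p(1)])
    also have "\<dots> \<le> cmod (\<Sum>j\<in>?T p. z j)" using p(2) abs_le_D1 by blast
    finally show ?thesis .
  qed
  have lin: "linear Re" "linear Im" "linear (\<lambda>w. - Re w)" "linear (\<lambda>w. - Im w)"
    by (auto intro!: linearI)
  have le: "cmod w \<le> max 0 (Re w) + max 0 (- Re w) + max 0 (Im w) + max 0 (- Im w)" for w
    using cmod_le[of w] by (auto simp: max_def abs_if split: if_splits)
  have "(\<Sum>j\<in>S. cmod (z j)) \<le> (\<Sum>j\<in>S. max 0 (Re (z j)) + max 0 (- Re (z j))
      + max 0 (Im (z j)) + max 0 (- Im (z j)))"
    by (intro sum_mono le)
  also have "\<dots> \<le> cmod (\<Sum>j\<in>?T Re. z j) + cmod (\<Sum>j\<in>?T (\<lambda>w. - Re w). z j)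
      + cmod (\<Sum>j\<in>?T Im. z j) + cmod (\<Sum>j\<in>?T (\<lambda>w. - Im w). z j)"
    unfolding sum.distrib
    by (intro add_mono * lin) (auto simp: abs_Re_le_cmod abs_Im_le_cmod)
  finally have sum4: "(\<Sum>j\<in>S. cmod (z j)) \<le> \<dots>" .
  have "\<exists>T\<in>{?T Re, ?T (\<lambda>w. - Re w), ?T Im, ?T (\<lambda>w. - Im w)}.
      (\<Sum>j\<in>S. cmod (z j)) \<le> 4 * cmod (\<Sum>j\<in>T. z j)"
  proof (rule ccontr)
    assume "\<not> ?thesis"
    then have "4 * cmod (\<Sum>j\<in>?T Re. z j) < (\<Sum>j\<in>S. cmod (z j))"
      "4 * cmod (\<Sum>j\<in>?T (\<lambda>w. - Re w). z j) < (\<Sum>j\<in>S. cmod (z j))"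
      "4 * cmod (\<Sum>j\<in>?T Im. z j) < (\<Sum>j\<in>S. cmod (z j))"
      "4 * cmod (\<Sum>j\<in>?T (\<lambda>w. - Im w). z j) < (\<Sum>j\<in>S. cmod (z j))"
      by (auto simp: not_le)
    then show False using sum4 by linarith
  qed
  then obtain T where "T \<in> {?T Re, ?T (\<lambda>w. - Re w), ?T Im, ?T (\<lambda>w. - Im w)}"
    and T: "(\<Sum>j\<in>S. cmod (z j)) \<le> 4 * cmod (\<Sum>j\<in>T. z j)" by blast
  then have "T \<subseteq> S" by blast
  then show ?thesis using T by blast
qed

text \<open>A finite part of a partition with large total modulus contains a union \<open>A\<close> with \<open>|F(A)| > 1 + |F(E)|\<close>.
  Then \<open>|F(A)| > 1\<close> and \<open>|F(E - A)| > 1\<close>, and one of the two sets has infinite variation.\<close>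

lemma infinite_variation_split:
  assumes F: "complex_measure B F" and E: "E \<in> sets B" and inf: "variation B F E = \<infinity>"
  shows "\<exists>D. D \<in> sets B \<and> variation B F D = \<infinity> \<and> D \<subseteq> E \<and> 1 < cmod (F (E - D))"
proof -
  let ?t = "4 * (1 + cmod (F E))"
  have "ennreal ?t < variation B F E" using inf by simp
  then obtain C where C: "C \<in> partitions B E" and lt: "ennreal ?t < (\<Sum>i. ennreal (cmod (F (C i))))"
    unfolding variation_def less_SUP_iff by blast
  then obtain n where n: "ennreal ?t < (\<Sum>i<n. ennreal (cmod (F (C i))))"
    unfolding suminf_eq_SUP less_SUP_iff by blast
  then have n: "?t < (\<Sum>i<n. cmod (F (C i)))"
    by (subst (asm) sum_ennreal) (simp_all add: ennreal_less_iff del: ennreal_plus)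
  obtain T where T: "T \<subseteq> {..<n}" "(\<Sum>i<n. cmod (F (C i))) \<le> 4 * cmod (\<Sum>i\<in>T. F (C i))"
    using subset_sum_norm_ge[of "{..<n}" "\<lambda>i. F (C i)"] by auto
  have [simp]: "finite T" using T(1) finite_subset by blast
  have Cs: "\<And>i. C i \<in> sets B" "disjoint_family C" using C by (auto simp: partitions_def)
  define A where "A = (\<Union>i\<in>T. C i)"
  have A: "A \<in> sets B" "A \<subseteq> E" using Cs C by (auto simp: A_def partitions_def)
  have FA: "F A = (\<Sum>i\<in>T. F (C i))"
    unfolding A_def by (rule complex_measure_UN[OF F]) (use Cs in auto)
  have gt: "1 + cmod (F E) < cmod (F A)" using n T(2) unfolding FA by argo
  have sum: "F E = F A + F (E - A)"
    using complex_measure_Un[OF F A(1), of "E - A"] E A by (auto simp: Un_absorb1)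
  have "cmod (F A) \<le> cmod (F E) + cmod (F (E - A))"
    using sum norm_triangle_ineq4[of "F E" "F (E - A)"] by simp
  then have gt2: "1 < cmod (F (E - A))" using gt by linarith
  have "variation B F E = variation B F A + variation B F (E - A)"
    using plus_emeasure[of A "total_variation B F" "E - A"] A E
    by (simp add: emeasure_total_variation[OF F] Un_absorb1)
  then consider "variation B F A = \<infinity>" | "variation B F (E - A) = \<infinity>"
    using inf by (metis ennreal_add_eq_top infinity_ennreal_def)
  then show ?thesis
  proof cases
    case 1
    then show ?thesis using A gt2 by (intro exI[of _ A]) auto
  next
    case 2
    have "E - (E - A) = A" using A by auto
    moreover have "1 < cmod (F A)" using gt norm_ge_zero[of "F E"] by linarith
    ultimately show ?thesis using A E 2 by (intro exI[of _ "E - A"]) auto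
  qed
qed

text \<open>If the variation of \<open>F\<close> were infinite, infinite pieces could be split off again and again, each
  time leaving behind a set \<open>A\<close> with \<open>|F(A)| > 1\<close>; these sets are disjoint, which contradicts the
  convergence of the series in the definition of a complex measure.\<close>

lemma finite_total_variation:
  assumes F: "complex_measure B F"
  shows "finite_measure (total_variation B F)"
proof
  show "emeasure (total_variation B F) (space (total_variation B F)) \<noteq> \<infinity>"
  proof
    assume "emeasure (total_variation B F) (space (total_variation B F)) = \<infinity>"
    then have inf: "variation B F (space B) = \<infinity>" by (simp add: emeasure_total_variation[OF F])
    let ?P = "\<lambda>(n::nat) D. D \<in> sets B \<and> variation B F D = \<infinity>"
    have "\<exists>D. ?P 0 D" using inf by (intro exI[of _ "space B"]) auto
    moreover have "\<exists>D'. ?P (Suc n) D' \<and> (D' \<subseteq> D \<and> 1 < cmod (F (D - D')))" if "?P n D" for D n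
      using infinite_variation_split[OF F, of D] that by auto
    ultimately obtain D where D: "\<And>n. D n \<in> sets B"
      and sub: "\<And>n. D (Suc n) \<subseteq> D n" and gt: "\<And>n. 1 < cmod (F (D n - D (Suc n)))"
      using dependent_nat_choice[of ?P "\<lambda>n D D'. D' \<subseteq> D \<and> 1 < cmod (F (D - D'))"] by blast
    have dec: "decseq D" using sub by (rule decseq_SucI)
    have "disjoint_family (\<lambda>n. D n - D (Suc n))"
      unfolding disjoint_family_on_def
    proof (intro ballI impI)
      fix m n :: nat assume "m \<noteq> n"
      then consider "Suc m \<le> n" | "Suc n \<le> m" by linarith
      then show "(D m - D (Suc m)) \<inter> (D n - D (Suc n)) = {}"
        by cases (use decseqD[OF dec] in blast)+
    qed
    then have "(\<lambda>n. F (D n - D (Suc n))) sums F (\<Union>n. D n - D (Suc n))"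
      using D by (intro complex_measure_sums[OF F]) auto
    then have "(\<lambda>n. F (D n - D (Suc n))) \<longlonglongrightarrow> 0"
      by (intro summable_LIMSEQ_zero) (auto simp: sums_iff)
    then have "eventually (\<lambda>n. dist (F (D n - D (Suc n))) 0 < 1) sequentially"
      by (rule tendstoD) simp
    then obtain n where "cmod (F (D n - D (Suc n))) < 1"
      by (auto simp: eventually_sequentially dist_norm)
    then show False using gt[of n] by linarith
  qed
qed


text \<open>For the real or imaginary part \<open>p\<close>, adding \<open>|F|\<close> turns \<open>p \<circ> F\<close> into a finite positive measure that is
  absolutely continuous with respect to \<open>|F|\<close>, so that no Hahn decomposition has to be made.\<close>

lemma complex_measure_component_density:
  assumes F: "complex_measure B F" and p: "bounded_linear p" "\<And>w::complex. \<bar>p w\<bar> \<le> cmod w"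
  shows "\<exists>g. integrable (total_variation B F) g \<and>
    (\<forall>A\<in>sets B. p (F A) = (LINT w:A|total_variation B F. (g w :: real)))"
proof -
  let ?T = "total_variation B F"
  interpret T: finite_measure ?T by (rule finite_total_variation[OF F])
  interpret p: bounded_linear p by (rule p(1))
  have le: "cmod (F A) \<le> measure ?T A" if "A \<in> sets B" for A
    using norm_le_variation[OF F that] that
    by (simp add: emeasure_total_variation[OF F, symmetric] T.emeasure_eq_measure)
  define m where "m A = ennreal (p (F A) + measure ?T A)" for A
  have nn: "0 \<le> p (F A) + measure ?T A" if "A \<in> sets B" for A
    using le[OF that] p(2)[of "F A"] by linarith
  define N where "N = measure_of (space B) (sets B) m"
  have setsN [simp, measurable_cong]: "sets N = sets B" by (simp add: N_def)
  have emN: "emeasure N A = m A" if "A \<in> sets B" for A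
  proof (rule emeasure_measure_of[OF N_def])
    show "sets B \<subseteq> Pow (space B)" using sets.space_closed .
    show "A \<in> sets N" using that by simp
    show "positive (sets N) m"
      by (simp add: positive_def m_def complex_measure_empty[OF F] p.zero)
    show "countably_additive (sets N) m"
      unfolding countably_additive_def
    proof (intro allI impI)
      fix A :: "nat \<Rightarrow> 'a set" assume A: "range A \<subseteq> sets N" "disjoint_family A"
      have "(\<lambda>i. p (F (A i))) sums p (F (\<Union>i. A i))"
        using A by (intro p.sums complex_measure_sums[OF F]) auto
      moreover have "(\<lambda>i. measure ?T (A i)) sums measure ?T (\<Union>i. A i)"
        using A by (intro T.finite_measure_UNION) auto
      ultimately have "(\<lambda>i. p (F (A i)) + measure ?T (A i)) sums (p (F (\<Union>i. A i)) + measure ?T (\<Union>i. A i))"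
        by (rule sums_add)
      then show "(\<Sum>i. m (A i)) = m (\<Union> (range A))"
        unfolding m_def using A nn by (intro suminf_ennreal_eq) auto
    qed
  qed
  have spN: "space N = space B" using setsN by (rule sets_eq_imp_space_eq)
  interpret N: finite_measure N
    by standard (simp add: spN emN m_def)
  have ac: "absolutely_continuous ?T N"
    unfolding absolutely_continuous_def
  proof
    fix A assume "A \<in> null_sets ?T"
    then have "A \<in> sets B" "measure ?T A = 0" by (auto simp: measure_def)
    then show "A \<in> null_sets N"
      using le[of A] by (auto simp: null_sets_def emN m_def p.zero)
  qed
  obtain D where D [measurable]: "D \<in> borel_measurable ?T"
    and RN: "AE x in ?T. RN_deriv ?T N x = ennreal (D x)" and D0: "\<And>x. 0 \<le> D x"
    using T.real_RN_deriv[OF N.finite_measure_axioms ac] by auto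
  have dens: "N = density ?T (\<lambda>x. ennreal (D x))"
    using T.density_RN_deriv[OF ac] density_cong[OF _ _ RN] by simp
  have eq: "p (F A) + measure ?T A = (LINT w:A|?T. D w)" and int: "set_integrable ?T A D"
    if A: "A \<in> sets B" for A
  proof -
    have nni: "(\<integral>\<^sup>+w. ennreal (indicator A w *\<^sub>R D w) \<partial>?T) = ennreal (p (F A) + measure ?T A)"
    proof -
      have "ennreal (p (F A) + measure ?T A) = emeasure (density ?T (\<lambda>x. ennreal (D x))) A"
        using emN[OF A] dens by (simp add: m_def)
      also have "\<dots> = (\<integral>\<^sup>+w. ennreal (D w) * indicator A w \<partial>?T)"
        using A by (subst emeasure_density) auto
      also have "\<dots> = (\<integral>\<^sup>+w. ennreal (indicator A w *\<^sub>R D w) \<partial>?T)"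
        by (intro nn_integral_cong) (auto split: split_indicator)
      finally show ?thesis by simp
    qed
    have [measurable]: "A \<in> sets ?T" using A by simp
    show "set_integrable ?T A D"
      unfolding set_integrable_def using nni D0
      by (intro integrableI_nn_integral_finite[where x = "p (F A) + measure ?T A"]) (auto simp: nn[OF A])
    have "has_bochner_integral ?T (\<lambda>w. indicator A w *\<^sub>R D w) (p (F A) + measure ?T A)"
      using nni D0 nn[OF A] by (intro has_bochner_integral_nn_integral) auto
    then show "p (F A) + measure ?T A = (LINT w:A|?T. D w)"
      unfolding set_lebesgue_integral_def by (simp add: has_bochner_integral_iff)
  qed
  have intD: "integrable ?T D"
    using int[of "space B"] unfolding set_integrable_def
    by (rule Bochner_Integration.integrable_cong[THEN iffD1, rotated 2]) auto
  show ?thesis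
  proof (intro exI conjI ballI)
    show "integrable ?T (\<lambda>w. D w - 1)" using intD by simp
    fix A assume A: "A \<in> sets B"
    have "(LINT w:A|?T. D w - 1) = (LINT w:A|?T. D w) - (LINT w:A|?T. 1)"
    proof (intro set_integral_diff int[OF A])
      show "set_integrable ?T A (\<lambda>_. 1 :: real)"
        unfolding set_integrable_def using A T.integrable_const
        by (intro integrable_mult_indicator) auto
    qed
    also have "(LINT w:A|?T. (1::real)) = measure ?T A"
      using A by (simp add: set_lebesgue_integral_def)
    finally show "p (F A) = (LINT w:A|?T. D w - 1)" using eq[OF A] by simp
  qed
qed

text \<open>The density exists by Radon--Nikodym.  Averages of it over sets have modulus at most \<open>1\<close>, hence
  so does the density itself; and if its modulus were smaller than \<open>1\<close> on a set of positive measure,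
  its integral would fall short of the total variation.\<close>

lemma polar_decomposition:
  assumes F: "complex_measure B F"
  shows "\<exists>h. h \<in> borel_measurable B \<and> (\<forall>w\<in>space B. cmod (h w) = 1) \<and>
     (\<forall>A\<in>sets B. F A = (LINT w:A|total_variation B F. h w))"
proof -
  let ?T = "total_variation B F"
  interpret T: finite_measure ?T by (rule finite_total_variation[OF F])
  obtain g1 where g1: "integrable ?T g1" "\<And>A. A \<in> sets B \<Longrightarrow> Re (F A) = (LINT w:A|?T. g1 w)"
    using complex_measure_component_density[OF F bounded_linear_Re] abs_Re_le_cmod by blast
  obtain g2 where g2: "integrable ?T g2" "\<And>A. A \<in> sets B \<Longrightarrow> Im (F A) = (LINT w:A|?T. g2 w)"
    using complex_measure_component_density[OF F bounded_linear_Im] abs_Im_le_cmod by blast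
  define h where "h w = Complex (g1 w) (g2 w)" for w
  have h_eq: "h = (\<lambda>w. complex_of_real (g1 w) + \<i> * complex_of_real (g2 w))"
    by (auto simp: h_def complex_eq_iff)
  have inth: "integrable ?T h" unfolding h_eq using g1 g2 by (intro Bochner_Integration.integrable_add integrable_mult_right integrable_of_real) auto
  have Fh: "F A = (LINT w:A|?T. h w)" if A: "A \<in> sets B" for A
  proof -
    have "set_integrable ?T A h"
      using inth A unfolding set_integrable_def by (intro integrable_mult_indicator) auto
    then have "Re (LINT w:A|?T. h w) = Re (F A)" "Im (LINT w:A|?T. h w) = Im (F A)"
      using g1(2)[OF A] g2(2)[OF A] unfolding set_lebesgue_integral_def set_integrable_def
      by (auto simp: h_def simp flip: integral_Re integral_Im)
    then show ?thesis by (simp add: complex_eq_iff)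
  qed
  have le: "cmod (F A) \<le> measure ?T A" if "A \<in> sets B" for A
    using norm_le_variation[OF F that] that
    by (simp add: emeasure_total_variation[OF F, symmetric] T.emeasure_eq_measure)
  have h1: "AE w in ?T. h w \<in> cball 0 1"
  proof (rule T.averaging_theorem[OF inth closed_cball])
    fix A assume A: "A \<in> sets ?T" "0 < measure ?T A"
    then show "(1 / measure ?T A) *\<^sub>R (LINT w:A|?T. h w) \<in> cball 0 1"
      using le[of A] by (simp flip: Fh add: field_simps)
  qed
  have tv_le: "emeasure ?T (space B) \<le> (\<integral>\<^sup>+w. ennreal (cmod (h w)) \<partial>?T)"
    unfolding emeasure_total_variation[OF F sets.top] variation_def
  proof (rule SUP_least)
    fix A assume A: "A \<in> partitions B (space B)"
    have As: "\<And>i. A i \<in> sets B" "disjoint_family A" "(\<Union>i. A i) = space B"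
      using A by (auto simp: partitions_def)
    have "(\<Sum>i. ennreal (cmod (F (A i)))) \<le> (\<Sum>i. \<integral>\<^sup>+w. ennreal (cmod (h w)) * indicator (A i) w \<partial>?T)"
    proof (rule suminf_le)
      fix i
      have "integrable ?T (\<lambda>w. indicator (A i) w *\<^sub>R h w)"
        using inth As by (intro integrable_mult_indicator) auto
      then have "ennreal (cmod (F (A i))) \<le> (\<integral>\<^sup>+w. ennreal (cmod (indicator (A i) w *\<^sub>R h w)) \<partial>?T)"
        unfolding Fh[OF As(1)] set_lebesgue_integral_def
        by (rule integral_norm_bound_ennreal)
      also have "\<dots> = (\<integral>\<^sup>+w. ennreal (cmod (h w)) * indicator (A i) w \<partial>?T)"
        by (intro nn_integral_cong) (auto split: split_indicator)
      finally show "ennreal (cmod (F (A i))) \<le> \<dots>" .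
    qed auto
    also have "\<dots> = (\<integral>\<^sup>+w. (\<Sum>i. ennreal (cmod (h w)) * indicator (A i) w) \<partial>?T)"
      using inth As by (subst nn_integral_suminf) auto
    also have "\<dots> = (\<integral>\<^sup>+w. ennreal (cmod (h w)) \<partial>?T)"
    proof (intro nn_integral_cong)
      fix w assume "w \<in> space ?T"
      then have "(\<Sum>i. indicator (A i) w :: ennreal) = 1"
        using suminf_indicator[OF As(2), of w] As(3) by simp
      then show "(\<Sum>i. ennreal (cmod (h w)) * indicator (A i) w) = ennreal (cmod (h w))" by simp
    qed
    finally show "(\<Sum>i. ennreal (cmod (F (A i)))) \<le> (\<integral>\<^sup>+w. ennreal (cmod (h w)) \<partial>?T)" .
  qed
  have "AE w in ?T. 1 - cmod (h w) = 0"
  proof (subst integral_nonneg_eq_0_iff_AE[symmetric])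
    show int: "integrable ?T (\<lambda>w. 1 - cmod (h w))"
      using inth by (intro Bochner_Integration.integrable_diff T.integrable_const integrable_norm)
    show nn: "AE w in ?T. 0 \<le> 1 - cmod (h w)" using h1 by (auto simp: dist_norm)
    have "(\<integral>w. cmod (h w) \<partial>?T) \<ge> measure ?T (space B)"
    proof -
      have "(\<integral>\<^sup>+w. ennreal (cmod (h w)) \<partial>?T) = ennreal (\<integral>w. cmod (h w) \<partial>?T)"
        using inth by (intro nn_integral_eq_integral) auto
      then show ?thesis using tv_le by (simp add: T.emeasure_eq_measure)
    qed
    moreover have "(\<integral>w. 1 - cmod (h w) \<partial>?T) = measure ?T (space B) - (\<integral>w. cmod (h w) \<partial>?T)"
      using inth by (subst Bochner_Integration.integral_diff) auto
    moreover have "(\<integral>w. 1 - cmod (h w) \<partial>?T) \<ge> 0" using nn by (rule integral_nonneg_AE)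
    ultimately show "(\<integral>w. 1 - cmod (h w) \<partial>?T) = 0" by linarith
  qed
  then have ae: "AE w in ?T. h w = (if cmod (h w) = 1 then h w else 1)" by auto
  have hm [measurable]: "h \<in> borel_measurable B" using inth by simp
  show ?thesis
  proof (intro exI[of _ "\<lambda>w. if cmod (h w) = 1 then h w else 1"] conjI ballI)
    show "(\<lambda>w. if cmod (h w) = 1 then h w else 1) \<in> borel_measurable B" by measurable
    fix A assume A: "A \<in> sets B"
    show "F A = (LINT w:A|?T. if cmod (h w) = 1 then h w else 1)"
      unfolding Fh[OF A] set_lebesgue_integral_def
    proof (rule integral_cong_AE)
      show "AE w in ?T. indicat_real A w *\<^sub>R h w = indicat_real A w *\<^sub>R (if cmod (h w) = 1 then h w else 1)"
        using ae by eventually_elim (auto split: if_splits)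
      have [measurable]: "A \<in> sets ?T" using A by simp
      show "(\<lambda>w. indicat_real A w *\<^sub>R h w) \<in> borel_measurable ?T" by measurable
      show "(\<lambda>w. indicat_real A w *\<^sub>R (if cmod (h w) = 1 then h w else 1)) \<in> borel_measurable ?T"
        by measurable
    qed
  qed auto
qed

lemma
  assumes "complex_measure B F"
  shows polar_density_measurable: "polar_density B F \<in> borel_measurable B"
    and polar_density_norm: "w \<in> space B \<Longrightarrow> cmod (polar_density B F w) = 1"
  using someI_ex[OF polar_decomposition[OF assms]] unfolding polar_density_def by blast+


section \<open>Averages over random signs\<close>

text \<open>The average of \<open>F e\<close> over the \<open>2\<^sup>n\<close> sign vectors \<open>e\<close> on \<open>{..<n}\<close>, continued by \<open>0\<close>.  The recursion exposes
  the last sign; symmetrization and contraction both treat one sign at a time.\<close>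

primrec rade :: "nat \<Rightarrow> ((nat \<Rightarrow> real) \<Rightarrow> real) \<Rightarrow> real" where
  "rade 0 F = F (\<lambda>_. 0)"
| "rade (Suc n) F = (rade n (\<lambda>e. F (e(n := 1))) + rade n (\<lambda>e. F (e(n := -1)))) / 2"

lemma rade_mono:
  "(\<And>e. (\<And>i. \<bar>e i\<bar> \<le> 1) \<Longrightarrow> F e \<le> G e) \<Longrightarrow> rade n F \<le> rade n G"
proof (induction n arbitrary: F G)
  case (Suc n)
  have "rade n (\<lambda>e. F (e(n := c))) \<le> rade n (\<lambda>e. G (e(n := c)))" if "\<bar>c\<bar> \<le> 1" for c
    using that by (intro Suc.IH Suc.prems) auto
  from this[of 1] this[of "-1"] show ?case by simp
qed simp

lemma rade_add: "rade n (\<lambda>e. F e + G e) = rade n F + rade n G"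
  by (induction n arbitrary: F G) (simp_all add: field_simps)

lemma rade_cmult: "rade n (\<lambda>e. c * F e) = c * rade n F"
  by (induction n arbitrary: F) (simp_all add: field_simps)

lemma rade_const [simp]: "rade n (\<lambda>e. c) = c"
  by (induction n) simp_all

lemma rade_sum: "rade n (\<lambda>e. \<Sum>j\<in>J. F j e) = (\<Sum>j\<in>J. rade n (F j))"
  by (induction J rule: infinite_finite_induct) (simp_all add: rade_add)

lemma rade_uminus: "rade n (\<lambda>e. F (\<lambda>i. - e i)) = rade n F"
proof (induction n arbitrary: F)
  case (Suc n)
  have "(\<lambda>i. - (e(n := c)) i) = (\<lambda>i. - e i)(n := - c)" for e :: "nat \<Rightarrow> real" and c
    by auto
  then show ?case
    using Suc.IH[of "\<lambda>e. F (e(n := 1))"] Suc.IH[of "\<lambda>e. F (e(n := -1))"] by simp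
qed simp

lemma rade_integrable:
  "(\<And>e. integrable N (F e)) \<Longrightarrow> integrable N (\<lambda>x. rade n (\<lambda>e. F e x))"
proof (induction n arbitrary: F)
  case (Suc n)
  then show ?case
    using Suc.IH[of "\<lambda>e. F (e(n := 1))"] Suc.IH[of "\<lambda>e. F (e(n := -1))"] by simp
qed simp

lemma sum_sign_upd:
  "(\<Sum>i<Suc n. (e(n := c)) i * a i) = (\<Sum>i<n. e i * a i) + c * (a n :: real)"
  by simp

text \<open>The offset \<open>u\<close> makes the induction work: averaging over the last sign is then the inequality between
  the arithmetic and the quadratic mean.\<close>

lemma rade_abs_sum_le: "rade n (\<lambda>e. \<bar>u + (\<Sum>i<n. e i * a i)\<bar>) \<le> sqrt (u\<^sup>2 + (\<Sum>i<n. (a i)\<^sup>2))"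
proof (induction n arbitrary: u)
  case (Suc n)
  define s where "s = (\<Sum>i<n. (a i)\<^sup>2)"
  define p q where "p = sqrt ((u + a n)\<^sup>2 + s)" and "q = sqrt ((u - a n)\<^sup>2 + s)"
  have s: "0 \<le> s" unfolding s_def by (intro sum_nonneg) auto
  have *: "rade n (\<lambda>e. \<bar>u + (\<Sum>i<Suc n. (e(n := c)) i * a i)\<bar>) \<le> sqrt ((u + c * a n)\<^sup>2 + s)" for c
    using Suc.IH[of "u + c * a n"] unfolding s_def
    by (simp only: sum_sign_upd) (simp add: algebra_simps)
  have "rade (Suc n) (\<lambda>e. \<bar>u + (\<Sum>i<Suc n. e i * a i)\<bar>) \<le> (p + q) / 2"
    using *[of 1] *[of "-1"] unfolding p_def q_def by (simp del: sum.lessThan_Suc)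
  also have "\<dots> \<le> sqrt (u\<^sup>2 + (a n)\<^sup>2 + s)"
  proof (rule real_le_rsqrt)
    have "0 \<le> (p - q)\<^sup>2" by simp
    then have "((p + q) / 2)\<^sup>2 \<le> (p\<^sup>2 + q\<^sup>2) / 2"
      by (simp add: power2_eq_square field_simps)
    also have "\<dots> = u\<^sup>2 + (a n)\<^sup>2 + s"
      using s by (simp add: p_def q_def) (simp add: power2_eq_square algebra_simps)
    finally show "((p + q) / 2)\<^sup>2 \<le> u\<^sup>2 + (a n)\<^sup>2 + s" .
  qed
  finally show ?case by (simp add: s_def algebra_simps)
qed simp

lemma Max_cmult_le:
  assumes "finite T" "T \<noteq> {}" "0 \<le> (c::real)"
  shows "(MAX t\<in>T. c * f t) \<le> c * (MAX t\<in>T. f t)"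
  using assms by (subst Max_le_iff) (auto intro!: mult_left_mono Max_ge)

lemma Max_attained:
  assumes "finite T" "T \<noteq> {}"
  obtains t where "t \<in> T" "(MAX t\<in>T. f t :: real) = f t"
proof -
  have "(MAX t\<in>T. f t) \<in> f ` T" using assms by (intro Max_in) auto
  then show thesis using that by blast
qed

lemma Max_two_point_contraction:
  fixes v \<phi> a :: "'t \<Rightarrow> real"
  assumes T: "finite T" "T \<noteq> {}"
    and le: "\<And>s t. s \<in> T \<Longrightarrow> t \<in> T \<Longrightarrow> \<bar>\<phi> s - \<phi> t\<bar> \<le> \<bar>a s - a t\<bar>"
  shows "(MAX t\<in>T. v t + \<phi> t) + (MAX t\<in>T. v t - \<phi> t) \<le> (MAX t\<in>T. v t + a t) + (MAX t\<in>T. v t - a t)"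
proof -
  obtain s where s: "s \<in> T" "(MAX t\<in>T. v t + \<phi> t) = v s + \<phi> s" using Max_attained[OF T] .
  obtain t where t: "t \<in> T" "(MAX t\<in>T. v t - \<phi> t) = v t - \<phi> t" using Max_attained[OF T] .
  have "v r + a r \<le> (MAX t\<in>T. v t + a t)" "v r - a r \<le> (MAX t\<in>T. v t - a t)" if "r \<in> T" for r
    using T that by (auto intro!: Max_ge)
  from this[OF s(1)] this[OF t(1)] show ?thesis
    unfolding s(2) t(2) using le[OF s(1) t(1)] by linarith
qed

text \<open>The Ledoux--Talagrand contraction principle: with the other signs fixed only the two values of a
  single sign matter.\<close>

lemma rade_contraction:
  fixes \<phi> a :: "nat \<Rightarrow> 't \<Rightarrow> real"
  assumes T: "finite T" "T \<noteq> {}"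
    and le: "\<And>i s t. i < n \<Longrightarrow> s \<in> T \<Longrightarrow> t \<in> T \<Longrightarrow> \<bar>\<phi> i s - \<phi> i t\<bar> \<le> \<bar>a i s - a i t\<bar>"
  shows "rade n (\<lambda>e. MAX t\<in>T. u t + (\<Sum>i<n. e i * \<phi> i t)) \<le> rade n (\<lambda>e. MAX t\<in>T. u t + (\<Sum>i<n. e i * a i t))"
  using le
proof (induction n arbitrary: u)
  case (Suc n)
  have IH: "rade n (\<lambda>e. MAX t\<in>T. w t + (\<Sum>i<n. e i * \<phi> i t)) \<le> rade n (\<lambda>e. MAX t\<in>T. w t + (\<Sum>i<n. e i * a i t))" for w
    by (rule Suc.IH) (use Suc.prems in auto)
  have split: "rade (Suc n) (\<lambda>e. MAX t\<in>T. u t + (\<Sum>i<Suc n. e i * b i t)) =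
      (rade n (\<lambda>e. MAX t\<in>T. (u t + b n t) + (\<Sum>i<n. e i * b i t)) +
       rade n (\<lambda>e. MAX t\<in>T. (u t - b n t) + (\<Sum>i<n. e i * b i t))) / 2" for b :: "nat \<Rightarrow> 't \<Rightarrow> real"
    by (simp only: rade.simps sum_sign_upd) (simp add: algebra_simps)
  have "rade n (\<lambda>e. MAX t\<in>T. (u t + \<phi> n t) + (\<Sum>i<n. e i * \<phi> i t)) +
       rade n (\<lambda>e. MAX t\<in>T. (u t - \<phi> n t) + (\<Sum>i<n. e i * \<phi> i t))
     \<le> rade n (\<lambda>e. MAX t\<in>T. (u t + \<phi> n t) + (\<Sum>i<n. e i * a i t)) +
       rade n (\<lambda>e. MAX t\<in>T. (u t - \<phi> n t) + (\<Sum>i<n. e i * a i t))"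
    by (intro add_mono IH)
  also have "\<dots> = rade n (\<lambda>e. (MAX t\<in>T. (u t + (\<Sum>i<n. e i * a i t)) + \<phi> n t) +
       (MAX t\<in>T. (u t + (\<Sum>i<n. e i * a i t)) - \<phi> n t))"
    by (simp add: rade_add algebra_simps)
  also have "\<dots> \<le> rade n (\<lambda>e. (MAX t\<in>T. (u t + (\<Sum>i<n. e i * a i t)) + a n t) +
       (MAX t\<in>T. (u t + (\<Sum>i<n. e i * a i t)) - a n t))"
    by (intro rade_mono Max_two_point_contraction T) (use Suc.prems in auto)
  also have "\<dots> = rade n (\<lambda>e. MAX t\<in>T. (u t + a n t) + (\<Sum>i<n. e i * a i t)) +
       rade n (\<lambda>e. MAX t\<in>T. (u t - a n t) + (\<Sum>i<n. e i * a i t))"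
    by (simp add: rade_add algebra_simps)
  finally show ?case unfolding split by simp
qed simp


section \<open>Symmetrization\<close>

lemma integrable_Max:
  assumes "finite T" "T \<noteq> {}" "\<And>t. t \<in> T \<Longrightarrow> integrable M (f t)"
  shows "integrable M (\<lambda>x. MAX t\<in>T. f t x :: real)"
  using assms by (induction T rule: finite_ne_induct) auto

lemma Max_integral_le:
  assumes "finite T" "T \<noteq> {}" "\<And>t. t \<in> T \<Longrightarrow> integrable M (f t)"
  shows "(MAX t\<in>T. \<integral>x. f t x \<partial>M) \<le> (\<integral>x. (MAX t\<in>T. f t x :: real) \<partial>M)"
  using assms by (subst Max_le_iff) (auto intro!: integral_mono integrable_Max Max_ge)

text \<open>Replacing the mean by an independent copy \<open>z\<close> (Jensen) gives \<open>u + g y - g z\<close>, which is the midpoint of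
  \<open>u + 2 g y\<close> and \<open>u - 2 g z\<close>; the maximum is convex, and \<open>z\<close> has the same law as \<open>y\<close>.\<close>

lemma symmetrization_step:
  fixes u :: "'t \<Rightarrow> real"
  assumes "prob_space M" and T: "finite T" "T \<noteq> {}" and g: "\<And>t. t \<in> T \<Longrightarrow> integrable M (g t)"
  shows "(\<integral>y. (MAX t\<in>T. u t + (g t y - (\<integral>z. g t z \<partial>M))) \<partial>M) \<le>
    (\<integral>y. ((MAX t\<in>T. u t + 2 * g t y) + (MAX t\<in>T. u t - 2 * g t y)) / 2 \<partial>M)"
proof -
  interpret prob_space M by fact
  note int = integrable_Max[OF T]
  have 1: "(MAX t\<in>T. u t + (g t y - (\<integral>z. g t z \<partial>M))) \<le>
    ((MAX t\<in>T. u t + 2 * g t y) + (\<integral>z. (MAX t\<in>T. u t - 2 * g t z) \<partial>M)) / 2" for y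
  proof -
    have "(MAX t\<in>T. u t + (g t y - (\<integral>z. g t z \<partial>M))) =
        (MAX t\<in>T. \<integral>z. ((u t + 2 * g t y) + (u t - 2 * g t z)) / 2 \<partial>M)"
      using T g by (intro arg_cong[where f = Max] image_cong) (auto simp: prob_space field_simps)
    also have "\<dots> \<le> (\<integral>z. (MAX t\<in>T. ((u t + 2 * g t y) + (u t - 2 * g t z)) / 2) \<partial>M)"
      using g by (intro Max_integral_le T) auto
    also have "\<dots> \<le> (\<integral>z. ((MAX t\<in>T. u t + 2 * g t y) + (MAX t\<in>T. u t - 2 * g t z)) / 2 \<partial>M)"
    proof (intro integral_mono)
      fix z
      show "(MAX t\<in>T. ((u t + 2 * g t y) + (u t - 2 * g t z)) / 2) \<le>
          ((MAX t\<in>T. u t + 2 * g t y) + (MAX t\<in>T. u t - 2 * g t z)) / 2"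
      proof -
        have "((u t + 2 * g t y) + (u t - 2 * g t z)) / 2 \<le>
            ((MAX t\<in>T. u t + 2 * g t y) + (MAX t\<in>T. u t - 2 * g t z)) / 2" if "t \<in> T" for t
          using T that by (intro divide_right_mono add_mono Max_ge) auto
        then show ?thesis using T by (subst Max_le_iff) blast+
      qed
    qed (use g in \<open>auto intro!: int Bochner_Integration.integrable_add integrable_const\<close>)
    also have "\<dots> = ((MAX t\<in>T. u t + 2 * g t y) + (\<integral>z. (MAX t\<in>T. u t - 2 * g t z) \<partial>M)) / 2"
      using g by (simp add: prob_space Bochner_Integration.integral_add int)
    finally show ?thesis .
  qed
  have "(\<integral>y. (MAX t\<in>T. u t + (g t y - (\<integral>z. g t z \<partial>M))) \<partial>M) \<le>
    (\<integral>y. ((MAX t\<in>T. u t + 2 * g t y) + (\<integral>z. (MAX t\<in>T. u t - 2 * g t z) \<partial>M)) / 2 \<partial>M)"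
    using 1 g by (intro integral_mono) (auto intro!: int integrable_divide Bochner_Integration.integrable_add)
  also have "\<dots> = (\<integral>y. ((MAX t\<in>T. u t + 2 * g t y) + (MAX t\<in>T. u t - 2 * g t y)) / 2 \<partial>M)"
    using g by (simp add: prob_space Bochner_Integration.integral_add int)
  finally show ?thesis .
qed

lemma integrable_PiM_component:
  fixes f :: "'a \<Rightarrow> real"
  assumes "prob_space M" "integrable M f" "i \<in> I"
  shows "integrable (\<Pi>\<^sub>M i\<in>I. M) (\<lambda>x. f (x i))"
proof -
  have "distr (\<Pi>\<^sub>M i\<in>I. M) M (\<lambda>x. x i) = M"
    using distr_PiM_component[of I "\<lambda>_. M" i] assms by simp
  then show ?thesis
    using assms integrable_distr_eq[of "\<lambda>x. x i" "PiM I (\<lambda>_. M)" M f]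
    by (simp add: measurable_component_singleton borel_measurable_integrable)
qed

text \<open>The offset \<open>u\<close> absorbs the samples that are held fixed: first the last sample is symmetrized with the
  others in \<open>u\<close>, then the induction hypothesis applies with the last sample in \<open>u\<close>.\<close>

lemma symmetrization:
  fixes u :: "'t \<Rightarrow> real" and M :: "'a measure"
  assumes M: "prob_space M" and T: "finite T" "T \<noteq> {}" and g: "\<And>t. t \<in> T \<Longrightarrow> integrable M (g t)"
  shows "(\<integral>x. (MAX t\<in>T. u t + (\<Sum>i<n. g t (x i) - (\<integral>z. g t z \<partial>M))) \<partial>(\<Pi>\<^sub>M i\<in>{..<n}. M)) \<le>
    (\<integral>x. rade n (\<lambda>e. MAX t\<in>T. u t + (\<Sum>i<n. e i * (2 * g t (x i)))) \<partial>(\<Pi>\<^sub>M i\<in>{..<n}. M))"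
proof (induction n arbitrary: u)
  case (Suc n)
  interpret M: prob_space M by fact
  interpret S: product_sigma_finite "\<lambda>_::nat. M"
    by standard
  define P where "P = (\<Pi>\<^sub>M i\<in>{..<n}. M)"
  interpret P: prob_space P unfolding P_def by (intro prob_space_PiM M)
  interpret PM: pair_prob_space P M ..
  define m where "m t = (\<integral>z. g t z \<partial>M)" for t
  define S where "S x t = (\<Sum>i<n. g t (x i) - m t)" for x :: "nat \<Rightarrow> 'a" and t
  define R where "R w x = rade n (\<lambda>e. MAX t\<in>T. w t + (\<Sum>i<n. e i * (2 * g t (x i))))"
    for w :: "'t \<Rightarrow> real" and x :: "nat \<Rightarrow> 'a"
  have comp: "integrable P (\<lambda>x. g t (x i))" if "t \<in> T" "i < n" for t i
    using that g unfolding P_def by (intro integrable_PiM_component[OF M]) auto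
  have intS: "integrable P (\<lambda>x. S x t)" if "t \<in> T" for t
    unfolding S_def using that comp
    by (intro Bochner_Integration.integrable_sum Bochner_Integration.integrable_diff) auto
  have intA: "integrable P (\<lambda>x. \<Sum>i<n. e i * (2 * g t (x i)))" if "t \<in> T" for t e
    using that comp by (intro Bochner_Integration.integrable_sum integrable_mult_right) auto
  have intR: "integrable P (\<lambda>x. R w x)" for w
    unfolding R_def using intA
    by (intro rade_integrable integrable_Max T Bochner_Integration.integrable_add) auto
  have fstI: "integrable (P \<Otimes>\<^sub>M M) (\<lambda>p. f (fst p))" if "integrable P f" for f :: "_ \<Rightarrow> real"
    using that integrable_distr_eq[of fst "P \<Otimes>\<^sub>M M" P f] M.distr_pair_fst[of P] by simp
  have sndI: "integrable (P \<Otimes>\<^sub>M M) (\<lambda>p. f (snd p))" if "integrable M f" for f :: "_ \<Rightarrow> real"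
    using that by (intro PM.Fubini_integrable) auto
  have upd: "(\<integral>z. (MAX t\<in>T. u t + (\<Sum>i<Suc n. g t (z i) - m t)) \<partial>(\<Pi>\<^sub>M i\<in>{..<Suc n}. M)) =
      (\<integral>x. (\<integral>y. (MAX t\<in>T. (u t + S x t) + (g t y - m t)) \<partial>M) \<partial>P)"
  proof -
    interpret Q: prob_space "\<Pi>\<^sub>M i\<in>insert n {..<n}. M" by (intro prob_space_PiM M)
    have "integrable (\<Pi>\<^sub>M i\<in>insert n {..<n}. M) (\<lambda>z. MAX t\<in>T. u t + (\<Sum>i<Suc n. g t (z i) - m t))"
      using g by (intro integrable_Max T Bochner_Integration.integrable_add Bochner_Integration.integrable_sum
        Bochner_Integration.integrable_diff integrable_PiM_component[OF M] Q.integrable_const) auto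
    then show ?thesis
      unfolding lessThan_Suc P_def
      by (subst S.product_integral_insert) (auto simp: S_def algebra_simps intro!: Bochner_Integration.integral_cong)
  qed
  have upd': "(\<integral>z. rade (Suc n) (\<lambda>e. MAX t\<in>T. u t + (\<Sum>i<Suc n. e i * (2 * g t (z i)))) \<partial>(\<Pi>\<^sub>M i\<in>{..<Suc n}. M)) =
      (\<integral>x. (\<integral>y. (R (\<lambda>t. u t + 2 * g t y) x + R (\<lambda>t. u t - 2 * g t y) x) / 2 \<partial>M) \<partial>P)"
  proof -
    interpret Q: prob_space "\<Pi>\<^sub>M i\<in>insert n {..<n}. M" by (intro prob_space_PiM M)
    have int: "integrable (\<Pi>\<^sub>M i\<in>insert n {..<n}. M) (\<lambda>z. rade (Suc n) (\<lambda>e. MAX t\<in>T. u t + (\<Sum>i<Suc n. e i * (2 * g t (z i)))))"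
      using g by (intro rade_integrable integrable_Max T Bochner_Integration.integrable_add Bochner_Integration.integrable_sum
        integrable_mult_right integrable_PiM_component[OF M] Q.integrable_const) auto
    have eq: "rade (Suc n) (\<lambda>e. MAX t\<in>T. u t + (\<Sum>i<Suc n. e i * (2 * g t ((x(n := y)) i)))) =
        (R (\<lambda>t. u t + 2 * g t y) x + R (\<lambda>t. u t - 2 * g t y) x) / 2" for x y
      by (simp add: R_def algebra_simps)
    have "(\<Pi>\<^sub>M i\<in>{..<Suc n}. M) = (\<Pi>\<^sub>M i\<in>insert n {..<n}. M)" by (simp add: lessThan_Suc)
    then show ?thesis
      using S.product_integral_insert[OF _ _ int] by (simp only: eq P_def finite_lessThan lessThan_iff
        less_irrefl not_False_eq_True simp_thms)
  qed
  have int_pair: "integrable (P \<Otimes>\<^sub>M M) (\<lambda>(x, y). MAX t\<in>T. (u t + S x t) + c * (2 * g t y))" for c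
    unfolding case_prod_beta using intS g
    by (intro integrable_Max T Bochner_Integration.integrable_add fstI sndI PM.integrable_const) auto
  have int_pair': "integrable (P \<Otimes>\<^sub>M M) (\<lambda>(x, y). R (\<lambda>t. u t + c * (2 * g t y)) x)" for c
    unfolding case_prod_beta R_def using intA g
    by (intro rade_integrable integrable_Max T Bochner_Integration.integrable_add fstI sndI PM.integrable_const) auto
  have one: "(\<integral>x. \<integral>y. (MAX t\<in>T. (u t + S x t) + c * (2 * g t y)) \<partial>M \<partial>P) \<le>
      (\<integral>x. \<integral>y. R (\<lambda>t. u t + c * (2 * g t y)) x \<partial>M \<partial>P)" for c
  proof -
    have "(\<integral>x. \<integral>y. (MAX t\<in>T. (u t + S x t) + c * (2 * g t y)) \<partial>M \<partial>P) =
        (\<integral>y. \<integral>x. (MAX t\<in>T. (u t + c * (2 * g t y)) + S x t) \<partial>P \<partial>M)"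
      using PM.Fubini_integral[OF int_pair[of c]] by (simp add: algebra_simps)
    also have "\<dots> \<le> (\<integral>y. \<integral>x. R (\<lambda>t. u t + c * (2 * g t y)) x \<partial>P \<partial>M)"
    proof (rule integral_mono)
      show "integrable M (\<lambda>y. \<integral>x. (MAX t\<in>T. (u t + c * (2 * g t y)) + S x t) \<partial>P)"
        using PM.integrable_snd[OF int_pair[of c]] by (simp add: algebra_simps)
      show "integrable M (\<lambda>y. \<integral>x. R (\<lambda>t. u t + c * (2 * g t y)) x \<partial>P)"
        using PM.integrable_snd[OF int_pair'[of c]] by simp
      show "(\<integral>x. (MAX t\<in>T. (u t + c * (2 * g t y)) + S x t) \<partial>P) \<le> (\<integral>x. R (\<lambda>t. u t + c * (2 * g t y)) x \<partial>P)" for y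
        using Suc.IH[of "\<lambda>t. u t + c * (2 * g t y)"] unfolding P_def S_def R_def m_def .
    qed
    also have "\<dots> = (\<integral>x. \<integral>y. R (\<lambda>t. u t + c * (2 * g t y)) x \<partial>M \<partial>P)"
      using PM.Fubini_integral[OF int_pair'[of c]] .
    finally show ?thesis .
  qed
  have intx: "integrable P (\<lambda>x. \<integral>y. (MAX t\<in>T. (u t + S x t) + c * (2 * g t y)) \<partial>M)" for c
    using PM.integrable_fst[OF int_pair[of c]] by simp
  have intx': "integrable P (\<lambda>x. \<integral>y. R (\<lambda>t. u t + c * (2 * g t y)) x \<partial>M)" for c
    using PM.integrable_fst[OF int_pair'[of c]] by simp
  have inty: "integrable M (\<lambda>y. R (\<lambda>t. u t + c * (2 * g t y)) x)" for c x
    unfolding R_def using g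
    by (intro rade_integrable integrable_Max T Bochner_Integration.integrable_add) auto
  have inty0: "integrable M (\<lambda>y. MAX t\<in>T. w t + c * (2 * g t y))" for c w
    using g by (intro integrable_Max T Bochner_Integration.integrable_add) auto
  have int0: "integrable P (\<lambda>x. \<integral>y. (MAX t\<in>T. (u t + S x t) + (g t y - m t)) \<partial>M)"
  proof -
    have "integrable (P \<Otimes>\<^sub>M M) (\<lambda>(x, y). MAX t\<in>T. (u t + S x t) + (g t y - m t))"
      unfolding case_prod_beta using intS g
      by (intro integrable_Max T Bochner_Integration.integrable_add Bochner_Integration.integrable_diff fstI sndI PM.integrable_const) auto
    from PM.integrable_fst[OF this] show ?thesis by simp
  qed
  have "(\<integral>x. \<integral>y. (MAX t\<in>T. (u t + S x t) + (g t y - m t)) \<partial>M \<partial>P) \<le>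
      (\<integral>x. ((\<integral>y. (MAX t\<in>T. (u t + S x t) + 1 * (2 * g t y)) \<partial>M) + (\<integral>y. (MAX t\<in>T. (u t + S x t) + (-1) * (2 * g t y)) \<partial>M)) / 2 \<partial>P)"
  proof (rule integral_mono)
    show "integrable P (\<lambda>x. ((\<integral>y. (MAX t\<in>T. (u t + S x t) + 1 * (2 * g t y)) \<partial>M) + (\<integral>y. (MAX t\<in>T. (u t + S x t) + (-1) * (2 * g t y)) \<partial>M)) / 2)"
      by (intro integrable_divide Bochner_Integration.integrable_add intx)
    fix x
    have "(\<integral>y. (MAX t\<in>T. (u t + S x t) + (g t y - m t)) \<partial>M) \<le>
      (\<integral>y. ((MAX t\<in>T. (u t + S x t) + 2 * g t y) + (MAX t\<in>T. (u t + S x t) - 2 * g t y)) / 2 \<partial>M)"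
      unfolding m_def by (rule symmetrization_step[OF M T g])
    also have "\<dots> = ((\<integral>y. (MAX t\<in>T. (u t + S x t) + 1 * (2 * g t y)) \<partial>M) + (\<integral>y. (MAX t\<in>T. (u t + S x t) + (-1) * (2 * g t y)) \<partial>M)) / 2"
      using inty0[of "\<lambda>t. u t + S x t" 1] inty0[of "\<lambda>t. u t + S x t" "-1"] by simp
    finally show "(\<integral>y. (MAX t\<in>T. (u t + S x t) + (g t y - m t)) \<partial>M) \<le> \<dots>" .
  qed (rule int0)
  also have "\<dots> = ((\<integral>x. \<integral>y. (MAX t\<in>T. (u t + S x t) + 1 * (2 * g t y)) \<partial>M \<partial>P) +
      (\<integral>x. \<integral>y. (MAX t\<in>T. (u t + S x t) + (-1) * (2 * g t y)) \<partial>M \<partial>P)) / 2"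
    using intx[of 1] intx[of "-1"] by (simp only: integral_divide_zero Bochner_Integration.integral_add)
  also have "\<dots> \<le> ((\<integral>x. \<integral>y. R (\<lambda>t. u t + 1 * (2 * g t y)) x \<partial>M \<partial>P) +
      (\<integral>x. \<integral>y. R (\<lambda>t. u t + (-1) * (2 * g t y)) x \<partial>M \<partial>P)) / 2"
    by (intro divide_right_mono add_mono one) simp
  also have "\<dots> = (\<integral>x. (\<integral>y. (R (\<lambda>t. u t + 2 * g t y) x + R (\<lambda>t. u t - 2 * g t y) x) / 2 \<partial>M) \<partial>P)"
    using inty[of 1] inty[of "-1"] intx'[of 1] intx'[of "-1"] by simp
  finally show ?case unfolding upd' upd[unfolded m_def] m_def .
qed simp

text \<open>The index at which all functions vanish makes both one-sided suprema nonnegative, so that the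
  supremum of the absolute values is at most their sum.\<close>

lemma symmetrization_abs:
  fixes M :: "'a measure"
  assumes M: "prob_space M" and T: "finite T" "t0 \<in> T" and g: "\<And>t. t \<in> T \<Longrightarrow> integrable M (g t)"
    and g0: "\<And>x. x \<in> space M \<Longrightarrow> g t0 x = (0::real)"
    and bound: "\<And>x. (\<And>i. i < n \<Longrightarrow> x i \<in> space M) \<Longrightarrow> rade n (\<lambda>e. MAX t\<in>T. \<Sum>i<n. e i * g t (x i)) \<le> b"
  shows "(\<integral>x. (MAX t\<in>T. \<bar>\<Sum>i<n. g t (x i) - (\<integral>z. g t z \<partial>M)\<bar>) \<partial>(\<Pi>\<^sub>M i\<in>{..<n}. M)) \<le> 4 * b"
proof -
  interpret M: prob_space M by fact
  let ?P = "\<Pi>\<^sub>M i\<in>{..<n}. M"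
  interpret P: prob_space ?P by (intro prob_space_PiM M)
  have T': "finite T" "T \<noteq> {}" using T by auto
  let ?Z = "\<lambda>s t x. \<Sum>i<n. s * g t (x i) - (\<integral>z. s * g t z \<partial>M)"
  have half: "(\<integral>x. (MAX t\<in>T. ?Z s t x) \<partial>?P) \<le> 2 * b"
    and intZ: "integrable ?P (\<lambda>x. MAX t\<in>T. ?Z s t x)" if s: "s = 1 \<or> s = -1" for s :: real
  proof -
    show int: "integrable ?P (\<lambda>x. MAX t\<in>T. ?Z s t x)"
      using g by (intro integrable_Max T' Bochner_Integration.integrable_sum
        Bochner_Integration.integrable_diff integrable_mult_right integrable_PiM_component[OF M]) auto
    have "(\<integral>x. (MAX t\<in>T. 0 + ?Z s t x) \<partial>?P) \<le>
      (\<integral>x. rade n (\<lambda>e. MAX t\<in>T. 0 + (\<Sum>i<n. e i * (2 * (s * g t (x i))))) \<partial>?P)"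
      using g by (intro symmetrization[OF M T', where g = "\<lambda>t x. s * g t x" and u = "\<lambda>_. 0"]) auto
    also have "\<dots> \<le> (\<integral>x. 2 * b \<partial>?P)"
    proof (rule integral_mono)
      show "integrable ?P (\<lambda>x. rade n (\<lambda>e. MAX t\<in>T. 0 + (\<Sum>i<n. e i * (2 * (s * g t (x i))))))"
        using g by (intro rade_integrable integrable_Max T' Bochner_Integration.integrable_add Bochner_Integration.integrable_sum
          integrable_mult_right integrable_PiM_component[OF M] P.integrable_const) auto
      fix x assume "x \<in> space ?P"
      then have x: "\<And>i. i < n \<Longrightarrow> x i \<in> space M" by (auto simp: space_PiM PiE_iff)
      have "rade n (\<lambda>e. MAX t\<in>T. 0 + (\<Sum>i<n. e i * (2 * (s * g t (x i)))))
          = rade n (\<lambda>e. MAX t\<in>T. 2 * (\<Sum>i<n. (s * e i) * g t (x i)))"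
        by (simp add: sum_distrib_left mult_ac)
      also have "\<dots> \<le> rade n (\<lambda>e. 2 * (MAX t\<in>T. \<Sum>i<n. (s * e i) * g t (x i)))"
        by (intro rade_mono Max_cmult_le T') simp
      also have "\<dots> = 2 * rade n (\<lambda>e. MAX t\<in>T. \<Sum>i<n. (s * e i) * g t (x i))" by (rule rade_cmult)
      also have "rade n (\<lambda>e. MAX t\<in>T. \<Sum>i<n. (s * e i) * g t (x i)) = rade n (\<lambda>e. MAX t\<in>T. \<Sum>i<n. e i * g t (x i))"
        using s rade_uminus[of n "\<lambda>e. MAX t\<in>T. \<Sum>i<n. e i * g t (x i)"] by auto
      also have "\<dots> \<le> b" by (rule bound[OF x])
      finally show "rade n (\<lambda>e. MAX t\<in>T. 0 + (\<Sum>i<n. e i * (2 * (s * g t (x i))))) \<le> 2 * b" by simp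
    qed simp
    also have "\<dots> = 2 * b" by (simp add: P.prob_space)
    finally show "(\<integral>x. (MAX t\<in>T. ?Z s t x) \<partial>?P) \<le> 2 * b" by simp
  qed
  have m0: "(\<integral>z. g t0 z \<partial>M) = 0"
    using g0 by (subst Bochner_Integration.integral_cong[OF refl, of _ _ "\<lambda>_. 0"]) auto
  have "(\<integral>x. (MAX t\<in>T. \<bar>\<Sum>i<n. g t (x i) - (\<integral>z. g t z \<partial>M)\<bar>) \<partial>?P) \<le>
      (\<integral>x. (MAX t\<in>T. ?Z 1 t x) + (MAX t\<in>T. ?Z (-1) t x) \<partial>?P)"
  proof (rule integral_mono)
    show "integrable ?P (\<lambda>x. MAX t\<in>T. \<bar>\<Sum>i<n. g t (x i) - (\<integral>z. g t z \<partial>M)\<bar>)"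
      using g by (intro integrable_Max T' integrable_abs Bochner_Integration.integrable_sum
        Bochner_Integration.integrable_diff integrable_PiM_component[OF M]) auto
    show "integrable ?P (\<lambda>x. (MAX t\<in>T. ?Z 1 t x) + (MAX t\<in>T. ?Z (-1) t x))"
      by (intro Bochner_Integration.integrable_add intZ) auto
    fix x assume "x \<in> space ?P"
    then have x: "\<And>i. i < n \<Longrightarrow> x i \<in> space M" by (auto simp: space_PiM PiE_iff)
    have nn: "0 \<le> (MAX t\<in>T. ?Z s t x)" for s
    proof -
      have "?Z s t0 x = 0" using x g0 m0 by simp
      then show ?thesis using Max_ge[of "(\<lambda>t. ?Z s t x) ` T" "?Z s t0 x"] T by simp
    qed
    show "(MAX t\<in>T. \<bar>\<Sum>i<n. g t (x i) - (\<integral>z. g t z \<partial>M)\<bar>) \<le> (MAX t\<in>T. ?Z 1 t x) + (MAX t\<in>T. ?Z (-1) t x)"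
    proof (subst Max_le_iff)
      have "\<bar>\<Sum>i<n. g t (x i) - (\<integral>z. g t z \<partial>M)\<bar> \<le> (MAX t\<in>T. ?Z 1 t x) + (MAX t\<in>T. ?Z (-1) t x)"
        if t: "t \<in> T" for t
      proof -
        have "?Z 1 t x \<le> (MAX t\<in>T. ?Z 1 t x)" "?Z (-1) t x \<le> (MAX t\<in>T. ?Z (-1) t x)"
          using T t by (auto intro!: Max_ge)
        moreover have "?Z 1 t x = (\<Sum>i<n. g t (x i) - (\<integral>z. g t z \<partial>M))"
          "?Z (-1) t x = - (\<Sum>i<n. g t (x i) - (\<integral>z. g t z \<partial>M))"
          by (simp_all add: sum_negf sum_subtractf)
        ultimately show ?thesis using nn[of 1] nn[of "-1"] by linarith
      qed
      then show "\<forall>a\<in>(\<lambda>t. \<bar>\<Sum>i<n. g t (x i) - (\<integral>z. g t z \<partial>M)\<bar>) ` T.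
         a \<le> (MAX t\<in>T. ?Z 1 t x) + (MAX t\<in>T. ?Z (-1) t x)" by blast
    qed (use T in auto)
  qed
  also have "\<dots> = (\<integral>x. (MAX t\<in>T. ?Z 1 t x) \<partial>?P) + (\<integral>x. (MAX t\<in>T. ?Z (-1) t x) \<partial>?P)"
    by (intro Bochner_Integration.integral_add intZ) auto
  also have "\<dots> \<le> 2 * b + 2 * b" by (intro add_mono half) auto
  finally show ?thesis by simp
qed


section \<open>Linear forms on the cube\<close>

lemma space_euc: "space (euc d) = extensional {..<d}"
  by (auto simp: euc_def space_PiM PiE_def)

lemma cube_subset_space: "cube d \<subseteq> space (euc d)"
  by (auto simp: euc_def space_PiM cube_def)

lemma cubeD: "x \<in> cube d \<Longrightarrow> i < d \<Longrightarrow> 0 \<le> x i \<and> x i \<le> 1"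
  by (auto simp: cube_def PiE_iff)

lemma origin_in_cube: "origin d \<in> cube d"
  by (auto simp: cube_def origin_def)

lemma dotp_origin [simp]: "dotp d w (origin d) = 0"
  by (simp add: dotp_def origin_def)

lemma dotp_measurable [measurable]: "(\<lambda>x. dotp d w x) \<in> borel_measurable (euc d)"
  unfolding dotp_def euc_def by measurable

lemma dotp_measurable' [measurable]: "(\<lambda>w. dotp d w x) \<in> borel_measurable (euc d)"
  unfolding dotp_def euc_def by measurable

lemma norm1_measurable [measurable]: "norm1 d \<in> borel_measurable (euc d)"
  unfolding norm1_def[abs_def] euc_def by measurable

lemma coord_measurable_euc: "i < d \<Longrightarrow> (\<lambda>w. w i) \<in> borel_measurable (euc d)"
  unfolding euc_def by (rule measurable_component_singleton) simp

lemma norm1_nonneg [simp]: "0 \<le> norm1 d w"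
  by (simp add: norm1_def sum_nonneg)

lemma norm1_divide: "norm1 d (\<lambda>j. w j / c) = norm1 d w / \<bar>c\<bar>"
  by (simp add: norm1_def sum_divide_distrib abs_divide)

lemma norm1_uminus: "norm1 d (\<lambda>j. - w j) = norm1 d w"
  by (simp add: norm1_def)

lemma dotp_divide: "dotp d (\<lambda>j. w j / c) x = dotp d w x / c"
  by (simp add: dotp_def sum_divide_distrib)

lemma dotp_uminus: "dotp d (\<lambda>j. - w j) x = - dotp d w x"
  by (simp add: dotp_def sum_negf)

lemma abs_coord_le_norm1: "j < d \<Longrightarrow> \<bar>w j\<bar> \<le> norm1 d w"
  unfolding norm1_def by (rule member_le_sum) auto

lemma dotp_diff_le:
  assumes "\<And>i. i < d \<Longrightarrow> \<bar>x i - y i\<bar> \<le> c"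
  shows "\<bar>dotp d w x - dotp d w y\<bar> \<le> norm1 d w * c"
proof -
  have "\<bar>dotp d w x - dotp d w y\<bar> = \<bar>\<Sum>i<d. w i * (x i - y i)\<bar>"
    by (simp add: dotp_def algebra_simps sum_subtractf)
  also have "\<dots> \<le> (\<Sum>i<d. \<bar>w i\<bar> * c)"
    using assms by (intro order_trans[OF sum_abs] sum_mono) (auto simp: abs_mult intro!: mult_left_mono)
  also have "\<dots> = norm1 d w * c" by (simp add: norm1_def sum_distrib_right)
  finally show ?thesis .
qed

lemma dotp_abs_le:
  assumes "x \<in> cube d"
  shows "\<bar>dotp d w x\<bar> \<le> norm1 d w"
proof -
  have "\<bar>dotp d w x - dotp d w (origin d)\<bar> \<le> norm1 d w * 1"
    using cubeD[OF assms] by (intro dotp_diff_le) (auto simp: origin_def)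
  then show ?thesis by simp
qed

lemma cube_finite_net:
  assumes "0 < c"
  obtains N where "finite N" "N \<subseteq> cube d" "origin d \<in> N"
    "\<And>x. x \<in> cube d \<Longrightarrow> \<exists>y\<in>N. \<forall>i<d. \<bar>x i - y i\<bar> \<le> c"
proof -
  obtain m :: nat where m: "0 < m" "1 / real m < c"
    using assms ex_inverse_of_nat_less[of c] by (auto simp: inverse_eq_divide)
  let ?N = "\<Pi>\<^sub>E i\<in>{..<d}. (\<lambda>j. real j / real m) ` {..m}"
  have "\<exists>y\<in>?N. \<forall>i<d. \<bar>x i - y i\<bar> \<le> c" if x: "x \<in> cube d" for x
  proof (intro bexI[of _ "\<lambda>i\<in>{..<d}. real (nat \<lfloor>real m * x i\<rfloor>) / real m"] allI impI)
    fix i assume i: "i < d"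
    have xi: "0 \<le> x i" "x i \<le> 1" using cubeD[OF x i] by auto
    have r: "real (nat \<lfloor>real m * x i\<rfloor>) = of_int \<lfloor>real m * x i\<rfloor>" using xi by simp
    have "\<bar>real m * x i - real (nat \<lfloor>real m * x i\<rfloor>)\<bar> \<le> 1" unfolding r by linarith
    then have "\<bar>x i - real (nat \<lfloor>real m * x i\<rfloor>) / real m\<bar> \<le> 1 / real m"
      using m by (simp add: field_simps abs_le_iff)
    then show "\<bar>x i - (\<lambda>i\<in>{..<d}. real (nat \<lfloor>real m * x i\<rfloor>) / real m) i\<bar> \<le> c"
      using i m by simp
  next
    have "nat \<lfloor>real m * x i\<rfloor> \<le> m" if "i < d" for i
    proof -
      have "real m * x i \<le> real m" using cubeD[OF x that] m by (simp add: mult_left_le)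
      then show ?thesis by linarith
    qed
    then show "(\<lambda>i\<in>{..<d}. real (nat \<lfloor>real m * x i\<rfloor>) / real m) \<in> ?N" by auto
  qed
  moreover have "finite ?N" by (intro finite_PiE) auto
  moreover have "?N \<subseteq> cube d"
    unfolding cube_def using m by (intro PiE_mono) (auto simp: divide_le_eq)
  moreover have "origin d \<in> ?N" by (force simp: origin_def)
  ultimately show thesis using that by blast
qed


section \<open>Approximation by sampled ReLU units\<close>

lemma relu_nonneg [simp]: "0 \<le> relu z" by (simp add: relu_def)

lemma relu_lipschitz: "\<bar>relu y - relu z\<bar> \<le> \<bar>y - z\<bar>" by (auto simp: relu_def)

lemma relu_measurable [measurable]: "relu \<in> borel_measurable borel"
  unfolding relu_def[abs_def] by measurable

lemma continuous_on_relu [continuous_intros]: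
  "continuous_on S f \<Longrightarrow> continuous_on S (\<lambda>x. relu (f x))"
  unfolding relu_def by (intro continuous_intros)

lemma cos_relu_one_sided:
  assumes "0 \<le> y" "y \<le> r" "0 < r"
  shows "(LBINT t:{0..1}. r\<^sup>2 * (relu (y / r - t) * cos (r * t + z))) = cos z - y * sin z - cos (y + z)"
proof -
  let ?f = "\<lambda>t. r\<^sup>2 * (relu (y / r - t) * cos (r * t + z))"
  let ?G = "\<lambda>t. (y - r * t) * sin (r * t + z) - cos (r * t + z)"
  define s where "s = y / r"
  have s: "0 \<le> s" "s \<le> 1" "r * s = y" using assms by (auto simp: s_def)
  have cont: "continuous_on {0..1} ?f" by (intro continuous_intros)
  have "((\<lambda>t. r * (y - r * t) * cos (r * t + z)) has_integral (?G s - ?G 0)) {0..s}"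
  proof (rule fundamental_theorem_of_calculus[OF s(1)])
    fix t assume "t \<in> {0..s}"
    show "(?G has_vector_derivative r * (y - r * t) * cos (r * t + z)) (at t within {0..s})"
      unfolding has_real_derivative_iff_has_vector_derivative[symmetric]
      by (auto intro!: derivative_eq_intros simp: algebra_simps)
  qed
  then have 1: "(?f has_integral (?G s - ?G 0)) {0..s}"
  proof (rule has_integral_eq[rotated])
    fix t assume "t \<in> {0..s}"
    then have "relu (y / r - t) = y / r - t" by (simp add: relu_def s_def)
    moreover have "r\<^sup>2 * (y / r - t) = r * (y - r * t)"
      using assms by (simp add: power2_eq_square field_simps)
    ultimately show "r * (y - r * t) * cos (r * t + z) = ?f t" by simp
  qed
  have 2: "(?f has_integral 0) {s..1}"
    by (rule has_integral_is_0) (auto simp: relu_def s_def)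
  have "(?f has_integral (?G s - ?G 0) + 0) {0..1}"
    by (rule has_integral_combine[OF s(1) s(2) 1 2])
  then have "integral {0..1} ?f = ?G s - ?G 0 + 0" by (rule integral_unique)
  moreover have "(LBINT t:{0..1}. ?f t) = integral {0..1} ?f"
    by (intro set_borel_integral_eq_integral borel_integrable_atLeastAtMost' cont)
  ultimately show ?thesis using s by simp
qed

text \<open>Taylor's formula with integral remainder, in which \<open>\<integral>\<^sub>0\<^sup>y (y - u) g''(u) du\<close> is written with the
  positive parts \<open>(y - u)\<^sub>+\<close> and \<open>(- y - u)\<^sub>+\<close> over a range \<open>[0, r]\<close> that does not depend on \<open>y\<close>.\<close>

lemma cos_relu_representation:
  assumes "\<bar>y\<bar> \<le> r"
  shows "(LBINT t:{0..1}. r\<^sup>2 * (relu (y / r - t) * cos (r * t + z) + relu (- y / r - t) * cos (z - r * t)))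
    = cos z - y * sin z - cos (y + z)"
proof (cases "r = 0")
  case False
  then have r: "0 < r" using assms by linarith
  show ?thesis
  proof (cases "0 \<le> y")
    case True
    have "(LBINT t:{0..1}. r\<^sup>2 * (relu (y / r - t) * cos (r * t + z) + relu (- y / r - t) * cos (z - r * t)))
      = (LBINT t:{0..1}. r\<^sup>2 * (relu (y / r - t) * cos (r * t + z)))"
    proof (rule set_lebesgue_integral_cong)
      show "\<forall>t. t \<in> {0..1} \<longrightarrow> r\<^sup>2 * (relu (y / r - t) * cos (r * t + z) + relu (- y / r - t) * cos (z - r * t))
          = r\<^sup>2 * (relu (y / r - t) * cos (r * t + z))"
      proof (intro allI impI)
        fix t :: real assume "t \<in> {0..1}"
        moreover have "0 \<le> y / r" using True r by simp
        ultimately have "relu (- y / r - t) = 0" by (simp add: relu_def)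
        then show "r\<^sup>2 * (relu (y / r - t) * cos (r * t + z) + relu (- y / r - t) * cos (z - r * t))
          = r\<^sup>2 * (relu (y / r - t) * cos (r * t + z))" by simp
      qed
    qed simp
    then show ?thesis using cos_relu_one_sided[of y r z] True r assms by simp
  next
    case False
    have "(LBINT t:{0..1}. r\<^sup>2 * (relu (y / r - t) * cos (r * t + z) + relu (- y / r - t) * cos (z - r * t)))
      = (LBINT t:{0..1}. r\<^sup>2 * (relu (- y / r - t) * cos (r * t + - z)))"
    proof (rule set_lebesgue_integral_cong)
      show "\<forall>t. t \<in> {0..1} \<longrightarrow> r\<^sup>2 * (relu (y / r - t) * cos (r * t + z) + relu (- y / r - t) * cos (z - r * t))
          = r\<^sup>2 * (relu (- y / r - t) * cos (r * t + - z))"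
      proof (intro allI impI)
        fix t :: real assume "t \<in> {0..1}"
        moreover have "y / r \<le> 0" using False r by (simp add: divide_nonpos_pos)
        ultimately have "relu (y / r - t) = 0" by (simp add: relu_def)
        moreover have "cos (z - r * t) = cos (r * t + - z)" using cos_minus[of "z - r * t"] by simp
        ultimately show "r\<^sup>2 * (relu (y / r - t) * cos (r * t + z) + relu (- y / r - t) * cos (z - r * t))
          = r\<^sup>2 * (relu (- y / r - t) * cos (r * t + - z))" by simp
      qed
    qed simp
    also have "\<dots> = cos (- z) - (- y) * sin (- z) - cos (- y + - z)"
      using cos_relu_one_sided[of "- y" r "- z"] False r assms by simp
    also have "cos (- y + - z) = cos (y + z)" using cos_minus[of "y + z"] by simp
    finally show ?thesis by simp
  qed
qed (use assms in simp)

definition unit_interval :: "real measure" where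
  "unit_interval = restrict_space lborel {0..1}"

lemma space_unit_interval [simp]: "space unit_interval = {0..1}"
  by (simp add: unit_interval_def space_restrict_space)

lemma prob_space_unit_interval: "prob_space unit_interval"
  by standard (simp add: unit_interval_def emeasure_restrict_space space_restrict_space)

lemma measurable_unit_interval_ident [measurable]: "(\<lambda>t. t) \<in> borel_measurable unit_interval"
  unfolding unit_interval_def by (intro measurable_restrict_space1) simp

lemma integral_unit_interval:
  "(\<integral>t. (f t :: real) \<partial>unit_interval) = (LBINT t:{0..1}. f t)"
  unfolding unit_interval_def set_lebesgue_integral_def
  by (subst integral_restrict_space) auto

text \<open>The integrand of the representation above for \<open>y = w \<cdot> x\<close> and \<open>r = \<parallel>w\<parallel>\<^sub>1\<close>, without the factor \<open>r\<^sup>2\<close>, as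
  a function of \<open>(w, t)\<close>: two ReLU units with inner weights \<open>\<plusminus> w / \<parallel>w\<parallel>\<^sub>1\<close> and threshold \<open>t\<close>, weighted by
  cosines of the phase \<open>z w\<close> of the Fourier coefficient at \<open>w\<close>.  For \<open>w = 0\<close> division by zero makes both
  units vanish.\<close>

definition ridge_pair :: "nat \<Rightarrow> ((nat \<Rightarrow> real) \<Rightarrow> real) \<Rightarrow> (nat \<Rightarrow> real) \<Rightarrow> (nat \<Rightarrow> real) \<times> real \<Rightarrow> real" where
  "ridge_pair d z x = (\<lambda>(w, t).
     relu (dotp d w x / norm1 d w - t) * cos (norm1 d w * t + z w) +
     relu (- dotp d w x / norm1 d w - t) * cos (z w - norm1 d w * t))"

lemma abs_mult_cos_le: "\<bar>(a::real) * cos b - a' * cos b\<bar> \<le> \<bar>a - a'\<bar>"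
proof -
  have "\<bar>a * cos b - a' * cos b\<bar> = \<bar>a - a'\<bar> * \<bar>cos b\<bar>"
    by (metis abs_mult left_diff_distrib)
  also have "\<dots> \<le> \<bar>a - a'\<bar> * 1" by (intro mult_left_mono) auto
  finally show ?thesis by simp
qed

lemma ridge_pair_lipschitz:
  "\<bar>ridge_pair d z x (w, t) - ridge_pair d z y (w, t)\<bar> \<le> \<bar>2 * (dotp d w x / norm1 d w) - 2 * (dotp d w y / norm1 d w)\<bar>"
proof -
  let ?a = "dotp d w x / norm1 d w" and ?b = "dotp d w y / norm1 d w"
  have "\<bar>relu (?a - t) * cos (norm1 d w * t + z w) - relu (?b - t) * cos (norm1 d w * t + z w)\<bar> \<le> \<bar>?a - ?b\<bar>"
    using relu_lipschitz[of "?a - t" "?b - t"] by (intro order_trans[OF abs_mult_cos_le]) simp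
  moreover have "\<bar>relu (- ?a - t) * cos (z w - norm1 d w * t) - relu (- ?b - t) * cos (z w - norm1 d w * t)\<bar> \<le> \<bar>?a - ?b\<bar>"
    using relu_lipschitz[of "- ?a - t" "- ?b - t"] by (intro order_trans[OF abs_mult_cos_le]) simp
  ultimately show ?thesis unfolding ridge_pair_def by auto
qed

lemma ridge_pair_origin:
  "t \<ge> 0 \<Longrightarrow> ridge_pair d z (origin d) (w, t) = 0"
  by (simp add: ridge_pair_def relu_def)

lemma dotp_normalized_diff_le:
  assumes "\<And>i. i < d \<Longrightarrow> \<bar>x i - y i\<bar> \<le> c" "0 \<le> c"
  shows "\<bar>dotp d w x / norm1 d w - dotp d w y / norm1 d w\<bar> \<le> c"
proof (cases "norm1 d w = 0")
  case False
  then have "0 < norm1 d w" using norm1_nonneg[of d w] by linarith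
  then show ?thesis
    using dotp_diff_le[of d x y c w] assms
    by (simp add: diff_divide_distrib[symmetric] abs_divide divide_le_eq mult.commute)
qed (use assms in simp)

lemma ridge_pair_bounded:
  assumes "x \<in> cube d" "t \<in> {0..1}"
  shows "\<bar>ridge_pair d z x (w, t)\<bar> \<le> 2"
proof -
  have "\<bar>dotp d w x / norm1 d w - dotp d w (origin d) / norm1 d w\<bar> \<le> 1"
    using cubeD[OF assms(1)] by (intro dotp_normalized_diff_le) (auto simp: origin_def)
  then show ?thesis
    using ridge_pair_lipschitz[of d z x w t "origin d"] ridge_pair_origin[of t d z w] assms(2) by simp
qed

lemma sum_sqrt_le:
  assumes "\<And>j. j < d \<Longrightarrow> 0 \<le> c j"
  shows "(\<Sum>j<d. sqrt (c j)) \<le> sqrt (real d * (\<Sum>j<d. c j))"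
proof (rule real_le_rsqrt)
  have "(\<Sum>j<d. sqrt (c j) * 1)\<^sup>2 \<le> (\<Sum>j<d. (sqrt (c j))\<^sup>2) * (\<Sum>j<d. 1\<^sup>2)"
    by (rule Cauchy_Schwarz_ineq_sum)
  also have "(\<Sum>j<d. (sqrt (c j))\<^sup>2) = (\<Sum>j<d. c j)" using assms by (intro sum.cong) auto
  finally show "(\<Sum>j<d. sqrt (c j))\<^sup>2 \<le> real d * (\<Sum>j<d. c j)" by (simp add: mult.commute)
qed

text \<open>The expected supremum of a signed sum of linear forms over the cube is attained coordinatewise,
  and every coordinate is a one-dimensional random walk.\<close>

lemma rade_linear_forms:
  assumes N: "finite N" "N \<noteq> {}" "N \<subseteq> cube d" and a: "\<And>i. norm1 d (a i) \<le> 1"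
  shows "rade n (\<lambda>e. MAX x\<in>N. \<Sum>i<n. e i * dotp d (a i) x) \<le> sqrt (real d * real n)"
proof -
  have sq: "(\<Sum>j<d. (a i j)\<^sup>2) \<le> 1" for i
  proof -
    have "(a i j)\<^sup>2 \<le> \<bar>a i j\<bar>" if "j < d" for j
    proof -
      have "\<bar>a i j\<bar> \<le> 1" using abs_coord_le_norm1[OF that, of "a i"] a[of i] by linarith
      then have "\<bar>a i j\<bar> * \<bar>a i j\<bar> \<le> \<bar>a i j\<bar> * 1" by (intro mult_left_mono) auto
      then show ?thesis by (simp add: power2_eq_square abs_mult_self_eq)
    qed
    then have "(\<Sum>j<d. (a i j)\<^sup>2) \<le> norm1 d (a i)" unfolding norm1_def by (intro sum_mono) auto
    then show ?thesis using a[of i] by linarith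
  qed
  have "rade n (\<lambda>e. MAX x\<in>N. \<Sum>i<n. e i * dotp d (a i) x) \<le> rade n (\<lambda>e. \<Sum>j<d. \<bar>0 + (\<Sum>i<n. e i * a i j)\<bar>)"
  proof (rule rade_mono)
    fix e :: "nat \<Rightarrow> real"
    have "(\<Sum>i<n. e i * dotp d (a i) x) \<le> (\<Sum>j<d. \<bar>0 + (\<Sum>i<n. e i * a i j)\<bar>)" if x: "x \<in> N" for x
    proof -
      have "(\<Sum>i<n. e i * dotp d (a i) x) = (\<Sum>j<d. x j * (\<Sum>i<n. e i * a i j))"
        unfolding dotp_def sum_distrib_left by (subst sum.swap) (simp add: mult_ac)
      also have "\<dots> \<le> (\<Sum>j<d. 1 * \<bar>\<Sum>i<n. e i * a i j\<bar>)"
      proof (rule sum_mono)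
        fix j assume "j \<in> {..<d}"
        then have xj: "0 \<le> x j" "x j \<le> 1" using cubeD[of x d j] x N(3) by auto
        have "x j * (\<Sum>i<n. e i * a i j) \<le> x j * \<bar>\<Sum>i<n. e i * a i j\<bar>" using xj by (intro mult_left_mono) auto
        also have "\<dots> \<le> 1 * \<bar>\<Sum>i<n. e i * a i j\<bar>" using xj by (intro mult_right_mono) auto
        finally show "x j * (\<Sum>i<n. e i * a i j) \<le> 1 * \<bar>\<Sum>i<n. e i * a i j\<bar>" .
      qed
      finally show ?thesis by simp
    qed
    then show "(MAX x\<in>N. \<Sum>i<n. e i * dotp d (a i) x) \<le> (\<Sum>j<d. \<bar>0 + (\<Sum>i<n. e i * a i j)\<bar>)"
      using N by (subst Max_le_iff) auto
  qed
  also have "\<dots> \<le> (\<Sum>j<d. sqrt (0\<^sup>2 + (\<Sum>i<n. (a i j)\<^sup>2)))"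
    unfolding rade_sum by (intro sum_mono rade_abs_sum_le)
  also have "\<dots> \<le> sqrt (real d * (\<Sum>j<d. \<Sum>i<n. (a i j)\<^sup>2))"
    by (simp, rule sum_sqrt_le) (simp add: sum_nonneg)
  also have "(\<Sum>j<d. \<Sum>i<n. (a i j)\<^sup>2) = (\<Sum>i<n. \<Sum>j<d. (a i j)\<^sup>2)" by (rule sum.swap)
  also have "sqrt (real d * (\<Sum>i<n. \<Sum>j<d. (a i j)\<^sup>2)) \<le> sqrt (real d * (\<Sum>i<n. 1))"
    by (intro real_sqrt_le_mono mult_left_mono sum_mono sq) auto
  finally show ?thesis by simp
qed

lemma exists_le_integral:
  assumes "prob_space M" "integrable M f" "(\<integral>x. f x \<partial>M) \<le> (c::real)"
  shows "\<exists>x\<in>space M. f x \<le> c"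
proof (rule ccontr)
  interpret prob_space M by fact
  assume "\<not> ?thesis"
  then have "AE x in M. c < f x" by (auto simp: not_le)
  then have "c < (\<integral>x. f x \<partial>M)" using assms(2) by (intro expectation_greater)
  then show False using assms(3) by simp
qed


text \<open>Sampling \<open>(w, t)\<close> from a probability measure gives, with positive probability, an average of
  \<open>n\<close> ridge functions that is uniformly close to the mean: symmetrization, contraction and the
  linear case bound the expected deviation on a fine net, and a Lipschitz estimate extends the bound
  from the net to the cube.\<close>

lemma ridge_pair_sampling:
  fixes Q :: "((nat \<Rightarrow> real) \<times> real) measure"
  assumes Q: "prob_space Q" and sQ: "\<And>w t. (w, t) \<in> space Q \<Longrightarrow> t \<in> {0..1}"
    and meas: "\<And>x. ridge_pair d z x \<in> borel_measurable Q" and n: "1 \<le> n" and d: "1 \<le> d"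
  obtains \<theta> where "\<And>i. i < n \<Longrightarrow> \<theta> i \<in> space Q"
    "\<And>x. x \<in> cube d \<Longrightarrow> \<bar>(\<Sum>i<n. ridge_pair d z x (\<theta> i)) - real n * (\<integral>q. ridge_pair d z x q \<partial>Q)\<bar> \<le> 9 * sqrt (real d * real n)"
proof -
  interpret Q: prob_space Q by fact
  interpret P: prob_space "\<Pi>\<^sub>M i\<in>{..<n}. Q" by (intro prob_space_PiM Q)
  let ?\<psi> = "ridge_pair d z"
  let ?m = "\<lambda>x. \<integral>q. ?\<psi> x q \<partial>Q"
  \<comment> \<open>Passing from the net to the cube costs \<open>4 c\<close> for each sample, in total \<open>sqrt (d n)\<close>.\<close>
  define c where "c = sqrt (real d * real n) / (4 * real n)"
  have c: "0 < c" using n d by (simp add: c_def)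
  obtain N where N: "finite N" "N \<subseteq> cube d" "origin d \<in> N"
    and net: "\<And>x. x \<in> cube d \<Longrightarrow> \<exists>y\<in>N. \<forall>i<d. \<bar>x i - y i\<bar> \<le> c"
    using cube_finite_net[OF c] by blast
  have int: "integrable Q (?\<psi> x)" if "x \<in> cube d" for x
  proof (rule Q.integrable_const_bound[of _ 2])
    show "AE q in Q. norm (?\<psi> x q) \<le> 2"
    proof (rule AE_I2)
      fix q assume "q \<in> space Q"
      then show "norm (?\<psi> x q) \<le> 2" using ridge_pair_bounded[OF that sQ] by (cases q) auto
    qed
  qed (rule meas)
  have lip: "\<bar>?\<psi> x q - ?\<psi> y q\<bar> \<le> 2 * c" if "\<forall>i<d. \<bar>x i - y i\<bar> \<le> c" for x y q
  proof (cases q)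
    case (Pair w t)
    then show ?thesis
      using ridge_pair_lipschitz[of d z x w t y] dotp_normalized_diff_le[of d x y c w] that c by auto
  qed
  have rad: "rade n (\<lambda>e. MAX x\<in>N. \<Sum>i<n. e i * ?\<psi> x (\<theta> i)) \<le> 2 * sqrt (real d * real n)"
    for \<theta> :: "nat \<Rightarrow> (nat \<Rightarrow> real) \<times> real"
  proof -
    let ?a = "\<lambda>i j. fst (\<theta> i) j / norm1 d (fst (\<theta> i))"
    have "rade n (\<lambda>e. MAX x\<in>N. 0 + (\<Sum>i<n. e i * ?\<psi> x (\<theta> i))) \<le>
        rade n (\<lambda>e. MAX x\<in>N. 0 + (\<Sum>i<n. e i * (2 * dotp d (?a i) x)))"
    proof (rule rade_contraction)
      fix i x y
      show "\<bar>?\<psi> x (\<theta> i) - ?\<psi> y (\<theta> i)\<bar> \<le> \<bar>2 * dotp d (?a i) x - 2 * dotp d (?a i) y\<bar>"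
        using ridge_pair_lipschitz[of d z x "fst (\<theta> i)" "snd (\<theta> i)" y] by (simp add: dotp_divide)
    qed (use N in auto)
    also have "\<dots> = rade n (\<lambda>e. MAX x\<in>N. 2 * (\<Sum>i<n. e i * dotp d (?a i) x))"
      by (simp add: sum_distrib_left mult_ac)
    also have "\<dots> \<le> rade n (\<lambda>e. 2 * (MAX x\<in>N. \<Sum>i<n. e i * dotp d (?a i) x))"
      using N by (intro rade_mono Max_cmult_le) auto
    also have "\<dots> = 2 * rade n (\<lambda>e. MAX x\<in>N. \<Sum>i<n. e i * dotp d (?a i) x)" by (rule rade_cmult)
    also have "\<dots> \<le> 2 * sqrt (real d * real n)"
      using N by (intro mult_left_mono rade_linear_forms) (auto simp: norm1_divide)
    finally show ?thesis by simp
  qed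
  have "(\<integral>\<theta>. (MAX x\<in>N. \<bar>\<Sum>i<n. ?\<psi> x (\<theta> i) - ?m x\<bar>) \<partial>(\<Pi>\<^sub>M i\<in>{..<n}. Q)) \<le> 4 * (2 * sqrt (real d * real n))"
  proof (rule symmetrization_abs[OF Q N(1) N(3)])
    show "?\<psi> (origin d) q = 0" if "q \<in> space Q" for q
      using that sQ by (cases q) (auto intro!: ridge_pair_origin)
  qed (use int N rad in auto)
  moreover have "integrable (\<Pi>\<^sub>M i\<in>{..<n}. Q) (\<lambda>\<theta>. MAX x\<in>N. \<bar>\<Sum>i<n. ?\<psi> x (\<theta> i) - ?m x\<bar>)"
    using N int by (intro integrable_Max integrable_abs Bochner_Integration.integrable_sum
      Bochner_Integration.integrable_diff integrable_PiM_component[OF Q] P.integrable_const) auto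
  ultimately obtain \<theta> where \<theta>: "\<theta> \<in> space (\<Pi>\<^sub>M i\<in>{..<n}. Q)"
    and le: "(MAX x\<in>N. \<bar>\<Sum>i<n. ?\<psi> x (\<theta> i) - ?m x\<bar>) \<le> 4 * (2 * sqrt (real d * real n))"
    using exists_le_integral[OF P.prob_space_axioms] by blast
  have leN: "\<bar>\<Sum>i<n. ?\<psi> x (\<theta> i) - ?m x\<bar> \<le> 8 * sqrt (real d * real n)" if "x \<in> N" for x
    using le N that by (subst (asm) Max_le_iff) auto
  show thesis
  proof (rule that[of \<theta>])
    show "\<theta> i \<in> space Q" if "i < n" for i using \<theta> that by (auto simp: space_PiM PiE_iff)
    fix x assume x: "x \<in> cube d"
    obtain y where y: "y \<in> N" "\<forall>i<d. \<bar>x i - y i\<bar> \<le> c" using net[OF x] by blast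
    have m: "\<bar>?m x - ?m y\<bar> \<le> 2 * c"
    proof -
      have "\<bar>?m x - ?m y\<bar> = \<bar>\<integral>q. ?\<psi> x q - ?\<psi> y q \<partial>Q\<bar>"
        using int[OF x] int[of y] y N by (subst Bochner_Integration.integral_diff) auto
      also have "\<dots> \<le> (\<integral>q. \<bar>?\<psi> x q - ?\<psi> y q\<bar> \<partial>Q)" by (rule integral_abs_bound)
      also have "\<dots> \<le> (\<integral>q. 2 * c \<partial>Q)"
        using int[OF x] int[of y] y N lip[OF y(2)] by (intro integral_mono) auto
      finally show ?thesis by (simp add: Q.prob_space)
    qed
    have "\<bar>\<Sum>i<n. (?\<psi> x (\<theta> i) - ?m x) - (?\<psi> y (\<theta> i) - ?m y)\<bar> \<le> (\<Sum>i<n. 4 * c)"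
    proof (intro order_trans[OF sum_abs] sum_mono)
      fix i
      show "\<bar>(?\<psi> x (\<theta> i) - ?m x) - (?\<psi> y (\<theta> i) - ?m y)\<bar> \<le> 4 * c"
        using lip[OF y(2), of "\<theta> i"] m by linarith
    qed
    also have "\<dots> = sqrt (real d * real n)" using n by (simp add: c_def)
    finally have "\<bar>(\<Sum>i<n. ?\<psi> x (\<theta> i) - ?m x) - (\<Sum>i<n. ?\<psi> y (\<theta> i) - ?m y)\<bar> \<le> sqrt (real d * real n)"
      by (simp only: sum_subtractf)
    then have "\<bar>\<Sum>i<n. ?\<psi> x (\<theta> i) - ?m x\<bar> \<le> 9 * sqrt (real d * real n)"
      using leN[OF y(1)] by linarith
    then show "\<bar>(\<Sum>i<n. ?\<psi> x (\<theta> i)) - real n * ?m x\<bar> \<le> 9 * sqrt (real d * real n)"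
      by (simp add: sum_subtractf)
  qed
qed


text \<open>The factor \<open>\<parallel>w\<parallel>\<^sub>1\<^sup>2\<close> of the remainder becomes the density of the law from which \<open>w\<close> is drawn.\<close>

lemma integral_ridge_pair:
  fixes T :: "(nat \<Rightarrow> real) measure"
  assumes "finite_measure T" and sT [measurable_cong]: "sets T = sets (euc d)"
    and z [measurable]: "z \<in> borel_measurable (euc d)"
    and S: "S = (\<integral>w. (norm1 d w)\<^sup>2 \<partial>T)" "0 < S" and i2: "integrable T (\<lambda>w. (norm1 d w)\<^sup>2)"
    and x: "x \<in> cube d"
  defines "Q \<equiv> density T (\<lambda>w. ennreal ((norm1 d w)\<^sup>2 / S)) \<Otimes>\<^sub>M unit_interval"
  shows "prob_space Q" and "ridge_pair d z y \<in> borel_measurable Q"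
    and "S * (\<integral>q. ridge_pair d z x q \<partial>Q) =
      (\<integral>w. cos (z w) - dotp d w x * sin (z w) - cos (dotp d w x + z w) \<partial>T)"
proof -
  interpret T: finite_measure T by fact
  interpret U: prob_space unit_interval by (rule prob_space_unit_interval)
  let ?D = "density T (\<lambda>w. ennreal ((norm1 d w)\<^sup>2 / S))"
  have meas: "(\<lambda>w. ennreal ((norm1 d w)\<^sup>2 / S)) \<in> borel_measurable T" by measurable
  interpret D: prob_space ?D
  proof
    have "emeasure ?D (space ?D) = (\<integral>\<^sup>+w. ennreal ((norm1 d w)\<^sup>2 / S) \<partial>T)"
      using meas by (simp add: emeasure_density nn_set_integral_space)
    also have "\<dots> = ennreal (\<integral>w. (norm1 d w)\<^sup>2 / S \<partial>T)"
      using i2 S by (intro nn_integral_eq_integral) auto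
    also have "\<dots> = 1" using S by simp
    finally show "emeasure ?D (space ?D) = 1" .
  qed
  interpret PM: pair_prob_space ?D unit_interval ..
  show Q: "prob_space Q" unfolding Q_def by unfold_locales
  have [measurable_cong]: "sets ?D = sets (euc d)" using sT by simp
  have m: "ridge_pair d z y \<in> borel_measurable (?D \<Otimes>\<^sub>M unit_interval)" for y
    unfolding ridge_pair_def by measurable
  then show "ridge_pair d z y \<in> borel_measurable Q" unfolding Q_def .
  have int: "integrable (?D \<Otimes>\<^sub>M unit_interval) (ridge_pair d z x)"
  proof (rule PM.integrable_const_bound[of _ 2])
    show "AE q in ?D \<Otimes>\<^sub>M unit_interval. norm (ridge_pair d z x q) \<le> 2"
    proof (rule AE_I2)
      fix q assume "q \<in> space (?D \<Otimes>\<^sub>M unit_interval)"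
      then show "norm (ridge_pair d z x q) \<le> 2"
        using ridge_pair_bounded[OF x] by (cases q) (auto simp: space_pair_measure)
    qed
  qed (rule m)
  have inner: "(norm1 d w)\<^sup>2 * (\<integral>t. ridge_pair d z x (w, t) \<partial>unit_interval) =
      cos (z w) - dotp d w x * sin (z w) - cos (dotp d w x + z w)" for w
  proof -
    have "(norm1 d w)\<^sup>2 * (\<integral>t. ridge_pair d z x (w, t) \<partial>unit_interval) =
        (\<integral>t. (norm1 d w)\<^sup>2 * ridge_pair d z x (w, t) \<partial>unit_interval)" by simp
    also have "\<dots> = (LBINT t:{0..1}. (norm1 d w)\<^sup>2 * ridge_pair d z x (w, t))"
      by (rule integral_unit_interval)
    also have "\<dots> = cos (z w) - dotp d w x * sin (z w) - cos (dotp d w x + z w)"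
      using cos_relu_representation[OF dotp_abs_le[OF x], of w "z w"] by (simp add: ridge_pair_def)
    finally show ?thesis .
  qed
  have [measurable]: "(\<lambda>w. \<integral>t. ridge_pair d z x (w, t) \<partial>unit_interval) \<in> borel_measurable ?D"
    using m[of x] by (intro U.borel_measurable_lebesgue_integral) simp
  then have [measurable]: "(\<lambda>w. \<integral>t. ridge_pair d z x (w, t) \<partial>unit_interval) \<in> borel_measurable T" by simp
  have "(\<integral>q. ridge_pair d z x q \<partial>Q) = (\<integral>w. \<integral>t. ridge_pair d z x (w, t) \<partial>unit_interval \<partial>?D)"
    unfolding Q_def using PM.integral_fst'[OF int] by simp
  also have "\<dots> = (\<integral>w. ((norm1 d w)\<^sup>2 / S) *\<^sub>R (\<integral>t. ridge_pair d z x (w, t) \<partial>unit_interval) \<partial>T)"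
    using S(2) by (intro integral_density) auto
  also have "\<dots> = (\<integral>w. (cos (z w) - dotp d w x * sin (z w) - cos (dotp d w x + z w)) / S \<partial>T)"
    unfolding inner[symmetric] by simp
  finally show "S * (\<integral>q. ridge_pair d z x q \<partial>Q) =
      (\<integral>w. cos (z w) - dotp d w x * sin (z w) - cos (dotp d w x + z w) \<partial>T)"
    using S(2) by simp
qed

lemma integrable_norm1:
  assumes "finite_measure T" "sets T = sets (euc d)" "integrable T (\<lambda>w. (norm1 d w)\<^sup>2)"
  shows "integrable T (norm1 d)"
proof -
  interpret finite_measure T by fact
  have [measurable]: "norm1 d \<in> borel_measurable T"
    using measurable_cong_sets[OF assms(2) refl, of borel] norm1_measurable by blast
  show ?thesis
  proof (rule Bochner_Integration.integrable_bound)
    show "integrable T (\<lambda>w. 1 + (norm1 d w)\<^sup>2)" using assms by simp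
    have "r \<le> 1 + r\<^sup>2" for r :: real
    proof -
      have "0 \<le> (r - 1/2)\<^sup>2" by simp
      then show ?thesis by (simp add: power2_eq_square algebra_simps)
    qed
    then show "AE w in T. norm (norm1 d w) \<le> norm (1 + (norm1 d w)\<^sup>2)" by auto
  qed measurable
qed

lemma integrable_first_moment:
  assumes "finite_measure T" and sT [measurable_cong]: "sets T = sets (euc d)"
    and i2: "integrable T (\<lambda>w. (norm1 d w)\<^sup>2)"
    and [measurable]: "f \<in> borel_measurable (euc d)" "g \<in> borel_measurable (euc d)"
    and f: "\<And>w. \<bar>f w\<bar> \<le> norm1 d w" and g: "\<And>w. \<bar>g w\<bar> \<le> (1::real)"
  shows "integrable T (\<lambda>w. f w * g w)"
proof (rule Bochner_Integration.integrable_bound[OF integrable_norm1[OF assms(1-3)]])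
  show "AE w in T. norm (f w * g w) \<le> norm (norm1 d w)"
  proof (rule AE_I2)
    fix w
    have "\<bar>f w\<bar> * \<bar>g w\<bar> \<le> norm1 d w * 1" using f g by (intro mult_mono) auto
    then show "norm (f w * g w) \<le> norm (norm1 d w)" by (simp add: abs_mult)
  qed
qed measurable

text \<open>The affine part is the first-order Taylor polynomial at the origin, and the remainder is a mixture of
  pairs of units with total weight \<open>S\<close>, from which \<open>n\<close> pairs are sampled.\<close>

lemma fourier_relu_approximation:
  fixes T :: "(nat \<Rightarrow> real) measure" and n :: nat
  assumes T: "finite_measure T" and sT [measurable_cong]: "sets T = sets (euc d)"
    and z [measurable]: "z \<in> borel_measurable (euc d)"
    and S: "S = (\<integral>w. (norm1 d w)\<^sup>2 \<partial>T)" and i2: "integrable T (\<lambda>w. (norm1 d w)\<^sup>2)"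
    and n: "1 \<le> n" and d: "1 \<le> d"
  shows "\<exists>c1 c2 a t. (\<forall>i<n. \<bar>c1 i\<bar> \<le> 1 \<and> \<bar>c2 i\<bar> \<le> 1 \<and> norm1 d (a i) \<le> 1 \<and> 0 \<le> t i \<and> t i \<le> 1) \<and>
    (\<forall>x\<in>cube d. \<bar>(\<integral>w. cos (dotp d w x + z w) \<partial>T) -
       ((\<integral>w. cos (z w) \<partial>T) - (\<Sum>j<d. (\<integral>w. w j * sin (z w) \<partial>T) * x j)
        - S / n * (\<Sum>i<n. c1 i * relu (dotp d (a i) x - t i) + c2 i * relu (dotp d (\<lambda>j. - a i j) x - t i)))\<bar>
      \<le> 9 * S * sqrt (d / n))"
proof -
  interpret T: finite_measure T by fact
  define D where "D x = (\<integral>w. cos (z w) - dotp d w x * sin (z w) - cos (dotp d w x + z w) \<partial>T)" for x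
  have D: "D x = (\<integral>w. cos (z w) \<partial>T) - (\<Sum>j<d. (\<integral>w. w j * sin (z w) \<partial>T) * x j) - (\<integral>w. cos (dotp d w x + z w) \<partial>T)"
    if x: "x \<in> cube d" for x
  proof -
    have cosi: "integrable T (\<lambda>w. cos (z w))" "integrable T (\<lambda>w. cos (dotp d w x + z w))"
      by (intro T.integrable_const_bound[of _ 1]; auto)+
    have sini: "integrable T (\<lambda>w. dotp d w x * sin (z w))"
      using dotp_abs_le[OF x] by (intro integrable_first_moment[OF T sT i2]) auto
    have coordi: "integrable T (\<lambda>w. w j * sin (z w))" if "j < d" for j
      using abs_coord_le_norm1[OF that] coord_measurable_euc[OF that]
      by (intro integrable_first_moment[OF T sT i2]) auto
    have "(\<integral>w. dotp d w x * sin (z w) \<partial>T) = (\<integral>w. (\<Sum>j<d. (w j * sin (z w)) * x j) \<partial>T)"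
      unfolding dotp_def sum_distrib_right by (simp only: mult_ac)
    also have "\<dots> = (\<Sum>j<d. (\<integral>w. w j * sin (z w) \<partial>T) * x j)"
      using coordi by (subst Bochner_Integration.integral_sum) auto
    finally show ?thesis
      unfolding D_def using cosi sini by simp
  qed
  have "\<exists>c1 c2 a t. (\<forall>i<n. \<bar>c1 i\<bar> \<le> 1 \<and> \<bar>c2 i\<bar> \<le> 1 \<and> norm1 d (a i) \<le> 1 \<and> 0 \<le> t i \<and> t i \<le> (1::real)) \<and>
    (\<forall>x\<in>cube d. \<bar>S / n * (\<Sum>i<n. c1 i * relu (dotp d (a i) x - t i) + c2 i * relu (dotp d (\<lambda>j. - a i j) x - t i)) - D x\<bar>
      \<le> 9 * S * sqrt (d / n))"
  proof (cases "S = 0")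
    case True
    have "AE w in T. (norm1 d w)\<^sup>2 = 0"
      using True i2 unfolding S by (subst (asm) integral_nonneg_eq_0_iff_AE) auto
    then have ae: "AE w in T. norm1 d w = 0" by simp
    have "D x = 0" if x: "x \<in> cube d" for x
    proof -
      have "D x = (\<integral>w. 0 \<partial>T)"
        unfolding D_def
      proof (rule integral_cong_AE)
        show "AE w in T. cos (z w) - dotp d w x * sin (z w) - cos (dotp d w x + z w) = 0"
          using ae
        proof eventually_elim
          case (elim w)
          then have "dotp d w x = 0" using dotp_abs_le[OF x, of w] by simp
          then show ?case by simp
        qed
      qed auto
      then show ?thesis by simp
    qed
    then show ?thesis using True by (intro exI[of _ "\<lambda>_. 0"] exI[of _ "\<lambda>_ _. 0"]) (auto simp: norm1_def)
  next
    case False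
    have "0 \<le> S" unfolding S by (rule integral_nonneg_AE) auto
    then have S0: "0 < S" using False by simp
    define Q where "Q = density T (\<lambda>w. ennreal ((norm1 d w)\<^sup>2 / S)) \<Otimes>\<^sub>M unit_interval"
    note Q = integral_ridge_pair[OF T sT z S S0 i2, folded Q_def]
    have "t \<in> {0..1}" if "(w, t) \<in> space Q" for w t
      using that unfolding Q_def by (auto simp: space_pair_measure)
    note samp = ridge_pair_sampling[where z = z, OF Q(1)[OF origin_in_cube] this Q(2)[OF origin_in_cube] n d]
    obtain \<theta> where \<theta>: "\<And>i. i < n \<Longrightarrow> \<theta> i \<in> space Q"
      and le: "\<And>x. x \<in> cube d \<Longrightarrow> \<bar>(\<Sum>i<n. ridge_pair d z x (\<theta> i)) - real n * (\<integral>q. ridge_pair d z x q \<partial>Q)\<bar> \<le> 9 * sqrt (real d * real n)"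
      by (rule samp) blast+
    define r where "r i = norm1 d (fst (\<theta> i))" for i
    show ?thesis
    proof (intro exI conjI ballI allI impI)
      fix i assume i: "i < n"
      show "\<bar>cos (r i * snd (\<theta> i) + z (fst (\<theta> i)))\<bar> \<le> 1" "\<bar>cos (z (fst (\<theta> i)) - r i * snd (\<theta> i))\<bar> \<le> 1"
        by auto
      show "norm1 d (\<lambda>j. fst (\<theta> i) j / r i) \<le> 1" by (simp add: norm1_divide r_def)
      show "0 \<le> snd (\<theta> i)" "snd (\<theta> i) \<le> 1" using \<theta>[OF i] unfolding Q_def by (auto simp: space_pair_measure)
    next
      fix x assume x: "x \<in> cube d"
      have dx: "D x = S * (\<integral>q. ridge_pair d z x q \<partial>Q)" unfolding D_def by (rule Q(3)[OF x, symmetric])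
      have eq: "(\<Sum>i<n. ridge_pair d z x (\<theta> i)) =
        (\<Sum>i<n. cos (r i * snd (\<theta> i) + z (fst (\<theta> i))) * relu (dotp d (\<lambda>j. fst (\<theta> i) j / r i) x - snd (\<theta> i)) +
          cos (z (fst (\<theta> i)) - r i * snd (\<theta> i)) * relu (dotp d (\<lambda>j. - (fst (\<theta> i) j / r i)) x - snd (\<theta> i)))"
        by (intro sum.cong refl) (simp add: ridge_pair_def case_prod_beta r_def dotp_divide dotp_uminus mult.commute)
      have "\<bar>S / n * (\<Sum>i<n. ridge_pair d z x (\<theta> i)) - D x\<bar> =
          S / n * \<bar>(\<Sum>i<n. ridge_pair d z x (\<theta> i)) - real n * (\<integral>q. ridge_pair d z x q \<partial>Q)\<bar>"
      proof -
        have "S / n * (\<Sum>i<n. ridge_pair d z x (\<theta> i)) - D x =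
            S / n * ((\<Sum>i<n. ridge_pair d z x (\<theta> i)) - real n * (\<integral>q. ridge_pair d z x q \<partial>Q))"
          using n by (simp add: dx right_diff_distrib)
        then show ?thesis using S0 by (simp add: abs_mult)
      qed
      also have "\<dots> \<le> S / n * (9 * sqrt (real d * real n))"
        using S0 le[OF x] by (intro mult_left_mono) auto
      also have "\<dots> = 9 * S * sqrt (d / n)"
      proof -
        have "sqrt (real d * real n) / real n = sqrt (real d / real n)"
          using n by (simp add: real_sqrt_mult real_sqrt_divide field_simps)
        then show ?thesis by (metis (no_types, opaque_lifting) mult.assoc mult.commute times_divide_eq_right)
      qed
      finally show "\<bar>S / n * (\<Sum>i<n. cos (r i * snd (\<theta> i) + z (fst (\<theta> i))) * relu (dotp d (\<lambda>j. fst (\<theta> i) j / r i) x - snd (\<theta> i)) +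
          cos (z (fst (\<theta> i)) - r i * snd (\<theta> i)) * relu (dotp d (\<lambda>j. - (fst (\<theta> i) j / r i)) x - snd (\<theta> i))) - D x\<bar> \<le> 9 * S * sqrt (d / n)"
        unfolding eq .
    qed
  qed
  then show ?thesis using D by (auto simp: algebra_simps) 
qed


section \<open>The variational formula\<close>

lemma KL_finite:
  assumes "KL \<mu> \<nu> < \<infinity>"
  shows "KL \<mu> \<nu> = ereal (\<integral>x. entropy_density (exp 1) \<nu> \<mu> x \<partial>\<mu>)"
    and "integrable \<mu> (entropy_density (exp 1) \<nu> \<mu>)"
  using assms by (auto simp: KL_def KL_divergence_def split: if_splits)

locale log_density =
  fixes \<mu> \<nu> :: "'a measure" and f :: "'a \<Rightarrow> real" and b :: real
  assumes pm: "prob_space \<mu>" and pn: "prob_space \<nu>" and sets_eq: "sets \<mu> = sets \<nu>"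
    and ac: "absolutely_continuous \<nu> \<mu>" and fin: "KL \<mu> \<nu> < \<infinity>"
    and version: "log_density_version \<mu> \<nu> f" and f_bounded: "\<And>x. x \<in> space \<nu> \<Longrightarrow> \<bar>f x\<bar> \<le> b"
begin

interpretation M: prob_space \<mu> by (rule pm)
interpretation N: prob_space \<nu> by (rule pn)

text \<open>A measurable version of the log-density; \<open>f\<close> is only known to agree with it almost everywhere.\<close>

definition f1 :: "'a \<Rightarrow> real" where "f1 = entropy_density (exp 1) \<nu> \<mu>"

text \<open>The functional whose maximum over \<open>g\<close> is the divergence; the estimator maximizes its empirical counterpart.\<close>

definition gain :: "('a \<Rightarrow> real) \<Rightarrow> real" where
  "gain g = (\<integral>x. g x \<partial>\<mu>) - (\<integral>x. exp (g x) - 1 \<partial>\<nu>)"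

lemma space_eq: "space \<mu> = space \<nu>" using sets_eq by (rule sets_eq_imp_space_eq)

lemma f1_measurable [measurable]: "f1 \<in> borel_measurable \<nu>"
  unfolding f1_def entropy_density_def[abs_def] by measurable

lemma f1_eq: "f1 x = ln (enn2real (RN_deriv \<nu> \<mu> x))"
  by (simp add: f1_def entropy_density_def log_def)

lemma AE_f1: "AE x in \<nu>. f1 x = f x"
  using version unfolding log_density_version_def
  by eventually_elim (simp add: f1_eq)

lemma AE_f1_bound: "AE x in \<nu>. \<bar>f1 x\<bar> \<le> b"
  using AE_f1 AE_space by eventually_elim (auto intro: f_bounded)

lemma mu_density: "\<mu> = density \<nu> (\<lambda>x. ennreal (exp (f1 x)))"
proof -
  have "AE x in \<nu>. RN_deriv \<nu> \<mu> x = ennreal (exp (f1 x))"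
    using version AE_f1 unfolding log_density_version_def by eventually_elim simp
  then have "density \<nu> (RN_deriv \<nu> \<mu>) = density \<nu> (\<lambda>x. ennreal (exp (f1 x)))"
    by (intro density_cong) auto
  then show ?thesis using N.density_RN_deriv[OF ac sets_eq] by simp
qed

lemma integral_mu: "g \<in> borel_measurable \<nu> \<Longrightarrow> (\<integral>x. g x \<partial>\<mu>) = (\<integral>x. exp (f1 x) * (g x :: real) \<partial>\<nu>)"
  by (subst mu_density, subst integral_density) auto

lemma integrable_exp_f1_times:
  fixes g :: "'a \<Rightarrow> real"
  assumes [measurable]: "g \<in> borel_measurable \<nu>" and g: "AE x in \<nu>. \<bar>g x\<bar> \<le> c"
  shows "integrable \<nu> (\<lambda>x. exp (f1 x) * g x)"
proof (rule N.integrable_const_bound)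
  show "AE x in \<nu>. norm (exp (f1 x) * g x) \<le> exp b * c"
    using AE_f1_bound g by eventually_elim (auto simp: abs_mult intro!: mult_mono)
qed measurable

lemma integrable_exp_bounded:
  fixes g :: "'a \<Rightarrow> real"
  assumes [measurable]: "g \<in> borel_measurable \<nu>" and g: "AE x in \<nu>. \<bar>g x\<bar> \<le> c"
  shows "integrable \<nu> (\<lambda>x. exp (g x))"
proof (rule N.integrable_const_bound)
  show "AE x in \<nu>. norm (exp (g x)) \<le> exp c"
    using g by eventually_elim auto
qed measurable

lemma integral_exp_f1: "(\<integral>x. exp (f1 x) \<partial>\<nu>) = 1"
  using integral_mu[of "\<lambda>_. 1"] by (simp add: M.prob_space)

lemma integral_exp_minus_one:
  fixes g :: "'a \<Rightarrow> real"
  assumes [measurable]: "g \<in> borel_measurable \<nu>" and g: "\<And>x. x \<in> space \<nu> \<Longrightarrow> \<bar>g x\<bar> \<le> c"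
  shows "(\<integral>x. exp (g x) - 1 \<partial>\<nu>) = (\<integral>x. exp (g x) \<partial>\<nu>) - 1"
  using integrable_exp_bounded[of g c] g by (simp add: N.prob_space)

text \<open>Pointwise \<open>g - f \<le> exp (g - f) - 1\<close>; integrating this against \<open>\<mu> = exp f \<cdot> \<nu>\<close> gives the upper
  bound, and equality holds for \<open>g = f\<close>.\<close>

lemma gain_le:
  assumes g [measurable]: "g \<in> borel_measurable \<nu>" and gb: "\<And>x. x \<in> space \<nu> \<Longrightarrow> \<bar>g x\<bar> \<le> c"
  shows "gain g \<le> real_of_ereal (KL \<mu> \<nu>)"
proof -
  have i1: "integrable \<nu> (\<lambda>x. exp (f1 x) * g x)" "integrable \<nu> (\<lambda>x. exp (f1 x) * f1 x)"
    "integrable \<nu> (\<lambda>x. exp (g x))" "integrable \<nu> (\<lambda>x. exp (f1 x))"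
    using gb by (auto intro!: integrable_exp_f1_times[OF _ AE_f1_bound] integrable_exp_f1_times[of _ c]
      integrable_exp_bounded[of _ c] integrable_exp_bounded[OF _ AE_f1_bound])
  have "(\<integral>x. g x \<partial>\<mu>) - (\<integral>x. f1 x \<partial>\<mu>) = (\<integral>x. exp (f1 x) * g x - exp (f1 x) * f1 x \<partial>\<nu>)"
    using i1 by (simp add: integral_mu)
  also have "\<dots> \<le> (\<integral>x. exp (g x) - exp (f1 x) \<partial>\<nu>)"
  proof (rule integral_mono)
    fix x
    have "exp (f1 x) * (1 + (g x - f1 x)) \<le> exp (f1 x) * exp (g x - f1 x)"
      by (intro mult_left_mono exp_ge_add_one_self) auto
    then show "exp (f1 x) * g x - exp (f1 x) * f1 x \<le> exp (g x) - exp (f1 x)"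
      by (simp add: exp_diff algebra_simps)
  qed (use i1 in auto)
  also have "\<dots> = (\<integral>x. exp (g x) - 1 \<partial>\<nu>)"
    using i1 integral_exp_minus_one[OF g gb] by (simp add: integral_exp_f1)
  finally show ?thesis
    unfolding gain_def using KL_finite(1)[OF fin] by (simp add: f1_def)
qed

text \<open>Up to null sets \<open>exp g \<le> exp f \<cdot> exp \<delta>\<close>, and \<open>\<integral> exp f d\<nu> = 1\<close>.\<close>

lemma gain_ge:
  assumes g [measurable]: "g \<in> borel_measurable \<nu>" and gb: "\<And>x. x \<in> space \<nu> \<Longrightarrow> \<bar>g x\<bar> \<le> c"
    and near: "\<And>x. x \<in> space \<nu> \<Longrightarrow> \<bar>g x - f x\<bar> \<le> \<delta>"
  shows "real_of_ereal (KL \<mu> \<nu>) \<le> gain g + (\<delta> + (exp \<delta> - 1))"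
proof -
  have near1: "AE x in \<nu>. \<bar>g x - f1 x\<bar> \<le> \<delta>"
    using AE_f1 AE_space by eventually_elim (auto intro: near)
  have i1: "integrable \<nu> (\<lambda>x. exp (f1 x) * g x)" "integrable \<nu> (\<lambda>x. exp (f1 x) * f1 x)"
    "integrable \<nu> (\<lambda>x. exp (g x))" "integrable \<nu> (\<lambda>x. exp (f1 x))"
    using gb by (auto intro!: integrable_exp_f1_times[OF _ AE_f1_bound] integrable_exp_f1_times[of _ c]
      integrable_exp_bounded[of _ c] integrable_exp_bounded[OF _ AE_f1_bound])
  have "(\<integral>x. f1 x \<partial>\<mu>) - (\<integral>x. g x \<partial>\<mu>) = (\<integral>x. exp (f1 x) * f1 x - exp (f1 x) * g x \<partial>\<nu>)"
    using i1 by (simp add: integral_mu)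
  also have "\<dots> \<le> (\<integral>x. exp (f1 x) * \<delta> \<partial>\<nu>)"
  proof (rule integral_mono_AE)
    show "AE x in \<nu>. exp (f1 x) * f1 x - exp (f1 x) * g x \<le> exp (f1 x) * \<delta>"
      using near1
    proof eventually_elim
      case (elim x)
      then have "exp (f1 x) * (f1 x - g x) \<le> exp (f1 x) * \<delta>" by (intro mult_left_mono) auto
      then show ?case by (simp add: right_diff_distrib)
    qed
  qed (use i1 in auto)
  also have "\<dots> = \<delta>" by (simp add: integral_exp_f1)
  finally have 1: "(\<integral>x. f1 x \<partial>\<mu>) - (\<integral>x. g x \<partial>\<mu>) \<le> \<delta>" .
  have "(\<integral>x. exp (g x) \<partial>\<nu>) \<le> (\<integral>x. exp (f1 x) * exp \<delta> \<partial>\<nu>)"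
  proof (rule integral_mono_AE)
    show "AE x in \<nu>. exp (g x) \<le> exp (f1 x) * exp \<delta>"
      using near1 by eventually_elim (simp add: exp_add[symmetric])
  qed (use i1 in auto)
  also have "\<dots> = exp \<delta>" by (simp add: integral_exp_f1)
  finally have "(\<integral>x. exp (g x) - 1 \<partial>\<nu>) \<le> exp \<delta> - 1"
    using integral_exp_minus_one[OF g gb] by simp
  with 1 show ?thesis
    unfolding gain_def using KL_finite(1)[OF fin] by (simp add: f1_def)
qed

end


section \<open>From uniform deviations to the error of the estimator\<close>

lemma exp_diff_le: "a \<le> c \<Longrightarrow> b \<le> c \<Longrightarrow> \<bar>exp a - exp b\<bar> \<le> exp c * \<bar>a - b :: real\<bar>"
proof (induction a b rule: linorder_wlog)
  case (le a b)
  have "1 - exp (a - b) \<le> b - a" using exp_ge_add_one_self[of "a - b"] by linarith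
  then have "exp b * (1 - exp (a - b)) \<le> exp b * (b - a)" by (intro mult_left_mono) auto
  also have "\<dots> \<le> exp c * (b - a)" using le by (intro mult_right_mono) auto
  finally show ?case using le by (simp add: exp_diff algebra_simps abs_if)
next
  case (sym a b)
  then show ?case by (simp add: abs_minus_commute)
qed

lemma abs_integral_diff_le:
  fixes a b :: "'a \<Rightarrow> real"
  assumes "integrable M a" "integrable M b"
  shows "\<bar>(\<integral>x. a x \<partial>M) - (\<integral>x. b x \<partial>M)\<bar> \<le> (\<integral>x. \<bar>a x - b x\<bar> \<partial>M)"
proof -
  have "(\<integral>x. a x \<partial>M) - (\<integral>x. b x \<partial>M) = (\<integral>x. a x - b x \<partial>M)" using assms by simp
  then show ?thesis by (simp only: integral_abs_bound)
qed

lemma abs_average_le: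
  assumes "\<And>i. i < n \<Longrightarrow> \<bar>a i - b i\<bar> \<le> (c::real)" "1 \<le> n"
  shows "\<bar>(1 / real n) * (\<Sum>i<n. a i) - (1 / real n) * (\<Sum>i<n. b i)\<bar> \<le> c"
proof -
  have "\<bar>\<Sum>i<n. a i - b i\<bar> \<le> (\<Sum>i<n. c)"
    using assms by (intro order_trans[OF sum_abs] sum_mono) auto
  then have "\<bar>(\<Sum>i<n. a i) - (\<Sum>i<n. b i)\<bar> \<le> real n * c" by (simp add: sum_subtractf)
  then have "(1 / real n) * \<bar>(\<Sum>i<n. a i) - (\<Sum>i<n. b i)\<bar> \<le> (1 / real n) * (real n * c)"
    by (intro mult_left_mono) auto
  then show ?thesis using assms(2) by (simp add: abs_mult[symmetric] right_diff_distrib[symmetric] abs_divide diff_divide_distrib[symmetric])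
qed

context log_density
begin

text \<open>The upper bound compares every network with a member of the net \<open>T\<close>, where the empirical gain is
  close to the true one, which is at most the divergence.  The lower bound follows the network \<open>h\<close>; it
  passes through the net twice, once for the empirical and once for the true gain.\<close>

lemma estimator_error:
  assumes n: "1 \<le> n" and x: "\<And>i. i < n \<Longrightarrow> x i \<in> space \<nu>" and y: "\<And>i. i < n \<Longrightarrow> y i \<in> space \<nu>"
    and G: "\<And>g. g \<in> G \<Longrightarrow> g \<in> borel_measurable \<nu>" "\<And>g x. g \<in> G \<Longrightarrow> x \<in> space \<nu> \<Longrightarrow> \<bar>g x\<bar> \<le> c"
    and T: "T \<subseteq> G" and net: "\<And>g. g \<in> G \<Longrightarrow> \<exists>t\<in>T. \<forall>x\<in>space \<nu>. \<bar>g x - t x\<bar> \<le> \<eta>"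
    and h: "h \<in> G" and near: "\<And>x. x \<in> space \<nu> \<Longrightarrow> \<bar>h x - f x\<bar> \<le> \<delta>"
    and devX: "\<And>t. t \<in> T \<Longrightarrow> \<bar>(1 / real n) * (\<Sum>i<n. t (x i)) - (\<integral>z. t z \<partial>\<mu>)\<bar> \<le> r"
    and devY: "\<And>t. t \<in> T \<Longrightarrow> \<bar>(1 / real n) * (\<Sum>i<n. exp (t (y i))) - (\<integral>z. exp (t z) \<partial>\<nu>)\<bar> \<le> s"
  shows "\<bar>KL_estimator G n x y - real_of_ereal (KL \<mu> \<nu>)\<bar> \<le> \<delta> + (exp \<delta> - 1) + r + s + 2 * (\<eta> + exp c * \<eta>)"
proof -
  interpret M: prob_space \<mu> by (rule pm)
  interpret N: prob_space \<nu> by (rule pn)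
  let ?D = "real_of_ereal (KL \<mu> \<nu>)"
  define emp where "emp g = (1 / real n) * (\<Sum>i<n. g (x i) - (exp (g (y i)) - 1))" for g :: "'a \<Rightarrow> real"
  define \<gamma> where "\<gamma> = \<eta> + exp c * \<eta>"
  have int: "integrable \<mu> g" "integrable \<nu> (\<lambda>x. exp (g x))" if "g \<in> G" for g
  proof -
    show "integrable \<mu> g"
    proof (rule M.integrable_const_bound)
      show "AE x in \<mu>. norm (g x) \<le> c" using G(2)[OF that] by (auto simp: space_eq)
      show "g \<in> borel_measurable \<mu>" using G(1)[OF that] measurable_cong_sets[OF sets_eq refl, of borel] by blast
    qed
    show "integrable \<nu> (\<lambda>x. exp (g x))"
      using G that by (intro integrable_exp_bounded[of _ c]) auto
  qed
  have expd: "\<bar>exp (g x) - exp (t x)\<bar> \<le> exp c * \<eta>"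
    if "g \<in> G" "t \<in> T" "x \<in> space \<nu>" "\<bar>g x - t x\<bar> \<le> \<eta>" for g t x
  proof -
    have "\<bar>exp (g x) - exp (t x)\<bar> \<le> exp c * \<bar>g x - t x\<bar>"
      using G(2)[of g x] G(2)[of t x] T that by (intro exp_diff_le) auto
    also have "\<dots> \<le> exp c * \<eta>" using that by (intro mult_left_mono) auto
    finally show ?thesis .
  qed
  have emp_near: "\<bar>emp g - emp t\<bar> \<le> \<gamma>" if "g \<in> G" "t \<in> T" "\<forall>x\<in>space \<nu>. \<bar>g x - t x\<bar> \<le> \<eta>" for g t
    unfolding emp_def
  proof (rule abs_average_le[OF _ n])
    fix i assume i: "i < n"
    have "\<bar>g (x i) - t (x i)\<bar> \<le> \<eta>" "\<bar>exp (g (y i)) - exp (t (y i))\<bar> \<le> exp c * \<eta>"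
      using that x[OF i] y[OF i] by (auto intro: expd)
    then show "\<bar>g (x i) - (exp (g (y i)) - 1) - (t (x i) - (exp (t (y i)) - 1))\<bar> \<le> \<gamma>"
      unfolding \<gamma>_def by linarith
  qed
  have gain_eq: "gain g = (\<integral>z. g z \<partial>\<mu>) - (\<integral>z. exp (g z) \<partial>\<nu>) + 1" if "g \<in> G" for g
    using integral_exp_minus_one[OF G(1)[OF that] G(2)[OF that]] by (simp add: gain_def)
  have gain_near: "\<bar>gain g - gain t\<bar> \<le> \<gamma>" if "g \<in> G" "t \<in> T" "\<forall>x\<in>space \<nu>. \<bar>g x - t x\<bar> \<le> \<eta>" for g t
  proof -
    have tG: "t \<in> G" using that T by auto
    have "\<bar>(\<integral>z. g z \<partial>\<mu>) - (\<integral>z. t z \<partial>\<mu>)\<bar> \<le> (\<integral>z. \<bar>g z - t z\<bar> \<partial>\<mu>)"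
      using int[OF that(1)] int[OF tG] by (intro abs_integral_diff_le) auto
    also have "\<dots> \<le> (\<integral>z. \<eta> \<partial>\<mu>)"
      using int[OF that(1)] int[OF tG] that(3) by (intro integral_mono) (auto simp: space_eq)
    finally have 1: "\<bar>(\<integral>z. g z \<partial>\<mu>) - (\<integral>z. t z \<partial>\<mu>)\<bar> \<le> \<eta>" by (simp add: M.prob_space)
    have "\<bar>(\<integral>z. exp (g z) \<partial>\<nu>) - (\<integral>z. exp (t z) \<partial>\<nu>)\<bar> \<le> (\<integral>z. \<bar>exp (g z) - exp (t z)\<bar> \<partial>\<nu>)"
      using int[OF that(1)] int[OF tG] by (intro abs_integral_diff_le) auto
    also have "\<dots> \<le> (\<integral>z. exp c * \<eta> \<partial>\<nu>)"
      using int[OF that(1)] int[OF tG] that expd by (intro integral_mono) auto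
    finally have "\<bar>(\<integral>z. exp (g z) \<partial>\<nu>) - (\<integral>z. exp (t z) \<partial>\<nu>)\<bar> \<le> exp c * \<eta>" by (simp add: N.prob_space)
    with 1 show ?thesis unfolding gain_eq[OF that(1)] gain_eq[OF tG] \<gamma>_def by linarith
  qed
  have emp_eq: "emp g = (1 / real n) * (\<Sum>i<n. g (x i)) - (1 / real n) * (\<Sum>i<n. exp (g (y i))) + 1" for g
    using n by (simp add: emp_def sum_subtractf sum.distrib field_simps)
  have dev: "\<bar>emp t - gain t\<bar> \<le> r + s" if "t \<in> T" for t
    using devX[OF that] devY[OF that] T that unfolding emp_eq by (subst gain_eq) auto
  have up: "emp g \<le> ?D + (r + s + \<gamma>)" if g: "g \<in> G" for g
  proof -
    obtain t where t: "t \<in> T" "\<forall>x\<in>space \<nu>. \<bar>g x - t x\<bar> \<le> \<eta>" using net[OF g] by blast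
    then have "t \<in> G" using T by auto
    then have "gain t \<le> ?D" using G by (intro gain_le) auto
    then show ?thesis using emp_near[OF g t] dev[OF t(1)] by linarith
  qed
  have low: "?D - (\<delta> + (exp \<delta> - 1) + r + s + 2 * \<gamma>) \<le> emp h"
  proof -
    obtain t where t: "t \<in> T" "\<forall>x\<in>space \<nu>. \<bar>h x - t x\<bar> \<le> \<eta>" using net[OF h] by blast
    have "?D \<le> gain h + (\<delta> + (exp \<delta> - 1))" using G h near by (intro gain_ge) auto
    then show ?thesis using emp_near[OF h t] gain_near[OF h t] dev[OF t(1)] by linarith
  qed
  have est: "KL_estimator G n x y = (SUP g\<in>G. emp g)" by (simp add: KL_estimator_def emp_def)
  have "(SUP g\<in>G. emp g) \<le> ?D + (r + s + \<gamma>)" using h up by (intro cSUP_least) auto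
  moreover have "emp h \<le> (SUP g\<in>G. emp g)" using h up by (intro cSUP_upper bdd_aboveI2)
  moreover have "0 \<le> \<gamma>"
  proof -
    obtain t where "\<bar>emp h - emp t\<bar> \<le> \<gamma>" using net[OF h] emp_near[OF h] by blast
    then show ?thesis by linarith
  qed
  moreover have "0 \<le> \<delta> + (exp \<delta> - 1)"
  proof -
    have "0 \<le> \<delta>" using near[of "x 0"] x[of 0] n by force
    then show ?thesis using one_le_exp_iff[of \<delta>] by linarith
  qed
  ultimately have "\<bar>(SUP g\<in>G. emp g) - ?D\<bar> \<le> \<delta> + (exp \<delta> - 1) + r + s + 2 * \<gamma>"
    using low by (simp only: abs_le_iff) linarith
  then show ?thesis unfolding est \<gamma>_def .
qed

end


section \<open>Classes of networks\<close>

lemma netsI: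
  assumes "g = (\<lambda>x. (\<Sum>i=1..k. \<beta> i * \<phi> (dotp d (w i) x + b i)) + dotp d w0 x + b0)"
    "\<And>i. i \<in> {1..k} \<Longrightarrow> norm1 d (w i) \<le> a1 \<and> \<bar>b i\<bar> \<le> a1 \<and> \<bar>\<beta> i\<bar> \<le> a2"
    "\<bar>b0\<bar> \<le> a3" "norm1 d w0 \<le> a4"
  shows "g \<in> nets d k a1 a2 a3 a4 \<phi>"
  unfolding nets_def mem_Collect_eq
  by (rule exI[of _ \<beta>], rule exI[of _ w], rule exI[of _ b], rule exI[of _ w0], rule exI[of _ b0])
    (use assms in auto)

lemma nets_finite_index:
  assumes I: "finite I" "card I \<le> k" and "0 \<le> a1" "0 \<le> a2"
    and wb: "\<And>i. i \<in> I \<Longrightarrow> norm1 d (w i) \<le> a1 \<and> \<bar>b i\<bar> \<le> a1 \<and> \<bar>\<beta> i\<bar> \<le> a2"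
    and "\<bar>b0\<bar> \<le> a3" "norm1 d w0 \<le> a4"
  shows "(\<lambda>x. (\<Sum>i\<in>I. \<beta> i * \<phi> (dotp d (w i) x + b i)) + dotp d w0 x + b0) \<in> nets d k a1 a2 a3 a4 \<phi>"
proof -
  obtain h where h: "bij_betw h {1..card I} I" using ex_bij_betw_nat_finite_1[OF I(1)] by blast
  have hI: "h i \<in> I" if "1 \<le> i" "i \<le> card I" for i
    using h that by (auto simp: bij_betw_def)
  define \<beta>' where "\<beta>' i = (if i \<le> card I then \<beta> (h i) else 0)" for i
  define w' where "w' i = (if i \<le> card I then w (h i) else (\<lambda>_. 0))" for i
  define b' where "b' i = (if i \<le> card I then b (h i) else 0)" for i
  have eq: "(\<Sum>i=1..k. \<beta>' i * \<phi> (dotp d (w' i) x + b' i)) = (\<Sum>i\<in>I. \<beta> i * \<phi> (dotp d (w i) x + b i))" for x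
  proof -
    have "(\<Sum>i=1..k. \<beta>' i * \<phi> (dotp d (w' i) x + b' i)) = (\<Sum>i=1..card I. \<beta>' i * \<phi> (dotp d (w' i) x + b' i))"
      using I by (intro sum.mono_neutral_right) (auto simp: \<beta>'_def)
    also have "\<dots> = (\<Sum>i=1..card I. \<beta> (h i) * \<phi> (dotp d (w (h i)) x + b (h i)))"
      by (intro sum.cong) (auto simp: \<beta>'_def w'_def b'_def)
    also have "\<dots> = (\<Sum>i\<in>I. \<beta> i * \<phi> (dotp d (w i) x + b i))"
      using h by (rule sum.reindex_bij_betw)
    finally show ?thesis .
  qed
  show ?thesis
  proof (rule netsI[where \<beta> = \<beta>' and w = w' and b = b' and ?w0.0 = w0 and ?b0.0 = b0])
    show "norm1 d (w' i) \<le> a1 \<and> \<bar>b' i\<bar> \<le> a1 \<and> \<bar>\<beta>' i\<bar> \<le> a2" if "i \<in> {1..k}" for i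
      using that wb hI assms(3,4) by (auto simp: w'_def b'_def \<beta>'_def norm1_def)
  qed (simp_all only: eq assms(6,7))
qed

lemma zero_in_nets:
  assumes "0 \<le> a1" "0 \<le> a2" "0 \<le> a3" "0 \<le> a4"
  shows "(\<lambda>x. 0) \<in> nets d k a1 a2 a3 a4 \<phi>"
proof -
  have "(\<lambda>x. (\<Sum>i\<in>{}. 0 * \<phi> (dotp d (\<lambda>_. 0) x + 0)) + dotp d (\<lambda>_. 0) x + 0) \<in> nets d k a1 a2 a3 a4 \<phi>"
    by (rule nets_finite_index) (use assms in \<open>auto simp: norm1_def\<close>)
  then show ?thesis by (simp add: dotp_def)
qed

lemma netsE:
  assumes "g \<in> nets d k a1 a2 a3 a4 \<phi>"
  obtains \<beta> w b w0 b0 where "g = (\<lambda>x. (\<Sum>i=1..k. \<beta> i * \<phi> (dotp d (w i) x + b i)) + dotp d w0 x + b0)"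
    "\<And>i. i \<in> {1..k} \<Longrightarrow> norm1 d (w i) \<le> a1" "\<And>i. i \<in> {1..k} \<Longrightarrow> \<bar>b i\<bar> \<le> a1"
    "\<And>i. i \<in> {1..k} \<Longrightarrow> \<bar>\<beta> i\<bar> \<le> a2" "\<bar>b0\<bar> \<le> a3" "norm1 d w0 \<le> a4"
proof -
  obtain \<beta> w b w0 b0 where "g = (\<lambda>x. (\<Sum>i=1..k. \<beta> i * \<phi> (dotp d (w i) x + b i)) + dotp d w0 x + b0)"
    "\<forall>i\<in>{1..k}. max (norm1 d (w i)) \<bar>b i\<bar> \<le> a1 \<and> \<bar>\<beta> i\<bar> \<le> a2" "\<bar>b0\<bar> \<le> a3" "norm1 d w0 \<le> a4"
    using assms unfolding nets_def by blast
  then show thesis by (intro that[of \<beta> w b w0 b0]) auto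
qed

lemma nets_measurable:
  assumes "g \<in> nets d k a1 a2 a3 a4 \<phi>" and [measurable]: "\<phi> \<in> borel_measurable borel"
  shows "g \<in> borel_measurable (euc d)"
  using assms(1)
proof (rule netsE)
  fix \<beta> w b w0 b0 assume g: "g = (\<lambda>x. (\<Sum>i=1..k. \<beta> i * \<phi> (dotp d (w i) x + b i)) + dotp d w0 x + b0)"
  show ?thesis unfolding g by measurable
qed

lemma nets_bounded:
  assumes g: "g \<in> nets d k a1 a2 a3 a4 \<phi>" and x: "x \<in> cube d"
    and \<phi>: "\<And>z. \<bar>z\<bar> \<le> 2 * a1 \<Longrightarrow> \<bar>\<phi> z\<bar> \<le> R" and "0 \<le> a2"
  shows "\<bar>g x\<bar> \<le> real k * (a2 * R) + a4 + a3"
  using g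
proof (rule netsE)
  fix \<beta> w b w0 b0 assume g: "g = (\<lambda>x. (\<Sum>i=1..k. \<beta> i * \<phi> (dotp d (w i) x + b i)) + dotp d w0 x + b0)"
    and w: "\<And>i. i \<in> {1..k} \<Longrightarrow> norm1 d (w i) \<le> a1" and b: "\<And>i. i \<in> {1..k} \<Longrightarrow> \<bar>b i\<bar> \<le> a1"
    and \<beta>: "\<And>i. i \<in> {1..k} \<Longrightarrow> \<bar>\<beta> i\<bar> \<le> a2" and b0: "\<bar>b0\<bar> \<le> a3" and w0: "norm1 d w0 \<le> a4"
  have "\<bar>\<Sum>i=1..k. \<beta> i * \<phi> (dotp d (w i) x + b i)\<bar> \<le> (\<Sum>i=1..k. a2 * R)"
  proof (intro order_trans[OF sum_abs] sum_mono)
    fix i assume i: "i \<in> {1..k}"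
    have "\<bar>dotp d (w i) x + b i\<bar> \<le> 2 * a1"
      using dotp_abs_le[OF x, of "w i"] w[OF i] b[OF i] by linarith
    then show "\<bar>\<beta> i * \<phi> (dotp d (w i) x + b i)\<bar> \<le> a2 * R"
      unfolding abs_mult using \<phi> \<beta>[OF i] assms(4) by (intro mult_mono) auto
  qed
  moreover have "\<bar>dotp d w0 x\<bar> \<le> a4" using dotp_abs_le[OF x, of w0] w0 by linarith
  ultimately show ?thesis unfolding g using b0 by simp
qed


section \<open>Finite covers\<close>

text \<open>All parameters in one array, so that they can be rounded uniformly: row \<open>i \<ge> 1\<close> holds \<open>w\<^sub>i\<close> in the columns
  below \<open>d\<close>, then \<open>\<beta>\<^sub>i\<close> and \<open>b\<^sub>i\<close>; row \<open>0\<close> holds \<open>w\<^sub>0\<close> and \<open>b\<^sub>0\<close>, and its last entry is void.\<close>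

definition net_of :: "nat \<Rightarrow> nat \<Rightarrow> (real \<Rightarrow> real) \<Rightarrow> (nat \<times> nat \<Rightarrow> real) \<Rightarrow> (nat \<Rightarrow> real) \<Rightarrow> real" where
  "net_of d k \<phi> p x = (\<Sum>i=1..k. p (i, d) * \<phi> (dotp d (\<lambda>j. p (i, j)) x + p (i, d + 1)))
     + dotp d (\<lambda>j. p (0, j)) x + p (0, d)"

definition net_params :: "nat \<Rightarrow> nat \<Rightarrow> real \<Rightarrow> real \<Rightarrow> real \<Rightarrow> real \<Rightarrow> (nat \<times> nat \<Rightarrow> real) set" where
  "net_params d k a1 a2 a3 a4 = {p. (\<forall>i\<in>{1..k}. norm1 d (\<lambda>j. p (i, j)) \<le> a1 \<and> \<bar>p (i, d + 1)\<bar> \<le> a1 \<and> \<bar>p (i, d)\<bar> \<le> a2)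
     \<and> \<bar>p (0, d)\<bar> \<le> a3 \<and> norm1 d (\<lambda>j. p (0, j)) \<le> a4}"

lemma dotp_cong: "(\<And>j. j < d \<Longrightarrow> v j = w j) \<Longrightarrow> dotp d v x = dotp d w x"
  by (simp add: dotp_def)

lemma norm1_cong: "(\<And>j. j < d \<Longrightarrow> v j = w j) \<Longrightarrow> norm1 d v = norm1 d w"
  by (simp add: norm1_def)

lemma norm1_mono: "(\<And>j. j < d \<Longrightarrow> \<bar>v j\<bar> \<le> \<bar>w j\<bar>) \<Longrightarrow> norm1 d v \<le> norm1 d w"
  by (auto simp: norm1_def intro!: sum_mono)

lemma nets_eq_net_of: "nets d k a1 a2 a3 a4 \<phi> = net_of d k \<phi> ` net_params d k a1 a2 a3 a4"
proof (intro equalityI subsetI)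
  fix g assume "g \<in> nets d k a1 a2 a3 a4 \<phi>"
  then show "g \<in> net_of d k \<phi> ` net_params d k a1 a2 a3 a4"
  proof (rule netsE)
    fix \<beta> w b w0 b0 assume g: "g = (\<lambda>x. (\<Sum>i=1..k. \<beta> i * \<phi> (dotp d (w i) x + b i)) + dotp d w0 x + b0)"
      and w: "\<And>i. i \<in> {1..k} \<Longrightarrow> norm1 d (w i) \<le> a1" and b: "\<And>i. i \<in> {1..k} \<Longrightarrow> \<bar>b i\<bar> \<le> a1"
      and \<beta>: "\<And>i. i \<in> {1..k} \<Longrightarrow> \<bar>\<beta> i\<bar> \<le> a2" and b0: "\<bar>b0\<bar> \<le> a3" and w0: "norm1 d w0 \<le> a4"
    define p where "p = (\<lambda>(i, j). if i = 0 then (if j < d then w0 j else b0)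
      else if j < d then w i j else if j = d then \<beta> i else b i)"
    have d: "dotp d (\<lambda>j. p (0, j)) x = dotp d w0 x" "i \<noteq> 0 \<Longrightarrow> dotp d (\<lambda>j. p (i, j)) x = dotp d (w i) x" for i x
      by (auto simp: p_def intro!: dotp_cong)
    have n: "norm1 d (\<lambda>j. p (0, j)) = norm1 d w0" "i \<noteq> 0 \<Longrightarrow> norm1 d (\<lambda>j. p (i, j)) = norm1 d (w i)" for i
      by (auto simp: p_def intro!: norm1_cong)
    have "g = net_of d k \<phi> p"
      unfolding g net_of_def by (intro ext arg_cong2[where f = "(+)"] sum.cong refl) (auto simp: d, auto simp: p_def)
    moreover have "p \<in> net_params d k a1 a2 a3 a4"
      unfolding net_params_def using w b \<beta> b0 w0 by (auto simp: n) (auto simp: p_def)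
    ultimately show ?thesis by blast
  qed
next
  fix g assume "g \<in> net_of d k \<phi> ` net_params d k a1 a2 a3 a4"
  then obtain p where "g = net_of d k \<phi> p" "p \<in> net_params d k a1 a2 a3 a4" by blast
  then show "g \<in> nets d k a1 a2 a3 a4 \<phi>"
    by (intro netsI[where \<beta> = "\<lambda>i. p (i, d)" and w = "\<lambda>i j. p (i, j)" and b = "\<lambda>i. p (i, d + 1)"
        and ?w0.0 = "\<lambda>j. p (0, j)" and ?b0.0 = "p (0, d)"])
      (auto simp: net_of_def fun_eq_iff net_params_def)
qed

definition round_to_zero :: "nat \<Rightarrow> real \<Rightarrow> real" where
  "round_to_zero m c = sgn c * real_of_int \<lfloor>\<bar>c\<bar> * real m\<rfloor> / real m"

lemma abs_round_to_zero:
  assumes "1 \<le> m"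
  shows "\<bar>round_to_zero m c\<bar> \<le> \<bar>c\<bar>" "\<bar>c - round_to_zero m c\<bar> \<le> 1 / real m"
proof -
  define f where "f = real_of_int \<lfloor>\<bar>c\<bar> * real m\<rfloor> / real m"
  have f: "0 \<le> f" "f \<le> \<bar>c\<bar>" "\<bar>c\<bar> - f \<le> 1 / real m"
  proof -
    show "0 \<le> f" by (simp add: f_def)
    have "real_of_int \<lfloor>\<bar>c\<bar> * real m\<rfloor> \<le> \<bar>c\<bar> * real m" "\<bar>c\<bar> * real m - real_of_int \<lfloor>\<bar>c\<bar> * real m\<rfloor> \<le> 1" by linarith+
    moreover have c: "\<bar>c\<bar> = (\<bar>c\<bar> * real m) / real m" using assms by simp
    ultimately show "f \<le> \<bar>c\<bar>" "\<bar>c\<bar> - f \<le> 1 / real m"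
      unfolding f_def by (subst c, intro divide_right_mono, simp_all)
        (subst c, unfold diff_divide_distrib[symmetric], intro divide_right_mono, simp_all)
  qed
  have r: "round_to_zero m c = sgn c * f" by (simp add: round_to_zero_def f_def)
  show "\<bar>round_to_zero m c\<bar> \<le> \<bar>c\<bar>" "\<bar>c - round_to_zero m c\<bar> \<le> 1 / real m"
    unfolding r using f by (auto simp: sgn_real_def abs_if split: if_splits)
qed

definition grid :: "nat \<Rightarrow> real \<Rightarrow> real set" where
  "grid m A = (\<lambda>j. real_of_int j / real m) ` {- \<lfloor>A * real m\<rfloor>..\<lfloor>A * real m\<rfloor>}"

lemma round_to_zero_in_grid:
  assumes "\<bar>c\<bar> \<le> A"
  shows "round_to_zero m c \<in> grid m A"
proof -
  have le: "\<lfloor>\<bar>c\<bar> * real m\<rfloor> \<le> \<lfloor>A * real m\<rfloor>" using assms by (intro floor_mono mult_right_mono) auto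
  define F where "F = \<lfloor>\<bar>c\<bar> * real m\<rfloor>"
  have F: "0 \<le> F" "F \<le> \<lfloor>A * real m\<rfloor>" "0 \<le> \<lfloor>A * real m\<rfloor>"
  proof -
    show "0 \<le> F" by (simp add: F_def)
    show "F \<le> \<lfloor>A * real m\<rfloor>" using le by (simp only: F_def)
    then show "0 \<le> \<lfloor>A * real m\<rfloor>" using \<open>0 \<le> F\<close> by linarith
  qed
  then have "round_to_zero m c = real_of_int (F * (if 0 < c then 1 else if c < 0 then -1 else 0)) / real m
    \<and> F * (if 0 < c then 1 else if c < 0 then -1 else 0) \<in> {- \<lfloor>A * real m\<rfloor>..\<lfloor>A * real m\<rfloor>}"
    unfolding round_to_zero_def F_def[symmetric] by (auto simp: sgn_real_def)
  then show ?thesis unfolding grid_def by blast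
qed

lemma grid_card:
  assumes "0 \<le> A"
  shows "finite (grid m A)" "real (card (grid m A)) \<le> 2 * A * real m + 1"
proof -
  show "finite (grid m A)" by (simp add: grid_def)
  have "card (grid m A) \<le> card {- \<lfloor>A * real m\<rfloor>..\<lfloor>A * real m\<rfloor>}" unfolding grid_def by (intro card_image_le) simp
  also have "\<dots> = nat (2 * \<lfloor>A * real m\<rfloor> + 1)" by simp
  finally have "real (card (grid m A)) \<le> real (nat (2 * \<lfloor>A * real m\<rfloor> + 1))" by simp
  also have "\<dots> = 2 * of_int \<lfloor>A * real m\<rfloor> + 1" using assms by simp
  also have "\<dots> \<le> 2 * A * real m + 1" by (simp add: mult.assoc)
  finally show "real (card (grid m A)) \<le> 2 * A * real m + 1" .
qed

lemma abs_mult_diff_le: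
  "\<bar>b\<bar> \<le> A \<Longrightarrow> \<bar>y'\<bar> \<le> R \<Longrightarrow> \<bar>b * y - b' * y'\<bar> \<le> A * \<bar>y - y'\<bar> + \<bar>b - b'\<bar> * (R::real)"
proof -
  assume *: "\<bar>b\<bar> \<le> A" "\<bar>y'\<bar> \<le> R"
  have "b * y - b' * y' = b * (y - y') + (b - b') * y'" by (simp add: algebra_simps)
  then have "\<bar>b * y - b' * y'\<bar> \<le> \<bar>b\<bar> * \<bar>y - y'\<bar> + \<bar>b - b'\<bar> * \<bar>y'\<bar>"
    by (metis abs_mult abs_triangle_ineq)
  also have "\<dots> \<le> A * \<bar>y - y'\<bar> + \<bar>b - b'\<bar> * R"
    using * by (intro add_mono mult_mono) auto
  finally show ?thesis .
qed

lemma dotp_weights_diff_le: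
  assumes x: "x \<in> cube d" and le: "\<And>j. j < d \<Longrightarrow> \<bar>v j - w j\<bar> \<le> c"
  shows "\<bar>dotp d v x - dotp d w x\<bar> \<le> real d * c"
proof -
  have "\<bar>dotp d v x - dotp d w x\<bar> = \<bar>\<Sum>j<d. (v j - w j) * x j\<bar>"
    by (simp add: dotp_def left_diff_distrib sum_subtractf)
  also have "\<dots> \<le> (\<Sum>j<d. c)"
  proof (intro order_trans[OF sum_abs] sum_mono)
    fix j assume "j \<in> {..<d}"
    then have "\<bar>v j - w j\<bar> * \<bar>x j\<bar> \<le> c * 1" using le[of j] cubeD[OF x, of j] by (intro mult_mono) auto
    then show "\<bar>(v j - w j) * x j\<bar> \<le> c" by (simp add: abs_mult)
  qed
  finally show ?thesis by simp
qed

text \<open>Rounding all parameters towards zero to multiples of \<open>1 / m\<close> does not leave the class.\<close>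

lemma nets_cover:
  assumes A: "0 \<le> A" "a1 \<le> A" "a2 \<le> A" "a3 \<le> A" "a4 \<le> A" and m: "1 \<le> m"
    and lip: "\<And>y z. \<bar>\<phi> y - \<phi> z\<bar> \<le> \<bar>y - z\<bar>" and \<phi>: "\<And>z. \<bar>z\<bar> \<le> 2 * a1 \<Longrightarrow> \<bar>\<phi> z\<bar> \<le> R"
  obtains T where "finite T" "T \<subseteq> nets d k a1 a2 a3 a4 \<phi>" "real (card T) \<le> (2 * A * real m + 1) ^ ((k + 1) * (d + 2))"
    "\<And>g. g \<in> nets d k a1 a2 a3 a4 \<phi> \<Longrightarrow> \<exists>t\<in>T. \<forall>x\<in>cube d.
       \<bar>g x - t x\<bar> \<le> (real k * (A * (real d + 1) + R) + (real d + 1)) / real m"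
proof -
  let ?J = "{0..k} \<times> {0..d + 1}"
  let ?P = "?J \<rightarrow>\<^sub>E grid m A"
  define T where "T = net_of d k \<phi> ` (?P \<inter> net_params d k a1 a2 a3 a4)"
  note G = grid_card[OF A(1), of m]
  have finP: "finite ?P" using G by (intro finite_PiE) auto
  have cardP: "real (card ?P) \<le> (2 * A * real m + 1) ^ ((k + 1) * (d + 2))"
  proof -
    have "card ?P = card (grid m A) ^ card ?J" by (simp add: card_PiE)
    also have "card ?J = (k + 1) * (d + 2)" by simp
    finally have "real (card ?P) = real (card (grid m A)) ^ ((k + 1) * (d + 2))" by (simp only: of_nat_power)
    also have "\<dots> \<le> (2 * A * real m + 1) ^ ((k + 1) * (d + 2))" using G by (intro power_mono) auto
    finally show ?thesis .
  qed
  show thesis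
  proof (rule that[of T])
    show "finite T" using finP by (auto simp: T_def)
    show "T \<subseteq> nets d k a1 a2 a3 a4 \<phi>" by (auto simp: T_def nets_eq_net_of)
    have "card T \<le> card (?P \<inter> net_params d k a1 a2 a3 a4)" unfolding T_def using finP by (intro card_image_le) auto
    also have "\<dots> \<le> card ?P" using finP by (intro card_mono) auto
    finally have "real (card T) \<le> real (card ?P)" by simp
    then show "real (card T) \<le> (2 * A * real m + 1) ^ ((k + 1) * (d + 2))" using cardP by linarith
    fix g assume "g \<in> nets d k a1 a2 a3 a4 \<phi>"
    then obtain p where g: "g = net_of d k \<phi> p" and p: "p \<in> net_params d k a1 a2 a3 a4"
      by (auto simp: nets_eq_net_of)
    define q where "q = (\<lambda>(i, j)\<in>?J. if (i, j) = (0, d + 1) then 0 else round_to_zero m (p (i, j)))"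
    have q: "q (i, j) = round_to_zero m (p (i, j))" if "(i, j) \<in> ?J" "(i, j) \<noteq> (0, d + 1)" for i j
      using that by (auto simp: q_def)
    have pA: "\<bar>p (i, j)\<bar> \<le> A" if ij: "(i, j) \<in> ?J" "(i, j) \<noteq> (0, d + 1)" for i j
    proof -
      have row: "\<bar>p (i, j)\<bar> \<le> A" if "j < d" "norm1 d (\<lambda>j. p (i, j)) \<le> A"
        using abs_coord_le_norm1[OF that(1), of "\<lambda>j. p (i, j)"] that(2) by linarith
      have j: "j < d \<or> j = d \<or> j = d + 1" using ij by auto
      show ?thesis
      proof (cases "i = 0")
        case True
        then have "norm1 d (\<lambda>j. p (i, j)) \<le> A" "\<bar>p (i, d)\<bar> \<le> A"
          using p A by (auto simp: net_params_def)
        then show ?thesis using j row ij True by auto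
      next
        case False
        then have "i \<in> {1..k}" using ij by auto
        then have "norm1 d (\<lambda>j. p (i, j)) \<le> a1" "\<bar>p (i, d)\<bar> \<le> a2" "\<bar>p (i, d + 1)\<bar> \<le> a1"
          using p unfolding net_params_def by blast+
        then have "norm1 d (\<lambda>j. p (i, j)) \<le> A" "\<bar>p (i, d)\<bar> \<le> A" "\<bar>p (i, d + 1)\<bar> \<le> A"
          using A by linarith+
        then show ?thesis using j row by blast
      qed
    qed
    have close: "\<bar>p (i, j) - q (i, j)\<bar> \<le> 1 / real m" and smaller: "\<bar>q (i, j)\<bar> \<le> \<bar>p (i, j)\<bar>"
      if "(i, j) \<in> ?J" "(i, j) \<noteq> (0, d + 1)" for i j
      using q[OF that] abs_round_to_zero[OF m, of "p (i, j)"] by auto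
    have "q \<in> ?P"
    proof -
      have "(0::real) \<in> grid m A" using round_to_zero_in_grid[of 0 A m] A by (simp add: round_to_zero_def)
      then show ?thesis using pA round_to_zero_in_grid by (auto simp: q_def)
    qed
    moreover have "q \<in> net_params d k a1 a2 a3 a4"
    proof -
      have "norm1 d (\<lambda>j. q (i, j)) \<le> norm1 d (\<lambda>j. p (i, j))" if "i \<le> k" for i
        using that by (intro norm1_mono smaller) auto
      then have n: "norm1 d (\<lambda>j. p (i, j)) \<le> c \<Longrightarrow> norm1 d (\<lambda>j. q (i, j)) \<le> c" if "i \<le> k" for i c
        using that order_trans by blast
      have s: "\<bar>p (i, j)\<bar> \<le> c \<Longrightarrow> \<bar>q (i, j)\<bar> \<le> c" if "(i, j) \<in> ?J" "(i, j) \<noteq> (0, d + 1)" for i j c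
        using smaller[OF that] by linarith
      show ?thesis using p unfolding net_params_def by (auto intro!: n s)
    qed
    ultimately have "net_of d k \<phi> q \<in> T" by (auto simp: T_def)
    moreover have "\<bar>g x - net_of d k \<phi> q x\<bar> \<le> (real k * (A * (real d + 1) + R) + (real d + 1)) / real m"
      if x: "x \<in> cube d" for x
    proof -
      let ?z = "\<lambda>p i. dotp d (\<lambda>j. p (i, j)) x + p (i, d + 1)"
      have "\<bar>\<Sum>i=1..k. (p (i, d) * \<phi> (?z p i) - q (i, d) * \<phi> (?z q i))\<bar> \<le> (\<Sum>i=1..k. (A * (real d + 1) + R) / real m)"
      proof (intro order_trans[OF sum_abs] sum_mono)
        fix i assume i: "i \<in> {1..k}"
        have qi: "norm1 d (\<lambda>j. q (i, j)) \<le> a1" "\<bar>q (i, d + 1)\<bar> \<le> a1"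
          using \<open>q \<in> net_params d k a1 a2 a3 a4\<close> i by (auto simp: net_params_def)
        have R: "\<bar>\<phi> (?z q i)\<bar> \<le> R"
          using dotp_abs_le[OF x, of "\<lambda>j. q (i, j)"] qi by (intro \<phi>) linarith
        have z: "\<bar>?z p i - ?z q i\<bar> \<le> (real d + 1) / real m"
        proof -
          have "\<bar>dotp d (\<lambda>j. p (i, j)) x - dotp d (\<lambda>j. q (i, j)) x\<bar> \<le> real d * (1 / real m)"
            using i by (intro dotp_weights_diff_le x close) auto
          moreover have "\<bar>p (i, d + 1) - q (i, d + 1)\<bar> \<le> 1 / real m" using i by (intro close) auto
          ultimately have "\<bar>?z p i - ?z q i\<bar> \<le> real d * (1 / real m) + 1 / real m" by linarith
          then show ?thesis by (simp add: add_divide_distrib)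
        qed
        have "\<bar>p (i, d) * \<phi> (?z p i) - q (i, d) * \<phi> (?z q i)\<bar>
            \<le> A * \<bar>\<phi> (?z p i) - \<phi> (?z q i)\<bar> + \<bar>p (i, d) - q (i, d)\<bar> * R"
          using i pA[of i d] R by (intro abs_mult_diff_le) auto
        also have "\<dots> \<le> A * ((real d + 1) / real m) + (1 / real m) * R"
          using i close[of i d] R A(1) order_trans[OF lip z]
          by (intro add_mono mult_left_mono mult_right_mono) auto
        also have "\<dots> = (A * (real d + 1) + R) / real m"
          by (simp add: add_divide_distrib[of "A * (real d + 1)" R])
        finally show "\<bar>p (i, d) * \<phi> (?z p i) - q (i, d) * \<phi> (?z q i)\<bar> \<le> (A * (real d + 1) + R) / real m" .
      qed
      moreover have "\<bar>dotp d (\<lambda>j. p (0, j)) x - dotp d (\<lambda>j. q (0, j)) x\<bar> \<le> real d * (1 / real m)"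
        by (intro dotp_weights_diff_le x close) auto
      moreover have "\<bar>p (0, d) - q (0, d)\<bar> \<le> 1 / real m" by (intro close) auto
      ultimately have "\<bar>g x - net_of d k \<phi> q x\<bar> \<le> real k * ((A * (real d + 1) + R) / real m) + real d * (1 / real m) + 1 / real m"
        unfolding g net_of_def sum_subtractf by (simp del: sum.cl_ivl_Suc)
      also have "\<dots> = (real k * (A * (real d + 1) + R) + (real d + 1)) / real m"
        by (simp only: times_divide_eq_right add_divide_distrib[symmetric] mult_1_right add.assoc)
      finally show ?thesis .
    qed
    ultimately show "\<exists>t\<in>T. \<forall>x\<in>cube d. \<bar>g x - t x\<bar> \<le> (real k * (A * (real d + 1) + R) + (real d + 1)) / real m"
      by blast
  qed
qed


section \<open>Rademacher complexity of ReLU networks\<close>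

text \<open>A network is linear in its outer coefficients, so its signed sum is controlled by those of single
  units and of the affine part.  Contraction replaces each unit by its argument, and signed sums of
  linear forms with weights of \<open>\<ell>\<^sub>1\<close>-norm at most \<open>1\<close> are dominated by \<open>d + 1\<close> one-dimensional random
  walks.  The zero unit is added so that the maxima over units are nonnegative.\<close>

lemma relu_nets_rademacher:
  assumes T: "finite T" "T \<noteq> {}" "T \<subseteq> nets d k 1 a2 a3 a4 relu" and a: "0 \<le> a2" "0 \<le> a3" "0 \<le> a4"
    and x: "\<And>i. i < n \<Longrightarrow> x i \<in> cube d"
  shows "rade n (\<lambda>e. MAX g\<in>T. \<Sum>i<n. e i * g (x i)) \<le> (2 * (real k * a2) + a3 + a4) * ((real d + 1) * sqrt (real n))"
proof -
  have "\<forall>g\<in>T. \<exists>p. g = net_of d k relu p \<and> p \<in> net_params d k 1 a2 a3 a4"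
    using T(3) unfolding nets_eq_net_of by auto
  then obtain p where p: "\<forall>g\<in>T. g = net_of d k relu (p g) \<and> p g \<in> net_params d k 1 a2 a3 a4"
    unfolding bchoice_iff by (elim exE)
  define \<beta> where "\<beta> g l = p g (l, d)" for g l
  define w where "w g l = (\<lambda>j. p g (l, j))" for g l
  define b where "b g l = p g (l, d + 1)" for g l
  define w0 where "w0 g = (\<lambda>j. p g (0, j))" for g
  define b0 where "b0 g = p g (0, d)" for g
  have g: "g x = (\<Sum>l=1..k. \<beta> g l * relu (dotp d (w g l) x + b g l)) + dotp d (w0 g) x + b0 g"
    if "g \<in> T" for g x
  proof -
    have "g x = net_of d k relu (p g) x" using p that by simp
    then show ?thesis by (simp only: net_of_def \<beta>_def w_def b_def w0_def b0_def)
  qed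
  have wb: "norm1 d (w g l) \<le> 1 \<and> \<bar>b g l\<bar> \<le> 1 \<and> \<bar>\<beta> g l\<bar> \<le> a2" if "g \<in> T" "l \<in> {1..k}" for g l
    using p that unfolding net_params_def \<beta>_def w_def b_def by blast
  have wb0: "\<bar>b0 g\<bar> \<le> a3 \<and> norm1 d (w0 g) \<le> a4" if "g \<in> T" for g
    using p that unfolding net_params_def w0_def b0_def by blast
  define N where "N = insert (\<lambda>_. 0, 0) ((\<lambda>(g, l). (w g l, b g l)) ` (T \<times> {1..k}))"
  have N: "finite N" "N \<noteq> {}" "(\<lambda>_. 0, 0) \<in> N" using T by (auto simp: N_def)
  have Nb: "norm1 d v \<le> 1 \<and> \<bar>c\<bar> \<le> 1" if "(v, c) \<in> N" for v c
    using that wb by (auto simp: N_def norm1_def)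
  define lin where "lin e = (\<Sum>j<d. \<bar>\<Sum>i<n. e i * x i j\<bar>) + \<bar>\<Sum>i<n. e i\<bar>" for e
  define act where "act i = (\<lambda>(v, c). relu (dotp d v (x i) + c))" for i
  have act0: "act i (\<lambda>_. 0, 0) = 0" for i by (simp add: act_def dotp_def relu_def)
  have comb: "\<bar>\<Sum>i<n. e i * (dotp d v (x i) + c)\<bar> \<le> s * (\<Sum>j<d. \<bar>\<Sum>i<n. e i * x i j\<bar>) + s' * \<bar>\<Sum>i<n. e i\<bar>"
    if "norm1 d v \<le> s" "\<bar>c\<bar> \<le> s'" for v c s s' and e :: "nat \<Rightarrow> real"
  proof -
    have "(\<Sum>i<n. e i * (dotp d v (x i) + c)) = (\<Sum>j<d. v j * (\<Sum>i<n. e i * x i j)) + c * (\<Sum>i<n. e i)"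
      unfolding dotp_def distrib_left sum.distrib sum_distrib_left
      by (subst sum.swap) (simp add: mult_ac)
    moreover have "\<bar>\<Sum>j<d. v j * (\<Sum>i<n. e i * x i j)\<bar> \<le> (\<Sum>j<d. s * \<bar>\<Sum>i<n. e i * x i j\<bar>)"
    proof (intro order_trans[OF sum_abs] sum_mono)
      fix j assume "j \<in> {..<d}"
      then have "\<bar>v j\<bar> \<le> s" using abs_coord_le_norm1[of j d v] that by simp
      then show "\<bar>v j * (\<Sum>i<n. e i * x i j)\<bar> \<le> s * \<bar>\<Sum>i<n. e i * x i j\<bar>"
        unfolding abs_mult by (intro mult_right_mono) auto
    qed
    moreover have "\<bar>c * (\<Sum>i<n. e i)\<bar> \<le> s' * \<bar>\<Sum>i<n. e i\<bar>"
      unfolding abs_mult using that by (intro mult_right_mono) auto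
    ultimately show ?thesis by (simp add: sum_distrib_left)
  qed
  have lin_le: "rade n lin \<le> (real d + 1) * sqrt (real n)"
  proof -
    have "rade n lin = (\<Sum>j<d. rade n (\<lambda>e. \<bar>0 + (\<Sum>i<n. e i * x i j)\<bar>)) + rade n (\<lambda>e. \<bar>0 + (\<Sum>i<n. e i * 1)\<bar>)"
      unfolding lin_def rade_add rade_sum by simp
    also have "\<dots> \<le> (\<Sum>j<d. sqrt (real n)) + sqrt (real n)"
    proof (intro add_mono sum_mono)
      fix j assume j: "j \<in> {..<d}"
      have "rade n (\<lambda>e. \<bar>0 + (\<Sum>i<n. e i * x i j)\<bar>) \<le> sqrt (0\<^sup>2 + (\<Sum>i<n. (x i j)\<^sup>2))"
        by (rule rade_abs_sum_le)
      also have "\<dots> \<le> sqrt (0\<^sup>2 + (\<Sum>i<n. 1))"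
      proof (intro real_sqrt_le_mono add_left_mono sum_mono)
        fix i assume "i \<in> {..<n}"
        then show "(x i j)\<^sup>2 \<le> 1" using cubeD[OF x, of i j] j by (auto intro: power_le_one)
      qed
      finally show "rade n (\<lambda>e. \<bar>0 + (\<Sum>i<n. e i * x i j)\<bar>) \<le> sqrt (real n)" by simp
    next
      show "rade n (\<lambda>e. \<bar>0 + (\<Sum>i<n. e i * 1)\<bar>) \<le> sqrt (real n)"
        using rade_abs_sum_le[of n 0 "\<lambda>_. 1"] by simp
    qed
    finally show ?thesis by (simp add: algebra_simps)
  qed
  have neurons: "rade n (\<lambda>e. MAX p\<in>N. \<Sum>i<n. e i * (s * act i p)) \<le> rade n lin" if s: "s = 1 \<or> s = -1" for s
  proof -
    have "rade n (\<lambda>e. MAX p\<in>N. 0 + (\<Sum>i<n. e i * (s * act i p))) \<le>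
        rade n (\<lambda>e. MAX p\<in>N. 0 + (\<Sum>i<n. e i * (dotp d (fst p) (x i) + snd p)))"
    proof (rule rade_contraction[OF N(1,2)])
      fix i p q
      have "\<bar>s * act i p - s * act i q\<bar> = \<bar>act i p - act i q\<bar>" using s by auto
      then show "\<bar>s * act i p - s * act i q\<bar> \<le> \<bar>dotp d (fst p) (x i) + snd p - (dotp d (fst q) (x i) + snd q)\<bar>"
        using relu_lipschitz by (simp add: act_def case_prod_beta)
    qed
    also have "\<dots> \<le> rade n lin"
    proof (rule rade_mono)
      fix e :: "nat \<Rightarrow> real"
      have "0 + (\<Sum>i<n. e i * (dotp d (fst p) (x i) + snd p)) \<le> lin e" if "p \<in> N" for p
        using comb[of "fst p" 1 "snd p" 1 e] Nb[of "fst p" "snd p"] that by (auto simp: lin_def)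
      then show "(MAX p\<in>N. 0 + (\<Sum>i<n. e i * (dotp d (fst p) (x i) + snd p))) \<le> lin e"
        using N by (subst Max_le_iff) auto
    qed
    finally show ?thesis by simp
  qed
  have point: "(MAX g\<in>T. \<Sum>i<n. e i * g (x i)) \<le>
      (real k * a2) * ((MAX p\<in>N. \<Sum>i<n. e i * (1 * act i p)) + (MAX p\<in>N. \<Sum>i<n. e i * (-1 * act i p))) + (a3 + a4) * lin e"
    for e
  proof -
    let ?X = "\<lambda>s. MAX p\<in>N. \<Sum>i<n. e i * (s * act i p)"
    have ge: "(\<Sum>i<n. e i * (s * act i p)) \<le> ?X s" if "p \<in> N" for p s using N that by (intro Max_ge) auto
    have nn: "0 \<le> ?X s" for s using ge[OF N(3), of s] by (simp add: act0)
    have abs: "\<bar>\<Sum>i<n. e i * act i p\<bar> \<le> ?X 1 + ?X (-1)" if "p \<in> N" for p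
      using ge[OF that, of 1] ge[OF that, of "-1"] nn[of 1] nn[of "-1"] by (simp add: sum_negf)
    have "(\<Sum>i<n. e i * h (x i)) \<le> (real k * a2) * (?X 1 + ?X (-1)) + (a3 + a4) * lin e" if h: "h \<in> T" for h
    proof -
      have "(\<Sum>i<n. e i * h (x i)) = (\<Sum>i<n. \<Sum>l=1..k. \<beta> h l * (e i * act i (w h l, b h l)))
          + (\<Sum>i<n. e i * (dotp d (w0 h) (x i) + b0 h))"
      proof -
        have "e i * h (x i) = (\<Sum>l=1..k. \<beta> h l * (e i * act i (w h l, b h l))) + e i * (dotp d (w0 h) (x i) + b0 h)" for i
        proof -
          have "(\<Sum>l=1..k. \<beta> h l * (e i * act i (w h l, b h l))) = e i * (\<Sum>l=1..k. \<beta> h l * relu (dotp d (w h l) (x i) + b h l))"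
            unfolding sum_distrib_left act_def prod.case by (intro sum.cong refl mult.left_commute)
          then show ?thesis unfolding g[OF h, of "x i"] by (simp only: distrib_left add.assoc)
        qed
        then show ?thesis by (simp only: sum.distrib)
      qed
      also have "(\<Sum>i<n. \<Sum>l=1..k. \<beta> h l * (e i * act i (w h l, b h l))) = (\<Sum>l=1..k. \<beta> h l * (\<Sum>i<n. e i * act i (w h l, b h l)))"
        by (subst sum.swap) (simp only: sum_distrib_left)
      also have "\<dots> \<le> (\<Sum>l=1..k. a2 * (?X 1 + ?X (-1)))"
      proof (rule sum_mono)
        fix l assume l: "l \<in> {1..k}"
        have "\<beta> h l * (\<Sum>i<n. e i * act i (w h l, b h l)) \<le> \<bar>\<beta> h l\<bar> * \<bar>\<Sum>i<n. e i * act i (w h l, b h l)\<bar>"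
          by (metis abs_ge_self abs_mult)
        also have "\<dots> \<le> a2 * (?X 1 + ?X (-1))"
          using wb[OF h l] h l a by (intro mult_mono abs) (force simp: N_def)+
        finally show "\<beta> h l * (\<Sum>i<n. e i * act i (w h l, b h l)) \<le> a2 * (?X 1 + ?X (-1))" .
      qed
      also have "\<dots> = (real k * a2) * (?X 1 + ?X (-1))" by simp
      also have "(\<Sum>i<n. e i * (dotp d (w0 h) (x i) + b0 h)) \<le> (a3 + a4) * lin e"
      proof -
        have "(\<Sum>i<n. e i * (dotp d (w0 h) (x i) + b0 h)) \<le> a4 * (\<Sum>j<d. \<bar>\<Sum>i<n. e i * x i j\<bar>) + a3 * \<bar>\<Sum>i<n. e i\<bar>"
          using comb[of "w0 h" a4 "b0 h" a3 e] wb0[OF h] by auto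
        also have "\<dots> \<le> (a3 + a4) * (\<Sum>j<d. \<bar>\<Sum>i<n. e i * x i j\<bar>) + (a3 + a4) * \<bar>\<Sum>i<n. e i\<bar>"
          using a by (intro add_mono mult_right_mono) (auto simp: sum_nonneg)
        also have "\<dots> = (a3 + a4) * lin e" by (simp only: lin_def distrib_left)
        finally show ?thesis .
      qed
      finally show ?thesis by simp
    qed
    then show ?thesis using T by (subst Max_le_iff) auto
  qed
  have "rade n (\<lambda>e. MAX g\<in>T. \<Sum>i<n. e i * g (x i)) \<le>
      (real k * a2) * (rade n (\<lambda>e. MAX p\<in>N. \<Sum>i<n. e i * (1 * act i p)) + rade n (\<lambda>e. MAX p\<in>N. \<Sum>i<n. e i * (-1 * act i p)))
      + (a3 + a4) * rade n lin"
    unfolding rade_add[symmetric] rade_cmult[symmetric] by (rule rade_mono) (rule point)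
  also have "\<dots> \<le> (real k * a2) * (rade n lin + rade n lin) + (a3 + a4) * rade n lin"
    using a by (intro add_mono mult_left_mono neurons) auto
  also have "\<dots> = (2 * (real k * a2) + a3 + a4) * rade n lin" by (simp add: algebra_simps)
  also have "\<dots> \<le> (2 * (real k * a2) + a3 + a4) * ((real d + 1) * sqrt (real n))"
    using a by (intro mult_left_mono lin_le) auto
  finally show ?thesis .
qed


section \<open>Approximation of functions with a finite Klusowski--Barron coefficient\<close>

lemma unit_complex_phase_measurable:
  assumes H [measurable]: "H \<in> borel_measurable B" and H1: "\<And>w. w \<in> space B \<Longrightarrow> cmod (H w) = 1"
  obtains z where "z \<in> borel_measurable B" "\<And>w. w \<in> space B \<Longrightarrow> H w = cis (z w)"
proof -
  let ?a = "\<lambda>x::real. arccos (max (-1) (min 1 x))"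
  have "continuous_on UNIV ?a" by (intro continuous_intros) auto
  then have [measurable]: "?a \<in> borel_measurable borel" by (rule borel_measurable_continuous_onI)
  define z where "z w = (if 0 \<le> Im (H w) then ?a (Re (H w)) else - ?a (Re (H w)))" for w
  have "H w = cis (z w)" if "w \<in> space B" for w
  proof -
    have sq: "(Re (H w))\<^sup>2 + (Im (H w))\<^sup>2 = 1" using H1[OF that] by (simp add: cmod_def)
    have r: "\<bar>Re (H w)\<bar> \<le> 1" using abs_Re_le_cmod[of "H w"] H1[OF that] by simp
    then have "max (-1) (min 1 (Re (H w))) = Re (H w)" using r by (simp add: abs_le_iff min_absorb2 max_absorb2)
    then have "?a (Re (H w)) = arccos (Re (H w))" by simp
    moreover have "sin (arccos (Re (H w))) = \<bar>Im (H w)\<bar>"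
    proof -
      have "sin (arccos (Re (H w))) = sqrt (1 - (Re (H w))\<^sup>2)" using r by (intro sin_arccos) auto
      also have "1 - (Re (H w))\<^sup>2 = (Im (H w))\<^sup>2" using sq by linarith
      finally show ?thesis by simp
    qed
    ultimately show ?thesis using r by (auto simp: z_def complex_eq_iff cos_arccos)
  qed
  moreover have "z \<in> borel_measurable B" unfolding z_def by measurable
  ultimately show thesis using that by blast
qed

lemma fourier_rep_cosine:
  assumes "fourier_rep d h F"
  obtains T z where "finite_measure T" "sets T = sets (euc d)" "z \<in> borel_measurable (euc d)"
    "\<And>x. x \<in> space (euc d) \<Longrightarrow> h x = (\<integral>w. cos (dotp d w x + z w) \<partial>T)"
    "\<And>m. fourier_moment d m F = (\<integral>\<^sup>+w. ennreal (norm1 d w ^ m) \<partial>T)"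
proof -
  have F: "complex_measure (euc d) F" using assms by (simp add: fourier_rep_def)
  let ?T = "total_variation (euc d) F"
  let ?H = "polar_density (euc d) F"
  interpret T: finite_measure ?T by (rule finite_total_variation[OF F])
  obtain z where z [measurable]: "z \<in> borel_measurable (euc d)"
    and Hz: "\<And>w. w \<in> space (euc d) \<Longrightarrow> ?H w = cis (z w)"
    using unit_complex_phase_measurable[OF polar_density_measurable[OF F] polar_density_norm[OF F]] by blast
  have "h x = (\<integral>w. cos (dotp d w x + z w) \<partial>?T)" if x: "x \<in> space (euc d)" for x
  proof -
    have "complex_of_real (h x) = (\<integral>w. exp (\<i> * complex_of_real (dotp d w x)) * ?H w \<partial>?T)"
      using assms x by (simp add: fourier_rep_def complex_measure_integral_def)
    also have "\<dots> = (\<integral>w. cis (dotp d w x + z w) \<partial>?T)"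
      by (intro Bochner_Integration.integral_cong) (auto simp: Hz cis_conv_exp exp_add[symmetric] algebra_simps)
    finally have "h x = Re (\<integral>w. cis (dotp d w x + z w) \<partial>?T)" by (metis Re_complex_of_real)
    also have "\<dots> = (\<integral>w. Re (cis (dotp d w x + z w)) \<partial>?T)"
    proof (rule integral_Re[symmetric])
      have [measurable]: "(\<lambda>y. cis y) \<in> borel_measurable borel"
        by (intro borel_measurable_continuous_onI continuous_intros)
      show "complex_integrable ?T (\<lambda>w. cis (dotp d w x + z w))"
        by (intro T.integrable_const_bound[of _ 1]) auto
    qed
    finally show ?thesis by simp
  qed
  then show thesis using that[of ?T z] T.finite_measure_axioms z by (simp add: fourier_moment_def)
qed

lemma cos_taylor_bound: "\<bar>cos (y + z :: real) - cos z + y * sin z\<bar> \<le> y\<^sup>2 / 2"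
proof -
  have "cmod (cis z * (iexp y - (\<Sum>k\<le>1. (\<i> * y) ^ k / fact k))) \<le> \<bar>y\<bar> ^ Suc 1 / fact (Suc 1)"
    using iexp_approx1[of y 1] by (simp add: norm_mult)
  moreover have "Re (cis z * (iexp y - (\<Sum>k\<le>1. (\<i> * y) ^ k / fact k))) = cos (y + z) - cos z + y * sin z"
    by (simp add: cis_conv_exp[symmetric] cis_mult Re_exp algebra_simps cos_add)
  ultimately show ?thesis
    using abs_Re_le_cmod[of "cis z * (iexp y - (\<Sum>k\<le>1. (\<i> * y) ^ k / fact k))"]
    by (simp add: power2_eq_square)
qed

lemma integral_cos_taylor:
  fixes T :: "(nat \<Rightarrow> real) measure"
  assumes T: "finite_measure T" and sT [measurable_cong]: "sets T = sets (euc d)"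
    and z [measurable]: "z \<in> borel_measurable (euc d)" and i2: "integrable T (\<lambda>w. (norm1 d w)\<^sup>2)"
    and y [measurable]: "y \<in> borel_measurable (euc d)" and yc: "\<And>w. \<bar>y w\<bar> \<le> c * norm1 d w" and c: "0 \<le> c"
  shows "\<bar>(\<integral>w. cos (y w + z w) \<partial>T) - (\<integral>w. cos (z w) \<partial>T) + (\<integral>w. y w * sin (z w) \<partial>T)\<bar> \<le> c\<^sup>2 * (\<integral>w. (norm1 d w)\<^sup>2 \<partial>T) / 2"
proof -
  interpret T: finite_measure T by fact
  have i: "integrable T (\<lambda>w. cos (z w))" "integrable T (\<lambda>w. cos (y w + z w))"
    by (intro T.integrable_const_bound[of _ 1]; auto)+
  have s: "integrable T (\<lambda>w. y w * sin (z w))"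
  proof (rule Bochner_Integration.integrable_bound)
    show "integrable T (\<lambda>w. c * norm1 d w)" using integrable_norm1[OF T sT i2] by simp
    show "AE w in T. norm (y w * sin (z w)) \<le> norm (c * norm1 d w)"
    proof (rule AE_I2)
      fix w
      have "\<bar>y w\<bar> * \<bar>sin (z w)\<bar> \<le> (c * norm1 d w) * 1" using yc c by (intro mult_mono) auto
      then show "norm (y w * sin (z w)) \<le> norm (c * norm1 d w)" using c by (simp add: abs_mult)
    qed
  qed measurable
  have "\<bar>(\<integral>w. cos (y w + z w) \<partial>T) - (\<integral>w. cos (z w) \<partial>T) + (\<integral>w. y w * sin (z w) \<partial>T)\<bar>
      = \<bar>\<integral>w. cos (y w + z w) - cos (z w) + y w * sin (z w) \<partial>T\<bar>"
    using i s by simp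
  also have "\<dots> \<le> (\<integral>w. \<bar>cos (y w + z w) - cos (z w) + y w * sin (z w)\<bar> \<partial>T)" by (rule integral_abs_bound)
  also have "\<dots> \<le> (\<integral>w. c\<^sup>2 * (norm1 d w)\<^sup>2 / 2 \<partial>T)"
  proof (rule integral_mono)
    fix w
    have "(y w)\<^sup>2 \<le> (c * norm1 d w)\<^sup>2" using yc[of w] by (simp add: abs_le_square_iff[symmetric] c abs_mult)
    then show "\<bar>cos (y w + z w) - cos (z w) + y w * sin (z w)\<bar> \<le> c\<^sup>2 * (norm1 d w)\<^sup>2 / 2"
      using cos_taylor_bound[of "y w" "z w"] by (simp add: power_mult_distrib)
  qed (use i s i2 in auto)
  also have "\<dots> = c\<^sup>2 * (\<integral>w. (norm1 d w)\<^sup>2 \<partial>T) / 2" by simp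
  finally show ?thesis .
qed

text \<open>The remainder of the Taylor expansion is quadratic in \<open>t\<close>, so the derivative need not be taken
  under the integral sign.\<close>

lemma gradient_cosine:
  fixes T :: "(nat \<Rightarrow> real) measure"
  assumes T: "finite_measure T" and sT: "sets T = sets (euc d)"
    and z [measurable]: "z \<in> borel_measurable (euc d)" and i2: "integrable T (\<lambda>w. (norm1 d w)\<^sup>2)"
    and h: "\<And>x. x \<in> space (euc d) \<Longrightarrow> h x = (\<integral>w. cos (dotp d w x + z w) \<partial>T)"
    and v: "gradient_at_origin d h v" and j: "j < d"
  shows "v j = - (\<integral>w. w j * sin (z w) \<partial>T)"
proof -
  let ?e = "\<lambda>t. (origin d)(j := t)"
  let ?S = "\<integral>w. (norm1 d w)\<^sup>2 \<partial>T"
  have e: "?e t \<in> space (euc d)" for t using j by (auto simp: space_euc extensional_def origin_def)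
  have dot: "dotp d w (?e t) = w j * t" for w t
  proof -
    have "dotp d w (?e t) = (\<Sum>i<d. if i = j then w j * t else 0)"
      unfolding dotp_def by (intro sum.cong) (auto simp: origin_def)
    then show ?thesis using j by simp
  qed
  have quad: "\<bar>h (?e t) - h (?e 0) - t * (- (\<integral>w. w j * sin (z w) \<partial>T))\<bar> \<le> t\<^sup>2 * ?S" for t
  proof -
    have [measurable]: "(\<lambda>w. w j) \<in> borel_measurable (euc d)" by (rule coord_measurable_euc[OF j])
    have "\<bar>(\<integral>w. cos (w j * t + z w) \<partial>T) - (\<integral>w. cos (z w) \<partial>T) + (\<integral>w. (w j * t) * sin (z w) \<partial>T)\<bar> \<le> \<bar>t\<bar>\<^sup>2 * ?S / 2"
    proof (rule integral_cos_taylor[OF T sT z i2])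
      show "\<bar>w j * t\<bar> \<le> \<bar>t\<bar> * norm1 d w" for w
        unfolding abs_mult using abs_coord_le_norm1[OF j, of w] by (simp add: mult.commute mult_left_mono)
    qed auto
    moreover have "(\<integral>w. (w j * t) * sin (z w) \<partial>T) = t * (\<integral>w. w j * sin (z w) \<partial>T)"
    proof -
      have "(\<lambda>w. (w j * t) * sin (z w)) = (\<lambda>w. t * (w j * sin (z w)))" by (auto simp: mult_ac)
      then show ?thesis by simp
    qed
    moreover have "0 \<le> t\<^sup>2 * ?S" by (simp add: integral_nonneg_AE)
    ultimately have "\<bar>(\<integral>w. cos (w j * t + z w) \<partial>T) - (\<integral>w. cos (z w) \<partial>T) + t * (\<integral>w. w j * sin (z w) \<partial>T)\<bar> \<le> t\<^sup>2 * ?S"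
      by (simp only: power2_abs)
    then show ?thesis using h[OF e] by (simp add: dot)
  qed
  have "((\<lambda>t. h (?e t)) has_real_derivative - (\<integral>w. w j * sin (z w) \<partial>T)) (at 0)"
    unfolding DERIV_def
  proof (subst LIM_zero_iff[symmetric], rule Lim_null_comparison)
    let ?D = "- (\<integral>w. w j * sin (z w) \<partial>T)"
    show "eventually (\<lambda>t. norm ((h (?e (0 + t)) - h (?e 0)) / t - ?D) \<le> \<bar>t\<bar> * ?S) (at 0)"
    proof (rule eventually_at_filter[THEN iffD2, OF always_eventually], intro allI impI)
      fix t :: real assume t: "t \<noteq> 0"
      have "(h (?e (0 + t)) - h (?e 0)) / t - ?D = (h (?e t) - h (?e 0) - t * ?D) / t"
      proof -
        have quot: "A / t - D = (A - t * D) / t" for A D :: real using t by (simp add: field_simps)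
        show ?thesis unfolding quot by simp
      qed
      then have "norm ((h (?e (0 + t)) - h (?e 0)) / t - ?D) = \<bar>h (?e t) - h (?e 0) - t * ?D\<bar> / \<bar>t\<bar>"
        by (simp only: real_norm_def abs_divide)
      also have "\<dots> \<le> t\<^sup>2 * ?S / \<bar>t\<bar>" using quad[of t] by (rule divide_right_mono) simp
      also have "\<dots> = \<bar>t\<bar> * ?S"
        using t power2_abs[of t] by (simp add: power2_eq_square field_simps)
      finally show "norm ((h (?e (0 + t)) - h (?e 0)) / t - ?D) \<le> \<bar>t\<bar> * ?S" .
    qed
    show "((\<lambda>t. \<bar>t\<bar> * ?S) \<longlongrightarrow> 0) (at 0)" by (auto intro!: tendsto_eq_intros)
  qed
  then show ?thesis
    using v j DERIV_unique unfolding gradient_at_origin_def by blast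
qed


lemma set_norm_cube_ge: "1 \<le> d \<Longrightarrow> 1 \<le> set_norm d (cube d)"
proof -
  assume d: "1 \<le> d"
  have "(\<lambda>i\<in>{..<d}. 1) \<in> cube d" by (auto simp: cube_def)
  then have "(SUP i\<in>{..<d}. ennreal \<bar>(\<lambda>i\<in>{..<d}. 1) i\<bar>) \<le> set_norm d (cube d)"
    unfolding set_norm_def by (rule SUP_upper)
  moreover have "ennreal \<bar>(\<lambda>i\<in>{..<d}. 1) 0\<bar> \<le> (SUP i\<in>{..<d}. ennreal \<bar>(\<lambda>i\<in>{..<d}. 1) i\<bar>)"
    using d by (intro SUP_upper) auto
  ultimately show ?thesis using d by (auto intro: order_trans)
qed

text \<open>The infimum in the coefficient need not be attained, hence \<open>M + 1\<close>.  The network consists of \<open>k div 2\<close>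
  sampled pairs of units, and \<open>9 sqrt 3 \<le> 16\<close> accounts for \<open>k \<le> 3 (k div 2)\<close>.\<close>

lemma KB_coeff_approximation:
  assumes f: "KB_coeff d (cube d) f \<le> ereal M" "0 \<le> M" and d: "1 \<le> d"
  shows "x \<in> cube d \<Longrightarrow> \<bar>f x\<bar> \<le> 3 * (M + 1)"
    and "2 \<le> k \<Longrightarrow> 2 * (M + 1) \<le> a \<Longrightarrow>
      \<exists>g\<in>nets_relu d k a. \<forall>x\<in>cube d. \<bar>g x - f x\<bar> \<le> 16 * (M + 1) * sqrt (real d / real k)"
proof -
  define C where "C = M + 1"
  have "KB_coeff d (cube d) f < ereal C" using f by (auto simp: C_def intro: le_less_trans)
  then obtain c h F v where c: "0 \<le> c" "c < C" and rep: "fourier_rep d h F" and hf: "\<forall>x\<in>cube d. h x = f x"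
    and mom: "set_norm d (cube d) * fourier_moment d 2 F \<le> ennreal c" and h0: "\<bar>h (origin d)\<bar> \<le> c"
    and grad: "gradient_at_origin d h v" and v: "norm1 d v \<le> c"
    unfolding KB_coeff_def Inf_less_iff by auto
  obtain T z where T: "finite_measure T" and sT [measurable_cong]: "sets T = sets (euc d)"
    and z [measurable]: "z \<in> borel_measurable (euc d)"
    and hT: "\<And>x. x \<in> space (euc d) \<Longrightarrow> h x = (\<integral>w. cos (dotp d w x + z w) \<partial>T)"
    and momT: "\<And>m. fourier_moment d m F = (\<integral>\<^sup>+w. ennreal (norm1 d w ^ m) \<partial>T)"
    by (rule fourier_rep_cosine[OF rep]) (rule that)
  let ?I = "\<integral>\<^sup>+w. ennreal ((norm1 d w)\<^sup>2) \<partial>T"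
  define S where "S = (\<integral>w. (norm1 d w)\<^sup>2 \<partial>T)"
  have "?I = 1 * fourier_moment d 2 F" by (simp add: momT)
  also have "\<dots> \<le> set_norm d (cube d) * fourier_moment d 2 F" using set_norm_cube_ge[OF d] by (intro mult_right_mono) auto
  finally have I: "?I \<le> ennreal c" using mom by (rule order_trans)
  have i2: "integrable T (\<lambda>w. (norm1 d w)\<^sup>2)"
    using I by (intro integrableI_bounded) (auto simp: le_less_trans[OF _ ennreal_less_top])
  have "ennreal S = ?I" unfolding S_def using i2 by (intro nn_integral_eq_integral[symmetric]) auto
  then have "ennreal S \<le> ennreal c" using I by simp
  then have S: "0 \<le> S" "S \<le> c"
    using c by (simp_all add: ennreal_le_iff) (simp add: S_def integral_nonneg_AE)
  have vj: "v j = - (\<integral>w. w j * sin (z w) \<partial>T)" if "j < d" for j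
    by (rule gradient_cosine[OF T sT z i2 hT grad that])
  have h0T: "h (origin d) = (\<integral>w. cos (z w) \<partial>T)"
    using hT[of "origin d"] origin_in_cube cube_subset_space by fastforce
  have cubeE: "x \<in> cube d \<Longrightarrow> x \<in> space (euc d)" for x using cube_subset_space by blast
  have vdot: "dotp d v x = - (\<Sum>j<d. (\<integral>w. w j * sin (z w) \<partial>T) * x j)" for x
    unfolding dotp_def sum_negf[symmetric] by (intro sum.cong) (auto simp: vj)
  have ap: "\<exists>c1 c2 a t. (\<forall>i<n. \<bar>c1 i\<bar> \<le> 1 \<and> \<bar>c2 i\<bar> \<le> 1 \<and> norm1 d (a i) \<le> 1 \<and> 0 \<le> t i \<and> t i \<le> 1) \<and>
    (\<forall>x\<in>cube d. \<bar>f x - (h (origin d) + dotp d v x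
        - S / n * (\<Sum>i<n. c1 i * relu (dotp d (a i) x - t i) + c2 i * relu (dotp d (\<lambda>j. - a i j) x - t i)))\<bar>
      \<le> 9 * S * sqrt (d / n))" if "1 \<le> n" for n :: nat
    using fourier_relu_approximation[OF T sT z S_def i2 that d] hf hT cubeE
    by (simp add: h0T vdot)
  show "\<bar>f x\<bar> \<le> 3 * (M + 1)" if x: "x \<in> cube d"
  proof -
    have "\<bar>(\<integral>w. cos (dotp d w x + z w) \<partial>T) - (\<integral>w. cos (z w) \<partial>T) + (\<integral>w. dotp d w x * sin (z w) \<partial>T)\<bar> \<le> 1\<^sup>2 * S / 2"
      unfolding S_def using dotp_abs_le[OF x] by (intro integral_cos_taylor[OF T sT z i2]) auto
    moreover have "(\<integral>w. dotp d w x * sin (z w) \<partial>T) = - dotp d v x"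
    proof -
      have "(\<integral>w. dotp d w x * sin (z w) \<partial>T) = (\<integral>w. (\<Sum>j<d. (w j * sin (z w)) * x j) \<partial>T)"
        unfolding dotp_def sum_distrib_right by (simp only: mult_ac)
      also have "\<dots> = (\<Sum>j<d. (\<integral>w. w j * sin (z w) \<partial>T) * x j)"
        using abs_coord_le_norm1 coord_measurable_euc
        by (subst Bochner_Integration.integral_sum)
          (auto intro!: integrable_mult_left integrable_first_moment[OF T sT i2])
      finally show ?thesis by (simp add: vdot)
    qed
    ultimately have "\<bar>h x - h (origin d) - dotp d v x\<bar> \<le> S / 2"
      using hT[OF cubeE[OF x]] by (simp add: h0T)
    moreover have "h x = f x" using hf x by blast
    ultimately have "\<bar>f x\<bar> \<le> S / 2 + \<bar>h (origin d)\<bar> + \<bar>dotp d v x\<bar>" by linarith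
    also have "\<dots> \<le> c / 2 + c + c"
      using h0 order_trans[OF dotp_abs_le[OF x, of v] v] S by (intro add_mono divide_right_mono) auto
    also have "\<dots> \<le> 3 * (M + 1)" using c by (simp add: C_def)
    finally show ?thesis .
  qed
  show "\<exists>g\<in>nets_relu d k a. \<forall>x\<in>cube d. \<bar>g x - f x\<bar> \<le> 16 * (M + 1) * sqrt (real d / real k)"
    if k: "2 \<le> k" and a: "2 * (M + 1) \<le> a"
  proof -
    define n where "n = k div 2"
    have "k \<le> 3 * n" using k unfolding n_def by presburger
    then have "real k \<le> real (3 * n)" by (rule of_nat_mono)
    then have n: "1 \<le> n" "2 * n \<le> k" "real k \<le> 3 * real n" using k by (auto simp: n_def)
    obtain c1 c2 w t where b: "\<forall>i<n. \<bar>c1 i\<bar> \<le> 1 \<and> \<bar>c2 i\<bar> \<le> 1 \<and> norm1 d (w i) \<le> 1 \<and> 0 \<le> t i \<and> t i \<le> 1"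
      and le: "\<forall>x\<in>cube d. \<bar>f x - (h (origin d) + dotp d v x
        - S / n * (\<Sum>i<n. c1 i * relu (dotp d (w i) x - t i) + c2 i * relu (dotp d (\<lambda>j. - w i j) x - t i)))\<bar>
      \<le> 9 * S * sqrt (d / n)"
      using ap[OF n(1)] by blast
    define g where "g x = (\<Sum>(i, s)\<in>{..<n} \<times> UNIV. (if s then - (S / n) * c1 i else - (S / n) * c2 i) *
       relu (dotp d (if s then w i else (\<lambda>j. - w i j)) x + - t i)) + dotp d v x + h (origin d)" for x
    have geq: "g x = h (origin d) + dotp d v x
        - S / n * (\<Sum>i<n. c1 i * relu (dotp d (w i) x - t i) + c2 i * relu (dotp d (\<lambda>j. - w i j) x - t i))" for x
    proof -
      have "(\<Sum>(i, s)\<in>{..<n} \<times> UNIV. (if s then - (S / n) * c1 i else - (S / n) * c2 i) *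
         relu (dotp d (if s then w i else (\<lambda>j. - w i j)) x + - t i)) =
         (\<Sum>i<n. - (S / n) * (c1 i * relu (dotp d (w i) x - t i) + c2 i * relu (dotp d (\<lambda>j. - w i j) x - t i)))"
        by (subst sum.cartesian_product[symmetric]) (simp add: UNIV_bool algebra_simps)
      then show ?thesis unfolding g_def sum_distrib_left[symmetric] by simp
    qed
    have "g \<in> nets d k 1 (2 * inverse (real k) * a) a a relu"
    proof -
      have Sn: "S / real n \<le> 2 * inverse (real k) * a"
      proof -
        have "S / real n \<le> C / real n" using S c n by (intro divide_right_mono) auto
        also have "\<dots> \<le> 3 * C / real k" using n k c by (simp add: field_simps mult_left_mono)
        also have "\<dots> \<le> 2 * a / real k" using a c by (intro divide_right_mono) (auto simp: C_def)
        finally show ?thesis by (simp add: field_simps)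
      qed
      have coef: "\<bar>- (S / real n) * u\<bar> \<le> 2 * inverse (real k) * a" if "\<bar>u\<bar> \<le> 1" for u
      proof -
        have "\<bar>- (S / real n) * u\<bar> = (S / real n) * \<bar>u\<bar>" using S by (simp add: abs_mult)
        also have "\<dots> \<le> (S / real n) * 1" using that S by (intro mult_left_mono) auto
        finally show ?thesis using Sn by linarith
      qed
      have "(\<lambda>x. (\<Sum>p\<in>{..<n} \<times> UNIV. (case p of (i, s) \<Rightarrow> if s then - (S / n) * c1 i else - (S / n) * c2 i) *
         relu (dotp d (case p of (i, s) \<Rightarrow> if s then w i else (\<lambda>j. - w i j)) x + (case p of (i, s) \<Rightarrow> - t i)))
         + dotp d v x + h (origin d)) \<in> nets d k 1 (2 * inverse (real k) * a) a a relu"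
      proof (rule nets_finite_index)
        show "card ({..<n} \<times> (UNIV :: bool set)) \<le> k" using n by (simp add: card_cartesian_product)
        show "0 \<le> 2 * inverse (real k) * a" using a f(2) by simp
        show "\<bar>h (origin d)\<bar> \<le> a" "norm1 d v \<le> a" using h0 v c a by (auto simp: C_def)
        fix p :: "nat \<times> bool" assume "p \<in> {..<n} \<times> UNIV"
        then show "norm1 d (case p of (i, s) \<Rightarrow> if s then w i else (\<lambda>j. - w i j)) \<le> 1 \<and>
          \<bar>case p of (i, s) \<Rightarrow> - t i\<bar> \<le> 1 \<and>
          \<bar>case p of (i, s) \<Rightarrow> if s then - (S / n) * c1 i else - (S / n) * c2 i\<bar> \<le> 2 * inverse (real k) * a"
          using b coef by (auto simp: norm1_uminus simp del: mult_minus_left)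
      qed auto
      then show ?thesis by (simp add: g_def[abs_def] case_prod_beta')
    qed
    moreover have "\<bar>g x - f x\<bar> \<le> 16 * (M + 1) * sqrt (real d / real k)" if x: "x \<in> cube d" for x
    proof -
      have "\<bar>g x - f x\<bar> \<le> 9 * S * sqrt (real d / real n)"
        using le x unfolding geq[symmetric] by (simp add: abs_minus_commute)
      also have "\<dots> \<le> 9 * C * sqrt (3 * (real d / real k))"
        using S c n k by (intro mult_mono real_sqrt_le_mono) (auto simp: field_simps mult_left_mono)
      also have "\<dots> = 9 * C * (sqrt 3 * sqrt (real d / real k))" by (simp only: real_sqrt_mult)
      also have "\<dots> \<le> 9 * C * ((16 / 9) * sqrt (real d / real k))"
        using c by (intro mult_left_mono mult_right_mono real_le_lsqrt) (auto simp: power2_eq_square)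
      also have "9 * C * ((16 / 9) * sqrt (real d / real k)) = 16 * C * sqrt (real d / real k)" by simp
      finally show ?thesis unfolding C_def .
    qed
    ultimately show ?thesis unfolding nets_relu_def by blast
  qed
qed


section \<open>The risk bound\<close>

lemma borel_prob_space: "borel_prob d (cube d) \<nu> \<Longrightarrow> space \<nu> = cube d"
  using sets_eq_imp_space_eq[of \<nu> "restrict_space (euc d) (cube d)"] cube_subset_space
  by (auto simp: borel_prob_def space_restrict_space)

lemma borel_prob_measurable:
  assumes "borel_prob d (cube d) \<nu>" "g \<in> borel_measurable (euc d)"
  shows "g \<in> borel_measurable \<nu>"
proof -
  have "g \<in> borel_measurable (restrict_space (euc d) (cube d))" using assms(2) by (rule measurable_restrict_space1)
  moreover have "sets \<nu> = sets (restrict_space (euc d) (cube d))" using assms(1) by (simp add: borel_prob_def)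
  ultimately show ?thesis using measurable_cong_sets[OF _ refl] by blast
qed

lemma KL_pairs_log_density:
  assumes "(\<mu>, \<nu>) \<in> KL_pairs d (cube d)" "log_density_version \<mu> \<nu> f" "\<And>x. x \<in> cube d \<Longrightarrow> \<bar>f x\<bar> \<le> b"
  shows "log_density \<mu> \<nu> f b"
  using assms borel_prob_space[of d \<nu>] by (auto simp: KL_pairs_def borel_prob_def intro!: log_density.intro)

lemma growth_ge_1: "1 \<le> growth k" by (simp add: growth_def)

lemma nets_relu_bounded:
  assumes g: "g \<in> nets_relu d k a" and x: "x \<in> cube d" and k: "1 \<le> k" and a: "0 \<le> a"
  shows "\<bar>g x\<bar> \<le> 6 * a"
proof -
  have "\<bar>g x\<bar> \<le> real k * (2 * inverse (real k) * a * 2) + a + a"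
  proof (rule nets_bounded[OF g[unfolded nets_relu_def] x])
    show "\<bar>relu z\<bar> \<le> 2" if "\<bar>z\<bar> \<le> 2 * 1" for z using that by (auto simp: relu_def)
  qed (use a in simp)
  also have "\<dots> = 6 * a" using k by simp
  finally show ?thesis .
qed

lemma nets_relu_borel: "g \<in> nets_relu d k a \<Longrightarrow> g \<in> borel_measurable (euc d)"
  unfolding nets_relu_def by (erule nets_measurable) simp

text \<open>Symmetrization and contraction of \<open>\<psi>\<close> reduce the deviation to the Rademacher complexity of the class;
  \<open>\<psi>\<close> will be the identity and \<open>exp - 1\<close>, which both vanish at \<open>0\<close>.\<close>

lemma nets_relu_deviation:
  fixes M :: "(nat \<Rightarrow> real) measure" and \<psi> :: "real \<Rightarrow> real"
  assumes M: "borel_prob d (cube d) M" and T: "finite T" "T \<subseteq> nets_relu d k a" "(\<lambda>_. 0) \<in> T"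
    and a: "0 \<le> a" and k: "1 \<le> k" and n: "1 \<le> n" and d: "1 \<le> d"
    and \<psi> [measurable]: "\<psi> \<in> borel_measurable borel" and \<psi>0: "\<psi> 0 = 0" and L: "0 \<le> L"
    and lip: "\<And>s t. \<bar>s\<bar> \<le> 6 * a \<Longrightarrow> \<bar>t\<bar> \<le> 6 * a \<Longrightarrow> \<bar>\<psi> s - \<psi> t\<bar> \<le> L * \<bar>s - t\<bar>"
  obtains r where "r \<in> borel_measurable (\<Pi>\<^sub>M i\<in>{..<n}. M)"
    "(\<integral>\<^sup>+x. ennreal (r x) \<partial>(\<Pi>\<^sub>M i\<in>{..<n}. M)) \<le> ennreal (48 * L * a * real d / sqrt (real n))"
    "\<And>x t. t \<in> T \<Longrightarrow> \<bar>(1 / real n) * (\<Sum>i<n. \<psi> (t (x i))) - (\<integral>z. \<psi> (t z) \<partial>M)\<bar> \<le> r x"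
proof -
  interpret M: prob_space M using M by (simp add: borel_prob_def)
  have sp: "space M = cube d" by (rule borel_prob_space[OF M])
  let ?P = "\<Pi>\<^sub>M i\<in>{..<n}. M"
  interpret P: prob_space ?P by (intro prob_space_PiM) (rule M.prob_space_axioms)
  have T': "T \<noteq> {}" using T(3) by auto
  have bd: "\<bar>t x\<bar> \<le> 6 * a" if "t \<in> T" "x \<in> cube d" for t x
    using T that k a by (intro nets_relu_bounded[of t d k]) auto
  have tm [measurable]: "t \<in> borel_measurable M" if "t \<in> T" for t
    using T(2) that by (intro borel_prob_measurable[OF M] nets_relu_borel) auto
  have int: "integrable M (\<lambda>z. \<psi> (t z))" if t: "t \<in> T" for t
  proof (rule M.integrable_const_bound)
    show "AE z in M. norm (\<psi> (t z)) \<le> L * (6 * a)"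
    proof (rule AE_I2)
      fix z assume "z \<in> space M"
      then have "\<bar>t z\<bar> \<le> 6 * a" using bd[OF t] sp by auto
      then have "\<bar>\<psi> (t z) - \<psi> 0\<bar> \<le> L * \<bar>t z - 0\<bar>" using a by (intro lip) auto
      also have "\<dots> \<le> L * (6 * a)" using \<open>\<bar>t z\<bar> \<le> 6 * a\<close> L by (intro mult_left_mono) auto
      finally show "norm (\<psi> (t z)) \<le> L * (6 * a)" by (simp add: \<psi>0)
    qed
    show "(\<lambda>z. \<psi> (t z)) \<in> borel_measurable M" using t by measurable
  qed
  define dev where "dev t x = (\<Sum>i<n. \<psi> (t (x i)) - (\<integral>z. \<psi> (t z) \<partial>M))" for t :: "(nat \<Rightarrow> real) \<Rightarrow> real" and x :: "nat \<Rightarrow> nat \<Rightarrow> real"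
  define r where "r x = (1 / real n) * (MAX t\<in>T. \<bar>dev t x\<bar>)" for x
  have rad: "rade n (\<lambda>e. MAX t\<in>T. \<Sum>i<n. e i * \<psi> (t (x i))) \<le> L * (6 * a * ((real d + 1) * sqrt (real n)))"
    if x: "\<And>i. i < n \<Longrightarrow> x i \<in> space M" for x
  proof -
    have "rade n (\<lambda>e. MAX t\<in>T. 0 + (\<Sum>i<n. e i * \<psi> (t (x i)))) \<le> rade n (\<lambda>e. MAX t\<in>T. 0 + (\<Sum>i<n. e i * (L * t (x i))))"
    proof (rule rade_contraction[OF T(1) T'])
      fix i s t assume "i < n" "s \<in> T" "t \<in> T"
      then have "\<bar>\<psi> (s (x i)) - \<psi> (t (x i))\<bar> \<le> L * \<bar>s (x i) - t (x i)\<bar>" using x sp by (intro lip bd) auto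
      also have "\<dots> = \<bar>L * s (x i) - L * t (x i)\<bar>" using L by (simp add: abs_mult right_diff_distrib[symmetric])
      finally show "\<bar>\<psi> (s (x i)) - \<psi> (t (x i))\<bar> \<le> \<bar>L * s (x i) - L * t (x i)\<bar>" .
    qed
    also have "\<dots> = rade n (\<lambda>e. MAX t\<in>T. L * (\<Sum>i<n. e i * t (x i)))"
      by (simp add: sum_distrib_left mult_ac)
    also have "\<dots> \<le> rade n (\<lambda>e. L * (MAX t\<in>T. \<Sum>i<n. e i * t (x i)))"
      using T(1) T' L by (intro rade_mono Max_cmult_le) auto
    also have "\<dots> = L * rade n (\<lambda>e. MAX t\<in>T. \<Sum>i<n. e i * t (x i))" by (rule rade_cmult)
    also have "\<dots> \<le> L * ((2 * (real k * (2 * inverse (real k) * a)) + a + a) * ((real d + 1) * sqrt (real n)))"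
      using T T' a L x sp unfolding nets_relu_def
      by (intro mult_left_mono relu_nets_rademacher) auto
    also have "2 * (real k * (2 * inverse (real k) * a)) + a + a = 6 * a" using k by simp
    finally show ?thesis by simp
  qed
  have intdev: "integrable ?P (\<lambda>x. MAX t\<in>T. \<bar>dev t x\<bar>)"
    unfolding dev_def using T' int
    by (intro integrable_Max T(1) integrable_abs Bochner_Integration.integrable_sum
        Bochner_Integration.integrable_diff integrable_PiM_component P.integrable_const M.prob_space_axioms) auto
  have le: "(\<integral>x. (MAX t\<in>T. \<bar>dev t x\<bar>) \<partial>?P) \<le> 4 * (L * (6 * a * ((real d + 1) * sqrt (real n))))"
    unfolding dev_def
    by (rule symmetrization_abs[OF M.prob_space_axioms T(1,3)]) (use int rad \<psi>0 in auto)
  have nn: "0 \<le> (MAX t\<in>T. \<bar>dev t x\<bar>)" for x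
  proof -
    have "\<bar>dev (\<lambda>_. 0) x\<bar> \<le> (MAX t\<in>T. \<bar>dev t x\<bar>)" using T by (intro Max_ge) auto
    then show ?thesis by (rule order_trans[OF abs_ge_zero])
  qed
  show thesis
  proof (rule that[of r])
    show "r \<in> borel_measurable ?P" unfolding r_def using intdev by simp
    have intr: "integrable ?P r" unfolding r_def using intdev by simp
    have "(\<integral>\<^sup>+x. ennreal (r x) \<partial>?P) = ennreal (\<integral>x. r x \<partial>?P)"
      by (rule nn_integral_eq_integral[OF intr]) (simp add: r_def nn)
    also have "(\<integral>x. r x \<partial>?P) = (1 / real n) * (\<integral>x. (MAX t\<in>T. \<bar>dev t x\<bar>) \<partial>?P)" by (simp add: r_def)
    also have "ennreal \<dots> \<le> ennreal ((1 / real n) * (4 * (L * (6 * a * ((real d + 1) * sqrt (real n))))))"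
      by (intro ennreal_leI mult_left_mono le) auto
    also have "(1 / real n) * (4 * (L * (6 * a * ((real d + 1) * sqrt (real n))))) \<le> 48 * L * a * real d / sqrt (real n)"
    proof -
      have "(1 / real n) * (4 * (L * (6 * a * ((real d + 1) * sqrt (real n))))) = 24 * (L * a) * (real d + 1) * (sqrt (real n) / real n)"
        by simp
      also have "sqrt (real n) / real n = 1 / sqrt (real n)" using n by (simp add: real_div_sqrt field_simps)
      also have "24 * (L * a) * (real d + 1) * (1 / sqrt (real n)) \<le> 24 * (L * a) * (2 * real d) * (1 / sqrt (real n))"
        using L a d by (intro mult_right_mono mult_left_mono) auto
      finally show ?thesis by (simp add: mult_ac)
    qed
    finally show "(\<integral>\<^sup>+x. ennreal (r x) \<partial>?P) \<le> ennreal (48 * L * a * real d / sqrt (real n))"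
      by (simp add: ennreal_leI)
    fix x t assume t: "t \<in> T"
    have "(1 / real n) * (\<Sum>i<n. \<psi> (t (x i))) - (\<integral>z. \<psi> (t z) \<partial>M) = (1 / real n) * dev t x"
      using n by (simp add: dev_def sum_subtractf right_diff_distrib)
    then have "\<bar>(1 / real n) * (\<Sum>i<n. \<psi> (t (x i))) - (\<integral>z. \<psi> (t z) \<partial>M)\<bar> = (1 / real n) * \<bar>dev t x\<bar>"
      by (simp add: abs_mult)
    also have "\<dots> \<le> r x" unfolding r_def using T(1) t by (intro mult_left_mono Max_ge) auto
    finally show "\<bar>(1 / real n) * (\<Sum>i<n. \<psi> (t (x i))) - (\<integral>z. \<psi> (t z) \<partial>M)\<bar> \<le> r x" .
  qed
qed

lemma nn_integral_sample_law:
  assumes "prob_space \<mu>" "prob_space \<nu>"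
    and r [measurable]: "r \<in> borel_measurable (\<Pi>\<^sub>M i\<in>{..<n}. \<mu>)" and s [measurable]: "s \<in> borel_measurable (\<Pi>\<^sub>M i\<in>{..<n}. \<nu>)"
  shows "(\<integral>\<^sup>+(x, y). c + ennreal (r x) + ennreal (s y) \<partial>sample_law n \<mu> \<nu>) =
     c + (\<integral>\<^sup>+x. ennreal (r x) \<partial>(\<Pi>\<^sub>M i\<in>{..<n}. \<mu>)) + (\<integral>\<^sup>+y. ennreal (s y) \<partial>(\<Pi>\<^sub>M i\<in>{..<n}. \<nu>))"
proof -
  let ?P = "\<Pi>\<^sub>M i\<in>{..<n}. \<mu>" and ?Q = "\<Pi>\<^sub>M i\<in>{..<n}. \<nu>"
  interpret P: prob_space ?P by (intro prob_space_PiM assms)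
  interpret Q: prob_space ?Q by (intro prob_space_PiM assms)
  have "(\<integral>\<^sup>+(x, y). c + ennreal (r x) + ennreal (s y) \<partial>sample_law n \<mu> \<nu>)
      = (\<integral>\<^sup>+x. \<integral>\<^sup>+y. c + ennreal (r x) + ennreal (s y) \<partial>?Q \<partial>?P)"
    unfolding sample_law_def by (subst Q.nn_integral_fst[symmetric]) auto
  also have "\<dots> = (\<integral>\<^sup>+x. c + ennreal (r x) + (\<integral>\<^sup>+y. ennreal (s y) \<partial>?Q) \<partial>?P)"
    by (intro nn_integral_cong, subst nn_integral_add) (auto simp: Q.emeasure_space_1)
  also have "\<dots> = c + (\<integral>\<^sup>+x. ennreal (r x) \<partial>?P) + (\<integral>\<^sup>+y. ennreal (s y) \<partial>?Q)"
    by (simp add: nn_integral_add P.emeasure_space_1)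
  finally show ?thesis .
qed

lemma nets_relu_cover:
  assumes a: "0 \<le> a" and k: "1 \<le> k" and \<eta>: "0 < \<eta>"
  obtains T where "finite T" "T \<subseteq> nets_relu d k a" "(\<lambda>_. 0) \<in> T"
    "\<And>g. g \<in> nets_relu d k a \<Longrightarrow> \<exists>t\<in>T. \<forall>x\<in>cube d. \<bar>g x - t x\<bar> \<le> \<eta>"
proof -
  let ?A = "2 * a + 1"
  let ?E = "real k * (?A * (real d + 1) + 2) + (real d + 1)"
  define m where "m = nat \<lceil>?E / \<eta>\<rceil> + 1"
  have m: "1 \<le> m" "?E / \<eta> \<le> real m" unfolding m_def by (simp, linarith)
  have Em: "?E / real m \<le> \<eta>" using m \<eta> by (simp add: field_simps)
  have a2: "2 * inverse (real k) * a \<le> ?A"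
  proof -
    have "inverse (real k) * a \<le> 1 * a" using k a by (intro mult_right_mono) (auto simp: field_simps)
    then show ?thesis by simp
  qed
  obtain T where T: "finite T" "T \<subseteq> nets d k 1 (2 * inverse (real k) * a) a a relu"
    and net: "\<And>g. g \<in> nets d k 1 (2 * inverse (real k) * a) a a relu \<Longrightarrow> \<exists>t\<in>T. \<forall>x\<in>cube d. \<bar>g x - t x\<bar> \<le> ?E / real m"
  proof (rule nets_cover[of ?A 1 "2 * inverse (real k) * a" a a m relu 2 d k])
    show "\<bar>relu z\<bar> \<le> 2" if "\<bar>z\<bar> \<le> 2 * 1" for z using that by (auto simp: relu_def)
  qed (use a a2 m relu_lipschitz in auto)
  show thesis
  proof (rule that[of "insert (\<lambda>_. 0) T"])
    show "insert (\<lambda>_. 0) T \<subseteq> nets_relu d k a"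
      using T a zero_in_nets[of 1 "2 * inverse (real k) * a" a a d k relu] by (auto simp: nets_relu_def)
    fix g assume "g \<in> nets_relu d k a"
    then obtain t where "t \<in> T" "\<forall>x\<in>cube d. \<bar>g x - t x\<bar> \<le> ?E / real m" using net by (auto simp: nets_relu_def)
    then show "\<exists>t\<in>insert (\<lambda>_. 0) T. \<forall>x\<in>cube d. \<bar>g x - t x\<bar> \<le> \<eta>" using Em by force
  qed (use T in auto)
qed

lemma sample_law_space:
  assumes "(x, y) \<in> space (sample_law n \<mu> \<nu>)" "i < n"
  shows "x i \<in> space \<mu>" "y i \<in> space \<nu>"
  using assms by (auto simp: sample_law_def space_pair_measure space_PiM PiE_iff)

text \<open>The deviation of \<open>exp g\<close> dominates, with the factor \<open>exp (6 a)\<close> from the contraction of the exponential;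
  the deviation of \<open>g\<close> and the error made by the net are absorbed into the constant \<open>97\<close>.\<close>

lemma risk_le:
  assumes pair: "(\<mu>, \<nu>) \<in> KL_pairs d (cube d)" and ver: "log_density_version \<mu> \<nu> f"
    and fb: "\<And>x. x \<in> cube d \<Longrightarrow> \<bar>f x\<bar> \<le> b"
    and a: "1 \<le> a" and k: "1 \<le> k" and n: "1 \<le> n" and d: "1 \<le> d"
    and h: "h \<in> nets_relu d k a" and near: "\<And>x. x \<in> cube d \<Longrightarrow> \<bar>h x - f x\<bar> \<le> \<delta>"
  shows "(\<integral>\<^sup>+(x, y). ennreal \<bar>KL_estimator (nets_relu d k a) n x y - real_of_ereal (KL \<mu> \<nu>)\<bar> \<partial>sample_law n \<mu> \<nu>)
    \<le> ennreal (\<delta> + (exp \<delta> - 1) + 97 * exp (6 * a) * a * real d / sqrt (real n))"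
proof -
  interpret L: log_density \<mu> \<nu> f b by (rule KL_pairs_log_density[OF pair ver fb])
  have bm: "borel_prob d (cube d) \<mu>" and bn: "borel_prob d (cube d) \<nu>" using pair by (auto simp: KL_pairs_def)
  have sp: "space \<mu> = cube d" "space \<nu> = cube d" using borel_prob_space bm bn by auto
  \<comment> \<open>A net this fine contributes no more than \<open>1 / sqrt n\<close>.\<close>
  define \<eta> where "\<eta> = 1 / (4 * exp (6 * a) * sqrt (real n))"
  have \<eta>: "0 < \<eta>" using n by (simp add: \<eta>_def)
  obtain T where T: "finite T" "T \<subseteq> nets_relu d k a" "(\<lambda>_. 0) \<in> T"
    and net: "\<And>g. g \<in> nets_relu d k a \<Longrightarrow> \<exists>t\<in>T. \<forall>x\<in>cube d. \<bar>g x - t x\<bar> \<le> \<eta>"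
    using nets_relu_cover[of a k \<eta> d] a k \<eta> by auto
  have a0: "0 \<le> a" using a by simp
  have ea: "1 \<le> exp (6 * a)" using a by simp
  obtain r where r: "r \<in> borel_measurable (\<Pi>\<^sub>M i\<in>{..<n}. \<mu>)"
    "(\<integral>\<^sup>+x. ennreal (r x) \<partial>(\<Pi>\<^sub>M i\<in>{..<n}. \<mu>)) \<le> ennreal (48 * 1 * a * real d / sqrt (real n))"
    and rd: "\<And>x t. t \<in> T \<Longrightarrow> \<bar>(1 / real n) * (\<Sum>i<n. t (x i)) - (\<integral>z. t z \<partial>\<mu>)\<bar> \<le> r x"
    by (rule nets_relu_deviation[OF bm T a0 k n d, of "\<lambda>s. s" 1]) auto
  obtain s where s: "s \<in> borel_measurable (\<Pi>\<^sub>M i\<in>{..<n}. \<nu>)"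
    "(\<integral>\<^sup>+x. ennreal (s x) \<partial>(\<Pi>\<^sub>M i\<in>{..<n}. \<nu>)) \<le> ennreal (48 * exp (6 * a) * a * real d / sqrt (real n))"
    and sd: "\<And>x t. t \<in> T \<Longrightarrow> \<bar>(1 / real n) * (\<Sum>i<n. exp (t (x i)) - 1) - (\<integral>z. exp (t z) - 1 \<partial>\<nu>)\<bar> \<le> s x"
  proof (rule nets_relu_deviation[OF bn T a0 k n d, of "\<lambda>s. exp s - 1" "exp (6 * a)"])
    show "\<bar>(exp u - 1) - (exp t - 1)\<bar> \<le> exp (6 * a) * \<bar>u - t\<bar>" if "\<bar>u\<bar> \<le> 6 * a" "\<bar>t\<bar> \<le> 6 * a" for u t :: real
      using exp_diff_le[of u "6 * a" t] that by (simp add: abs_le_iff)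
  qed auto
  have G: "g \<in> borel_measurable \<nu>" "x \<in> space \<nu> \<Longrightarrow> \<bar>g x\<bar> \<le> 6 * a" if "g \<in> nets_relu d k a" for g x
    using that borel_prob_measurable[OF bn nets_relu_borel] nets_relu_bounded[of g d k a x] k a0 sp by auto
  have sd': "\<bar>(1 / real n) * (\<Sum>i<n. exp (t (y i))) - (\<integral>z. exp (t z) \<partial>\<nu>)\<bar> \<le> s y" if t: "t \<in> T" for t y
  proof -
    have "(\<integral>z. exp (t z) - 1 \<partial>\<nu>) = (\<integral>z. exp (t z) \<partial>\<nu>) - 1"
      using G[of t] T(2) t by (intro L.integral_exp_minus_one) auto
    then show ?thesis using sd[OF t, of y] n by (simp add: sum_subtractf right_diff_distrib)
  qed
  have \<delta>: "0 \<le> \<delta> + (exp \<delta> - 1)"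
  proof -
    have "0 \<le> \<delta>" using near[OF origin_in_cube] by linarith
    then show ?thesis using one_le_exp_iff[of \<delta>] by linarith
  qed
  have \<gamma>: "2 * (\<eta> + exp (6 * a) * \<eta>) \<le> 1 / sqrt (real n)"
  proof -
    have "\<eta> + exp (6 * a) * \<eta> \<le> exp (6 * a) * \<eta> + exp (6 * a) * \<eta>"
      using mult_right_mono[OF ea, of \<eta>] \<eta> by simp
    also have "2 * (exp (6 * a) * \<eta> + exp (6 * a) * \<eta>) = 1 / sqrt (real n)" using n by (simp add: \<eta>_def field_simps)
    finally show ?thesis by simp
  qed
  let ?c = "\<delta> + (exp \<delta> - 1) + 1 / sqrt (real n)"
  have "(\<integral>\<^sup>+(x, y). ennreal \<bar>KL_estimator (nets_relu d k a) n x y - real_of_ereal (KL \<mu> \<nu>)\<bar> \<partial>sample_law n \<mu> \<nu>)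
    \<le> (\<integral>\<^sup>+(x, y). ennreal ?c + ennreal (r x) + ennreal (s y) \<partial>sample_law n \<mu> \<nu>)"
  proof (intro nn_integral_mono, clarify)
    fix x y assume xy: "(x, y) \<in> space (sample_law n \<mu> \<nu>)"
    have "\<bar>KL_estimator (nets_relu d k a) n x y - real_of_ereal (KL \<mu> \<nu>)\<bar>
        \<le> \<delta> + (exp \<delta> - 1) + r x + s y + 2 * (\<eta> + exp (6 * a) * \<eta>)"
    proof (rule L.estimator_error[where T = T and h = h and x = x and y = y])
      show "g \<in> borel_measurable \<nu>" if "g \<in> nets_relu d k a" for g using G(1)[OF that] .
      show "\<bar>g z\<bar> \<le> 6 * a" if "g \<in> nets_relu d k a" "z \<in> space \<nu>" for g z using G(2)[OF that] .
      show "\<exists>t\<in>T. \<forall>x\<in>space \<nu>. \<bar>g x - t x\<bar> \<le> \<eta>" if "g \<in> nets_relu d k a" for g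
        unfolding sp by (rule net[OF that])
      show "\<bar>h z - f z\<bar> \<le> \<delta>" if "z \<in> space \<nu>" for z using near that sp by simp
    qed (use n T(2) h rd sd' sample_law_space[OF xy] sp in auto)
    also have "\<dots> \<le> ?c + r x + s y" using \<gamma> by simp
    finally have "ennreal \<bar>KL_estimator (nets_relu d k a) n x y - real_of_ereal (KL \<mu> \<nu>)\<bar> \<le> ennreal (?c + r x + s y)"
      by (rule ennreal_leI)
    also have "\<dots> = ennreal ?c + ennreal (r x) + ennreal (s y)"
      using rd[OF T(3), of x] sd[OF T(3), of y] \<delta> by (subst ennreal_plus[symmetric]; (subst ennreal_plus[symmetric])?; simp)
    finally show "ennreal \<bar>KL_estimator (nets_relu d k a) n x y - real_of_ereal (KL \<mu> \<nu>)\<bar>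
      \<le> ennreal ?c + ennreal (r x) + ennreal (s y)" .
  qed
  also have "\<dots> = ennreal ?c + (\<integral>\<^sup>+x. ennreal (r x) \<partial>(\<Pi>\<^sub>M i\<in>{..<n}. \<mu>)) + (\<integral>\<^sup>+y. ennreal (s y) \<partial>(\<Pi>\<^sub>M i\<in>{..<n}. \<nu>))"
    by (rule nn_integral_sample_law[OF L.pm L.pn r(1) s(1)])
  also have "\<dots> \<le> ennreal ?c + ennreal (48 * 1 * a * real d / sqrt (real n)) + ennreal (48 * exp (6 * a) * a * real d / sqrt (real n))"
    by (intro add_mono r s order_refl)
  also have "\<dots> = ennreal (?c + 48 * 1 * a * real d / sqrt (real n) + 48 * exp (6 * a) * a * real d / sqrt (real n))"
  proof -
    have "0 \<le> ?c" "0 \<le> 48 * 1 * a * real d / sqrt (real n)" "0 \<le> 48 * exp (6 * a) * a * real d / sqrt (real n)"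
      using \<delta> a by simp_all
    then show ?thesis by (simp only: ennreal_plus[symmetric] add_nonneg_nonneg)
  qed
  also have "\<dots> \<le> ennreal (\<delta> + (exp \<delta> - 1) + 97 * exp (6 * a) * a * real d / sqrt (real n))"
  proof (rule ennreal_leI)
    have "1 * 1 \<le> a * real d" using a d by (intro mult_mono) auto
    moreover have "1 * (a * real d) \<le> exp (6 * a) * (a * real d)" using ea a by (intro mult_right_mono) auto
    ultimately have "1 + 48 * (a * real d) + 48 * (exp (6 * a) * (a * real d)) \<le> 97 * (exp (6 * a) * (a * real d))" by linarith
    then have "(1 + 48 * (a * real d) + 48 * (exp (6 * a) * (a * real d))) / sqrt (real n) \<le> 97 * (exp (6 * a) * (a * real d)) / sqrt (real n)"
      by (intro divide_right_mono) auto
    then show "?c + 48 * 1 * a * real d / sqrt (real n) + 48 * exp (6 * a) * a * real d / sqrt (real n)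
      \<le> \<delta> + (exp \<delta> - 1) + 97 * exp (6 * a) * a * real d / sqrt (real n)"
      by (simp add: add_divide_distrib mult_ac)
  qed
  finally show ?thesis .
qed

text \<open>A bound for small \<open>k\<close>, from the boundedness of the networks alone.\<close>

lemma risk_trivial:
  assumes pair: "(\<mu>, \<nu>) \<in> KL_pairs d (cube d)" and KLM: "KL \<mu> \<nu> \<le> ereal M" and M: "0 \<le> M"
    and ver: "log_density_version \<mu> \<nu> f" and fb: "\<And>x. x \<in> cube d \<Longrightarrow> \<bar>f x\<bar> \<le> b"
    and a: "0 \<le> a" and k: "1 \<le> k" and n: "1 \<le> n"
  shows "(\<integral>\<^sup>+(x, y). ennreal \<bar>KL_estimator (nets_relu d k a) n x y - real_of_ereal (KL \<mu> \<nu>)\<bar> \<partial>sample_law n \<mu> \<nu>)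
    \<le> ennreal (6 * a + exp (6 * a) + 1 + M)"
proof -
  interpret L: log_density \<mu> \<nu> f b by (rule KL_pairs_log_density[OF pair ver fb])
  interpret MU: prob_space \<mu> by (rule L.pm)
  interpret NU: prob_space \<nu> by (rule L.pn)
  have bm: "borel_prob d (cube d) \<mu>" and bn: "borel_prob d (cube d) \<nu>" using pair by (auto simp: KL_pairs_def)
  have sp: "space \<mu> = cube d" "space \<nu> = cube d" using borel_prob_space bm bn by auto
  have D: "\<bar>real_of_ereal (KL \<mu> \<nu>)\<bar> \<le> M"
  proof -
    have "L.gain (\<lambda>_. 0) \<le> real_of_ereal (KL \<mu> \<nu>)" by (rule L.gain_le[of _ 0]) auto
    then have "0 \<le> real_of_ereal (KL \<mu> \<nu>)" by (simp add: L.gain_def)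
    moreover have "real_of_ereal (KL \<mu> \<nu>) \<le> M"
      using KLM KL_finite(1)[OF L.fin] by (metis ereal_less_eq(3) real_of_ereal.simps(1))
    ultimately show ?thesis by (simp only: abs_of_nonneg)
  qed
  let ?b = "6 * a + exp (6 * a) + 1"
  interpret S: prob_space "sample_law n \<mu> \<nu>"
  proof -
    interpret P: prob_space "\<Pi>\<^sub>M i\<in>{..<n}. \<mu>" by (intro prob_space_PiM L.pm)
    interpret Q: prob_space "\<Pi>\<^sub>M i\<in>{..<n}. \<nu>" by (intro prob_space_PiM L.pn)
    interpret PQ: pair_prob_space "\<Pi>\<^sub>M i\<in>{..<n}. \<mu>" "\<Pi>\<^sub>M i\<in>{..<n}. \<nu>" ..
    show "prob_space (sample_law n \<mu> \<nu>)" unfolding sample_law_def by unfold_locales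
  qed
  have "(\<integral>\<^sup>+(x, y). ennreal \<bar>KL_estimator (nets_relu d k a) n x y - real_of_ereal (KL \<mu> \<nu>)\<bar> \<partial>sample_law n \<mu> \<nu>)
     \<le> (\<integral>\<^sup>+p. ennreal (?b + M) \<partial>sample_law n \<mu> \<nu>)"
  proof (intro nn_integral_mono, clarify)
    fix x y assume xy: "(x, y) \<in> space (sample_law n \<mu> \<nu>)"
    have emp: "\<bar>(1 / real n) * (\<Sum>i<n. g (x i) - (exp (g (y i)) - 1))\<bar> \<le> ?b" if g: "g \<in> nets_relu d k a" for g
    proof -
      have "\<bar>(1 / real n) * (\<Sum>i<n. g (x i) - (exp (g (y i)) - 1)) - (1 / real n) * (\<Sum>i<n. 0)\<bar> \<le> ?b"
      proof (rule abs_average_le[OF _ n])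
        fix i assume "i < n"
        then have "\<bar>g (x i)\<bar> \<le> 6 * a" "\<bar>g (y i)\<bar> \<le> 6 * a"
          using sample_law_space[OF xy] sp nets_relu_bounded[OF g _ k a] by auto
        moreover from this have "exp (g (y i)) \<le> exp (6 * a)" by simp
        moreover have "0 < exp (g (y i))" by simp
        ultimately show "\<bar>g (x i) - (exp (g (y i)) - 1) - 0\<bar> \<le> ?b" by linarith
      qed
      then show ?thesis by simp
    qed
    have ne: "nets_relu d k a \<noteq> {}"
      using zero_in_nets[of 1 "2 * inverse (real k) * a" a a d k relu] a by (auto simp: nets_relu_def)
    have "\<bar>KL_estimator (nets_relu d k a) n x y\<bar> \<le> ?b"
      unfolding KL_estimator_def using emp ne by (intro cSup_abs_le) auto
    then have "\<bar>KL_estimator (nets_relu d k a) n x y - real_of_ereal (KL \<mu> \<nu>)\<bar> \<le> ?b + M" using D by linarith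
    then show "ennreal \<bar>KL_estimator (nets_relu d k a) n x y - real_of_ereal (KL \<mu> \<nu>)\<bar> \<le> ennreal (?b + M)"
      by (rule ennreal_leI)
  qed
  also have "\<dots> = ennreal (?b + M)" by (simp add: S.emeasure_space_1)
  finally show ?thesis .
qed


text \<open>The first summand serves the finitely many \<open>k\<close> with \<open>log log k < 2 (M + 1)\<close>; the next two serve the
  approximation error, for \<open>d > k\<close> (where the zero network is good enough) and for \<open>d \<le> k\<close>; the last
  one serves the deviations.\<close>

definition risk_constant :: "real \<Rightarrow> real" where
  "risk_constant M = (let c = M + 1 in (12 * c + exp (12 * c) + 1 + M) * exp (exp (2 * c) / 2)
     + (3 * c + exp (3 * c)) + 16 * c * (1 + exp (16 * c)) + 97)"

lemma risk_bound:
  assumes M: "0 \<le> M" and d: "1 \<le> d" and k: "1 \<le> k" and n: "1 \<le> n"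
    and pair: "(\<mu>, \<nu>) \<in> KL_pairs_bounded M d (cube d)"
  shows "(\<integral>\<^sup>+(x, y). ennreal \<bar>KL_estimator (nets_relu d k (growth k)) n x y - real_of_ereal (KL \<mu> \<nu>)\<bar> \<partial>sample_law n \<mu> \<nu>)
    \<le> ennreal (risk_constant M * (real d powr (1/2) * real k powr (-1/2) + real d powr (3/2) * ln (real k) ^ 7 * real n powr (-1/2)))"
    (is "?R \<le> ennreal (?C * (?u + ?v))")
proof -
  define c where "c = M + 1"
  define C1 where "C1 = (12 * c + exp (12 * c) + 1 + M) * exp (exp (2 * c) / 2)"
  define C2 where "C2 = 3 * c + exp (3 * c)"
  define C3 where "C3 = 16 * c * (1 + exp (16 * c))"
  have C: "?C = C1 + C2 + C3 + 97" by (simp add: risk_constant_def Let_def c_def C1_def C2_def C3_def)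
  have c1: "1 \<le> c" using M by (simp add: c_def)
  have C0: "0 \<le> C1" "0 \<le> C2" "0 \<le> C3" using c1 M by (auto simp: C1_def C2_def C3_def)
  obtain f where pr: "(\<mu>, \<nu>) \<in> KL_pairs d (cube d)" and ver: "log_density_version \<mu> \<nu> f"
    and KB: "KB_coeff d (cube d) f \<le> ereal M" and KLM: "KL \<mu> \<nu> \<le> ereal M"
    using pair by (auto simp: KL_pairs_bounded_def)
  note fb = KB_coeff_approximation(1)[OF KB M d]
  have u: "?u = sqrt (real d / real k)"
  proof -
    have "real k powr (-1/2) = inverse (sqrt (real k))"
      using k powr_minus[of "real k" "1/2"] by (simp add: powr_half_sqrt)
    moreover have "real d powr (1/2) = sqrt (real d)" by (simp add: powr_half_sqrt)
    moreover have "sqrt (real d / real k) = sqrt (real d) * inverse (sqrt (real k))"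
      unfolding real_sqrt_divide by (rule divide_inverse)
    ultimately show ?thesis by (simp only:)
  qed
  have lnk: "0 \<le> ln (real k)" using k by simp
  have uv: "0 \<le> ?u" "0 \<le> ?v" using lnk by auto
  define a where "a = growth k"
  have a: "1 \<le> a" by (simp add: a_def growth_ge_1)
  show ?thesis
  proof (cases "real k < exp (exp (2 * c))")
    case True
    have a2: "a \<le> 2 * c"
    proof (cases "k = 1")
      case False
      then have k2: "1 < real k" using k by simp
      have "ln (ln (real k)) \<le> 2 * c"
      proof -
        have "ln (real k) < exp (2 * c)" using True k2 by (metis exp_gt_zero ln_exp ln_less_cancel_iff less_trans zero_less_one)
        moreover have "0 < ln (real k)" using k2 by simp
        ultimately show ?thesis by (metis exp_gt_zero ln_exp ln_less_cancel_iff less_imp_le)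
      qed
      then show ?thesis using False c1 by (simp add: a_def growth_def)
    qed (use c1 in \<open>simp add: a_def growth_def\<close>)
    have "?R \<le> ennreal (6 * a + exp (6 * a) + 1 + M)"
      unfolding a_def[symmetric] by (rule risk_trivial[OF pr KLM M ver fb]) (use a k n in auto)
    also have "\<dots> \<le> ennreal (?C * (?u + ?v))"
    proof (rule ennreal_leI)
      have "exp (6 * a) \<le> exp (12 * c)" using a2 by simp
      then have "6 * a + exp (6 * a) + 1 + M \<le> 12 * c + exp (12 * c) + 1 + M" using a2 by linarith
      also have "\<dots> \<le> (12 * c + exp (12 * c) + 1 + M) * (exp (exp (2 * c) / 2) * ?u)"
      proof -
        have "1 / exp (exp (2 * c) / 2) \<le> ?u"
        proof -
          have "sqrt (real k) \<le> sqrt (exp (exp (2 * c)))" using True by (intro real_sqrt_le_mono) simp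
          also have "\<dots> = exp (exp (2 * c) / 2)" by (rule real_sqrt_unique) (auto simp: exp_double[symmetric])
          finally have "1 / exp (exp (2 * c) / 2) \<le> 1 / sqrt (real k)" using k by (intro divide_left_mono) auto
          also have "\<dots> \<le> sqrt (real d) / sqrt (real k)" using d by (intro divide_right_mono) auto
          finally show ?thesis unfolding u real_sqrt_divide .
        qed
        then have "1 \<le> exp (exp (2 * c) / 2) * ?u" by (simp add: divide_le_eq mult.commute)
        moreover have "0 \<le> 12 * c + exp (12 * c) + 1 + M" using c1 M by (intro add_nonneg_nonneg) auto
        ultimately have "(12 * c + exp (12 * c) + 1 + M) * 1 \<le> (12 * c + exp (12 * c) + 1 + M) * (exp (exp (2 * c) / 2) * ?u)"
          by (rule mult_left_mono)
        then show ?thesis by (simp only: mult_1_right)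
      qed
      also have "\<dots> = C1 * ?u" by (simp add: C1_def)
      also have "\<dots> \<le> ?C * (?u + ?v)" using C0 uv unfolding C by (intro mult_mono) auto
      finally show "6 * a + exp (6 * a) + 1 + M \<le> ?C * (?u + ?v)" .
    qed
    finally show ?thesis .
  next
    case False
    then have big: "exp (exp (2 * c)) \<le> real k" by simp
    have e2: "exp (2 * c) \<le> ln (real k)" using big k by (subst ln_ge_iff) auto
    have lpos: "0 < ln (real k)" using e2 exp_gt_zero[of "2 * c"] by linarith
    have l2: "2 * c \<le> ln (ln (real k))" using e2 lpos by (subst ln_ge_iff) auto
    have k2: "2 \<le> k" using lpos by (cases "k = 1") (use k in auto)
    have aeq: "a = ln (ln (real k))" using l2 c1 k2 by (simp add: a_def growth_def)
    have a2: "2 * (M + 1) \<le> a" using l2 by (simp add: aeq c_def)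
    have exp6: "exp (6 * a) = ln (real k) ^ 6"
    proof -
      have "exp (6 * a) = exp a ^ 6" using exp_of_nat_mult[of 6 a] by simp
      then show ?thesis using lpos by (simp add: aeq)
    qed
    have lna: "a \<le> ln (real k)" unfolding aeq using lpos ln_le_minus_one[of "ln (real k)"] by linarith
    have stoch: "97 * exp (6 * a) * a * real d / sqrt (real n) \<le> 97 * ?v"
    proof -
      have dd: "real d \<le> real d powr (3/2)"
        using d powr_mono[of 1 "3/2" "real d"] by simp
      have "exp (6 * a) * a * real d \<le> ln (real k) ^ 6 * ln (real k) * real d powr (3/2)"
        unfolding exp6 using lna dd lpos a by (intro mult_mono) auto
      also have "ln (real k) ^ 6 * ln (real k) = ln (real k) ^ 7" by (simp add: power_Suc[symmetric] mult.commute eval_nat_numeral)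
      finally have "exp (6 * a) * a * real d * (1 / sqrt (real n)) \<le> ln (real k) ^ 7 * real d powr (3/2) * (1 / sqrt (real n))"
        by (intro mult_right_mono) auto
      moreover have v: "?v = ln (real k) ^ 7 * real d powr (3/2) * (1 / sqrt (real n))"
      proof -
        have "real n powr (-1/2) = inverse (sqrt (real n))"
          using n powr_minus[of "real n" "1/2"] by (simp add: powr_half_sqrt)
        then have "real n powr (-1/2) = 1 / sqrt (real n)" by (simp only: inverse_eq_divide)
        then show ?thesis by (simp only: mult_ac)
      qed
      moreover have "97 * exp (6 * a) * a * real d / sqrt (real n) = 97 * (exp (6 * a) * a * real d * (1 / sqrt (real n)))"
        by simp
      ultimately show ?thesis by (simp only: mult_left_mono)
    qed
    have "\<exists>h\<in>nets_relu d k a. \<exists>\<delta>. (\<forall>x\<in>cube d. \<bar>h x - f x\<bar> \<le> \<delta>) \<and> \<delta> + (exp \<delta> - 1) \<le> (C2 + C3) * ?u"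
    proof (cases "d \<le> k")
      case True
      obtain h where h: "h \<in> nets_relu d k a" and near: "\<forall>x\<in>cube d. \<bar>h x - f x\<bar> \<le> 16 * c * ?u"
        using KB_coeff_approximation(2)[OF KB M d k2 a2] unfolding c_def u by blast
      let ?\<delta> = "16 * c * ?u"
      have u1: "?u \<le> 1" using True k unfolding u by simp
      have \<delta>0: "0 \<le> ?\<delta>" "?\<delta> \<le> 16 * c" using uv u1 c1 mult_left_mono[OF u1, of "16 * c"] by auto
      have "exp ?\<delta> - exp 0 \<le> exp ?\<delta> * \<bar>?\<delta> - 0\<bar>" using exp_diff_le[of ?\<delta> ?\<delta> 0] \<delta>0 by (simp add: abs_le_iff)
      also have "\<dots> \<le> exp (16 * c) * ?\<delta>" using \<delta>0 by (intro mult_mono) auto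
      finally have "?\<delta> + (exp ?\<delta> - 1) \<le> C3 * ?u" by (simp add: C3_def algebra_simps)
      also have "\<dots> \<le> (C2 + C3) * ?u" using C0 uv by (intro mult_right_mono) auto
      finally show ?thesis using h near by blast
    next
      case False
      have zero: "(\<lambda>_. 0) \<in> nets_relu d k a"
        using zero_in_nets[of 1 "2 * inverse (real k) * a" a a d k relu] a by (auto simp: nets_relu_def)
      have "1 \<le> ?u" using False k unfolding u by simp
      then have "C2 * 1 \<le> (C2 + C3) * ?u" using C0 by (intro mult_mono) auto
      moreover have "3 * c + (exp (3 * c) - 1) \<le> C2 * 1" by (simp add: C2_def)
      ultimately have "3 * c + (exp (3 * c) - 1) \<le> (C2 + C3) * ?u" by linarith
      moreover have "\<forall>x\<in>cube d. \<bar>0 - f x\<bar> \<le> 3 * c" using fb by (auto simp: c_def)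
      ultimately show ?thesis using zero by (intro bexI[of _ "\<lambda>_. 0"] exI[of _ "3 * c"]) auto
    qed
    then obtain h \<delta> where h: "h \<in> nets_relu d k a" and near: "\<forall>x\<in>cube d. \<bar>h x - f x\<bar> \<le> \<delta>"
      and \<delta>: "\<delta> + (exp \<delta> - 1) \<le> (C2 + C3) * ?u" by blast
    have "?R \<le> ennreal (\<delta> + (exp \<delta> - 1) + 97 * exp (6 * a) * a * real d / sqrt (real n))"
      unfolding a_def[symmetric] by (rule risk_le[OF pr ver fb a k n d h]) (use near in auto)
    also have "\<dots> \<le> ennreal (?C * (?u + ?v))"
    proof (rule ennreal_leI)
      have "\<delta> + (exp \<delta> - 1) + 97 * exp (6 * a) * a * real d / sqrt (real n) \<le> (C2 + C3) * ?u + 97 * ?v"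
        by (intro add_mono \<delta> stoch)
      also have "\<dots> \<le> ?C * ?u + ?C * ?v"
      proof (rule add_mono)
        have "C2 + C3 \<le> ?C" "97 \<le> ?C" using C0 unfolding C by linarith+
        then show "(C2 + C3) * ?u \<le> ?C * ?u" "97 * ?v \<le> ?C * ?v" using uv by (simp_all only: mult_right_mono)
      qed
      finally show "\<delta> + (exp \<delta> - 1) + 97 * exp (6 * a) * a * real d / sqrt (real n) \<le> ?C * (?u + ?v)"
        by (simp only: distrib_left)
    qed
    finally show ?thesis .
  qed
qed


section \<open>Density of networks with bounded weights\<close>

text \<open>The span of the units that the classes allow, with coefficients of any size.\<close>

inductive_set ridge_span :: "nat \<Rightarrow> (real \<Rightarrow> real) \<Rightarrow> ((nat \<Rightarrow> real) \<Rightarrow> real) set"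
  for d :: nat and \<phi> :: "real \<Rightarrow> real" where
  unit: "norm1 d w \<le> 1 \<Longrightarrow> \<bar>b\<bar> \<le> 1 \<Longrightarrow> (\<lambda>x. c * \<phi> (dotp d w x + b)) \<in> ridge_span d \<phi>"
| add: "f \<in> ridge_span d \<phi> \<Longrightarrow> g \<in> ridge_span d \<phi> \<Longrightarrow> (\<lambda>x. f x + g x) \<in> ridge_span d \<phi>"

lemma ridge_span_scale: "f \<in> ridge_span d \<phi> \<Longrightarrow> (\<lambda>x. a * f x) \<in> ridge_span d \<phi>"
proof (induction rule: ridge_span.induct)
  case (unit w b c)
  then show ?case using ridge_span.unit[of d w b "a * c" \<phi>] by (simp add: mult.assoc)
next
  case (add f g)
  then show ?case using ridge_span.add[of "\<lambda>x. a * f x" d \<phi> "\<lambda>x. a * g x"] by (simp add: distrib_left)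
qed

lemma dotp_zero_weight: "norm1 d w \<le> 0 \<Longrightarrow> dotp d w x = 0"
proof -
  assume "norm1 d w \<le> 0"
  then have "\<bar>w j\<bar> \<le> 0" if "j < d" for j using abs_coord_le_norm1[OF that, of w] by linarith
  then show ?thesis by (simp add: dotp_def)
qed

lemma nets_add:
  assumes "f \<in> nets d k 1 1 0 0 \<phi>" "g \<in> nets d k' 1 1 0 0 \<phi>"
  shows "(\<lambda>x. f x + g x) \<in> nets d (k + k') 1 1 0 0 \<phi>"
proof -
  obtain \<beta> w b w0 b0 where f: "f = (\<lambda>x. (\<Sum>i=1..k. \<beta> i * \<phi> (dotp d (w i) x + b i)) + dotp d w0 x + b0)"
    and f': "\<And>i. i \<in> {1..k} \<Longrightarrow> norm1 d (w i) \<le> 1" "\<And>i. i \<in> {1..k} \<Longrightarrow> \<bar>b i\<bar> \<le> 1"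
    "\<And>i. i \<in> {1..k} \<Longrightarrow> \<bar>\<beta> i\<bar> \<le> 1" "\<bar>b0\<bar> \<le> 0" "norm1 d w0 \<le> 0"
    using assms(1) by (rule netsE) (rule that)
  obtain \<gamma> v c v0 c0 where g: "g = (\<lambda>x. (\<Sum>i=1..k'. \<gamma> i * \<phi> (dotp d (v i) x + c i)) + dotp d v0 x + c0)"
    and g': "\<And>i. i \<in> {1..k'} \<Longrightarrow> norm1 d (v i) \<le> 1" "\<And>i. i \<in> {1..k'} \<Longrightarrow> \<bar>c i\<bar> \<le> 1"
    "\<And>i. i \<in> {1..k'} \<Longrightarrow> \<bar>\<gamma> i\<bar> \<le> 1" "\<bar>c0\<bar> \<le> 0" "norm1 d v0 \<le> 0"
    using assms(2) by (rule netsE) (rule that)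
  have "(\<lambda>x. (\<Sum>p\<in>{1..k} <+> {1..k'}. case_sum \<beta> \<gamma> p * \<phi> (dotp d (case_sum w v p) x + case_sum b c p))
      + dotp d (\<lambda>_. 0) x + 0) \<in> nets d (k + k') 1 1 0 0 \<phi>"
    by (rule nets_finite_index) (use f' g' in \<open>auto simp: card_Plus norm1_def\<close>)
  moreover have "(\<Sum>p\<in>{1..k} <+> {1..k'}. case_sum \<beta> \<gamma> p * \<phi> (dotp d (case_sum w v p) x + case_sum b c p))
      + dotp d (\<lambda>_. 0) x + 0 = f x + g x" for x
    using f'(4) g'(4) unfolding f g dotp_zero_weight[OF f'(5)] dotp_zero_weight[OF g'(5)]
    by (subst sum.Plus) (simp_all add: dotp_def)
  ultimately show ?thesis by (simp only:)
qed

text \<open>A coefficient larger than \<open>1\<close> is distributed over several copies of the same unit.\<close>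

lemma ridge_span_nets:
  assumes "f \<in> ridge_span d \<phi>"
  shows "\<exists>k. f \<in> nets d k 1 1 0 0 \<phi>"
  using assms
proof (induction rule: ridge_span.induct)
  case (unit w b c)
  define m where "m = nat \<lceil>\<bar>c\<bar>\<rceil> + 1"
  have m: "0 < real m" "\<bar>c\<bar> \<le> real m"
  proof -
    show "\<bar>c\<bar> \<le> real m"
      unfolding m_def of_nat_add by (rule order_trans[OF real_nat_ceiling_ge]) simp
    show "0 < real m" unfolding m_def by (subst of_nat_0_less_iff) simp
  qed
  have "(\<lambda>x. (\<Sum>i<m. (c / m) * \<phi> (dotp d w x + b)) + dotp d (\<lambda>_. 0) x + 0) \<in> nets d m 1 1 0 0 \<phi>"
    by (rule nets_finite_index) (use unit m in \<open>auto simp: norm1_def\<close>)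
  moreover have "(\<Sum>i<m. (c / m) * \<phi> (dotp d w x + b)) + dotp d (\<lambda>_. 0) x + 0 = c * \<phi> (dotp d w x + b)" for x
    using m by (simp add: dotp_def)
  ultimately show ?case by (intro exI[of _ m]) (simp only:)
next
  case (add f g)
  then show ?case using nets_add by blast
qed

lemma nets_mono:
  assumes "k \<le> k'"
  shows "nets d k 1 1 0 0 \<phi> \<subseteq> nets_star d k' \<phi>"
proof
  fix f assume "f \<in> nets d k 1 1 0 0 \<phi>"
  then show "f \<in> nets_star d k' \<phi>"
    unfolding nets_star_def
  proof (rule netsE)
    fix \<beta> w b w0 b0 assume f: "f = (\<lambda>x. (\<Sum>i=1..k. \<beta> i * \<phi> (dotp d (w i) x + b i)) + dotp d w0 x + b0)"
    and f': "\<And>i. i \<in> {1..k} \<Longrightarrow> norm1 d (w i) \<le> 1" "\<And>i. i \<in> {1..k} \<Longrightarrow> \<bar>b i\<bar> \<le> 1"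
    "\<And>i. i \<in> {1..k} \<Longrightarrow> \<bar>\<beta> i\<bar> \<le> 1" "\<bar>b0\<bar> \<le> 0" "norm1 d w0 \<le> 0"
    show "f \<in> nets d k' 1 1 1 0 \<phi>"
      unfolding f by (rule nets_finite_index) (use f' assms in auto)
  qed
qed

definition ridge_closure :: "nat \<Rightarrow> (real \<Rightarrow> real) \<Rightarrow> ((nat \<Rightarrow> real) \<Rightarrow> real) set" where
  "ridge_closure d \<phi> = {f. \<forall>e>0. \<exists>g\<in>ridge_span d \<phi>. \<forall>x\<in>cube d. \<bar>f x - g x\<bar> \<le> e}"

lemma ridge_closure_limit:
  assumes "\<And>e. 0 < e \<Longrightarrow> \<exists>g\<in>ridge_closure d \<phi>. \<forall>x\<in>cube d. \<bar>f x - g x\<bar> \<le> e"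
  shows "f \<in> ridge_closure d \<phi>"
  unfolding ridge_closure_def
proof (intro CollectI allI impI)
  fix e :: real assume e: "0 < e"
  obtain g where g: "g \<in> ridge_closure d \<phi>" "\<forall>x\<in>cube d. \<bar>f x - g x\<bar> \<le> e / 2" using assms[of "e / 2"] e by auto
  moreover obtain h where h: "h \<in> ridge_span d \<phi>" "\<forall>x\<in>cube d. \<bar>g x - h x\<bar> \<le> e / 2"
    using g(1) half_gt_zero[OF e] unfolding ridge_closure_def by blast
  have "\<bar>f x - h x\<bar> \<le> e" if "x \<in> cube d" for x
  proof -
    have "\<bar>f x - g x\<bar> \<le> e / 2" "\<bar>g x - h x\<bar> \<le> e / 2" using g(2) h(2) that by auto
    then show ?thesis by linarith
  qed
  then show "\<exists>g\<in>ridge_span d \<phi>. \<forall>x\<in>cube d. \<bar>f x - g x\<bar> \<le> e" using h(1) by blast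
qed

lemma ridge_closure_span: "f \<in> ridge_span d \<phi> \<Longrightarrow> f \<in> ridge_closure d \<phi>"
  unfolding ridge_closure_def by force

lemma ridge_closure_unit: "norm1 d w \<le> 1 \<Longrightarrow> \<bar>b\<bar> \<le> 1 \<Longrightarrow> (\<lambda>x. \<phi> (dotp d w x + b)) \<in> ridge_closure d \<phi>"
  using ridge_closure_span[OF ridge_span.unit[of d w b 1 \<phi>]] by simp

lemma ridge_closure_add:
  assumes "f \<in> ridge_closure d \<phi>" "g \<in> ridge_closure d \<phi>"
  shows "(\<lambda>x. f x + g x) \<in> ridge_closure d \<phi>"
  unfolding ridge_closure_def
proof (intro CollectI allI impI)
  fix e :: real assume e: "0 < e"
  then have e2: "0 < e / 2" by simp
  obtain f' where f': "f' \<in> ridge_span d \<phi>" "\<forall>x\<in>cube d. \<bar>f x - f' x\<bar> \<le> e / 2"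
    using assms(1) e2 unfolding ridge_closure_def by blast
  obtain g' where g': "g' \<in> ridge_span d \<phi>" "\<forall>x\<in>cube d. \<bar>g x - g' x\<bar> \<le> e / 2"
    using assms(2) e2 unfolding ridge_closure_def by blast
  have "\<bar>(f x + g x) - (f' x + g' x)\<bar> \<le> e" if "x \<in> cube d" for x
  proof -
    have "\<bar>f x - f' x\<bar> \<le> e / 2" "\<bar>g x - g' x\<bar> \<le> e / 2" using f'(2) g'(2) that by auto
    then show ?thesis by linarith
  qed
  then show "\<exists>h\<in>ridge_span d \<phi>. \<forall>x\<in>cube d. \<bar>(f x + g x) - h x\<bar> \<le> e"
    using ridge_span.add[OF f'(1) g'(1)] by (intro bexI[of _ "\<lambda>x. f' x + g' x"]) auto
qed

lemma ridge_closure_scale: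
  assumes "f \<in> ridge_closure d \<phi>"
  shows "(\<lambda>x. a * f x) \<in> ridge_closure d \<phi>"
  unfolding ridge_closure_def
proof (intro CollectI allI impI)
  fix e :: real assume e: "0 < e"
  then have e2: "0 < e / (\<bar>a\<bar> + 1)" by (intro divide_pos_pos) auto
  obtain f' where f': "f' \<in> ridge_span d \<phi>" "\<forall>x\<in>cube d. \<bar>f x - f' x\<bar> \<le> e / (\<bar>a\<bar> + 1)"
    using assms(1) e2 unfolding ridge_closure_def by blast
  have "\<bar>a * f x - a * f' x\<bar> \<le> e" if "x \<in> cube d" for x
  proof -
    have "\<bar>a * f x - a * f' x\<bar> = \<bar>a\<bar> * \<bar>f x - f' x\<bar>" by (simp add: abs_mult right_diff_distrib[symmetric])
    also have "\<dots> \<le> (\<bar>a\<bar> + 1) * (e / (\<bar>a\<bar> + 1))" using f'(2) that by (intro mult_mono) auto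
    also have "\<dots> = e" using abs_ge_zero[of a] by (intro nonzero_mult_div_cancel_left[of "\<bar>a\<bar> + 1" e, unfolded times_divide_eq_right[symmetric]]) linarith
    finally show ?thesis .
  qed
  then show "\<exists>h\<in>ridge_span d \<phi>. \<forall>x\<in>cube d. \<bar>a * f x - h x\<bar> \<le> e"
    using ridge_span_scale[OF f'(1)] by (intro bexI[of _ "\<lambda>x. a * f' x"]) auto
qed

lemma ridge_closure_sum:
  assumes "\<And>i. i \<in> I \<Longrightarrow> f i \<in> ridge_closure d \<phi>"
  shows "(\<lambda>x. \<Sum>i\<in>I. f i x) \<in> ridge_closure d \<phi>"
  using assms
proof (induction I rule: infinite_finite_induct)
  case (insert i I)
  then show ?case using ridge_closure_add[of "f i" d \<phi> "\<lambda>x. \<Sum>i\<in>I. f i x"] by simp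
next
  case empty
  have "(\<lambda>x. 0 * \<phi> (dotp d (\<lambda>_. 0) x + 0)) \<in> ridge_span d \<phi>" by (rule ridge_span.unit) (auto simp: norm1_def)
  then show ?case using ridge_closure_span by fastforce
next
  case (infinite I)
  have "(\<lambda>x. 0 * \<phi> (dotp d (\<lambda>_. 0) x + 0)) \<in> ridge_span d \<phi>" by (rule ridge_span.unit) (auto simp: norm1_def)
  then show ?case using infinite ridge_closure_span by fastforce
qed

lemma sigmoid_range: "0 < sigmoid z" "sigmoid z < 1"
  by (auto simp: sigmoid_def add_pos_pos)

lemma sigmoid_deriv: "(sigmoid has_real_derivative (sigmoid z - sigmoid z ^ 2)) (at z)"
proof -
  have pos: "1 + exp (- z) \<noteq> 0" using exp_gt_zero[of "- z"] by linarith
  have "((\<lambda>z. 1 / (1 + exp (- z))) has_real_derivative (exp (- z) / (1 + exp (- z))\<^sup>2)) (at z)"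
    using pos by (auto intro!: derivative_eq_intros simp: power2_eq_square)
  moreover have "exp (- z) / (1 + exp (- z))\<^sup>2 = sigmoid z - sigmoid z ^ 2"
  proof -
    have "1 - 1 / (1 + exp (- z)) = exp (- z) / (1 + exp (- z))" using pos by (simp add: field_simps)
    then have "exp (- z) / (1 + exp (- z)) * (1 / (1 + exp (- z))) = sigmoid z * (1 - sigmoid z)"
      by (simp add: sigmoid_def)
    then show ?thesis by (simp add: power2_eq_square right_diff_distrib)
  qed
  ultimately show ?thesis by (simp add: sigmoid_def[abs_def])
qed

lemma sigmoid_power_deriv:
  "((\<lambda>z. sigmoid z ^ j) has_real_derivative (real j * (sigmoid z ^ j - sigmoid z ^ Suc j))) (at z)"
proof (cases j)
  case (Suc m)
  have "((\<lambda>z. sigmoid z ^ j) has_real_derivative (real j * sigmoid z ^ (j - Suc 0) * (sigmoid z - sigmoid z ^ 2))) (at z)"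
    using DERIV_power[OF sigmoid_deriv, of j z] by (simp add: mult_ac)
  moreover have "real j * sigmoid z ^ (j - Suc 0) * (sigmoid z - sigmoid z ^ 2) = real j * (sigmoid z ^ j - sigmoid z ^ Suc j)"
    by (simp add: Suc algebra_simps power2_eq_square)
  ultimately show ?thesis by simp
qed simp

lemma sigmoid_power_lipschitz: "\<bar>sigmoid y ^ j - sigmoid z ^ j\<bar> \<le> real j * \<bar>y - z\<bar>"
proof (induction y z rule: linorder_wlog)
  case (le y z)
  show ?case
  proof (cases "y = z")
    case False
    then have "y < z" using le by simp
    then obtain \<xi> where "sigmoid z ^ j - sigmoid y ^ j = (z - y) * (real j * (sigmoid \<xi> ^ j - sigmoid \<xi> ^ Suc j))"
      using MVT2[of y z "\<lambda>z. sigmoid z ^ j" "\<lambda>\<xi>. real j * (sigmoid \<xi> ^ j - sigmoid \<xi> ^ Suc j)"] sigmoid_power_deriv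
      by blast
    moreover have "\<bar>sigmoid \<xi> ^ j - sigmoid \<xi> ^ Suc j\<bar> \<le> 1"
    proof -
      have "0 \<le> sigmoid \<xi> ^ i" "sigmoid \<xi> ^ i \<le> 1" for i
        using sigmoid_range[of \<xi>] by (auto intro: power_le_one)
      from this[of j] this[of "Suc j"] show ?thesis by (simp only: abs_le_iff) linarith
    qed
    ultimately have "\<bar>sigmoid z ^ j - sigmoid y ^ j\<bar> \<le> \<bar>z - y\<bar> * (real j * 1)"
      by (simp only: abs_mult abs_of_nat) (intro mult_left_mono, auto)
    then show ?thesis by (simp add: abs_minus_commute mult.commute)
  qed simp
next
  case (sym y z)
  then show ?case by (simp add: abs_minus_commute)
qed

text \<open>Since \<open>\<sigma>' = \<sigma> - \<sigma>\<^sup>2\<close>, the derivative of \<open>\<sigma>\<^sup>j\<close> is \<open>j (\<sigma>\<^sup>j - \<sigma>\<^sup>j\<^sup>+\<^sup>1)\<close>.  Differentiating in the bias, which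
  stays inside the closed span, therefore produces all powers of \<open>\<sigma>\<close>.\<close>

lemma sigmoid_powers_in_closure:
  assumes w: "norm1 d w \<le> 1"
  shows "\<bar>b\<bar> < 1 \<Longrightarrow> (\<lambda>x. sigmoid (dotp d w x + b) ^ Suc j) \<in> ridge_closure d sigmoid"
proof (induction j arbitrary: b)
  case 0
  then show ?case using ridge_closure_unit[OF w, of b sigmoid] by simp
next
  case (Suc j)
  let ?j = "Suc j"
  let ?q = "\<lambda>z. sigmoid z ^ ?j"
  let ?q' = "\<lambda>z. real ?j * (sigmoid z ^ ?j - sigmoid z ^ Suc ?j)"
  define L where "L = real ?j * (real ?j + real (Suc ?j))"
  have L: "0 < L" by (simp add: L_def)
  have lip: "\<bar>?q' y - ?q' z\<bar> \<le> L * \<bar>y - z\<bar>" for y z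
  proof -
    have "\<bar>(sigmoid y ^ ?j - sigmoid y ^ Suc ?j) - (sigmoid z ^ ?j - sigmoid z ^ Suc ?j)\<bar> \<le> (real ?j + real (Suc ?j)) * \<bar>y - z\<bar>"
      using sigmoid_power_lipschitz[of y ?j z] sigmoid_power_lipschitz[of y "Suc ?j" z]
      by (simp only: distrib_right abs_le_iff) linarith
    then have "real ?j * \<bar>(sigmoid y ^ ?j - sigmoid y ^ Suc ?j) - (sigmoid z ^ ?j - sigmoid z ^ Suc ?j)\<bar> \<le> L * \<bar>y - z\<bar>"
      unfolding L_def mult.assoc by (intro mult_left_mono) auto
    then show ?thesis by (simp only: right_diff_distrib[symmetric] abs_mult abs_of_nat)
  qed
  have deriv: "(\<lambda>x. ?q' (dotp d w x + b)) \<in> ridge_closure d sigmoid"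
  proof (rule ridge_closure_limit)
    fix e :: real assume e: "0 < e"
    define h where "h = min (e / L) ((1 - \<bar>b\<bar>) / 2)"
    have h: "0 < h" "h \<le> e / L" "h \<le> (1 - \<bar>b\<bar>) / 2" 
    proof -
      show "0 < h" using e L Suc.prems by (simp add: h_def)
      show "h \<le> e / L" "h \<le> (1 - \<bar>b\<bar>) / 2" unfolding h_def by (rule min.cobounded1, rule min.cobounded2)
    qed
    have "\<bar>b + h\<bar> \<le> \<bar>b\<bar> + h" using abs_triangle_ineq[of b h] h(1) by simp
    also have "\<dots> \<le> \<bar>b\<bar> + (1 - \<bar>b\<bar>) / 2" using h(3) by (rule add_left_mono)
    also have "\<dots> < 1" using Suc.prems by (simp add: field_simps)
    finally have bh: "\<bar>b + h\<bar> < 1" .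
    let ?g = "\<lambda>x. (1 / h) * ?q (dotp d w x + (b + h)) + (- (1 / h)) * ?q (dotp d w x + b)"
    have "?g \<in> ridge_closure d sigmoid"
      by (intro ridge_closure_add ridge_closure_scale Suc.IH bh Suc.prems)
    moreover have "\<bar>?q' (dotp d w x + b) - ?g x\<bar> \<le> e" for x
    proof -
      let ?y = "dotp d w x + b"
      obtain \<xi> where \<xi>: "?y < \<xi>" "\<xi> < ?y + h" "?q (?y + h) - ?q ?y = (?y + h - ?y) * ?q' \<xi>"
        using MVT2[of ?y "?y + h" ?q ?q'] h(1) sigmoid_power_deriv[of ?j] by auto
      have "?g x = (1 / h) * (?q (?y + h) - ?q ?y)" by (simp add: right_diff_distrib add.assoc)
      also have "\<dots> = ?q' \<xi>" unfolding \<xi>(3) using h(1) by simp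
      finally have g: "?g x = ?q' \<xi>" .
      have "\<bar>?q' ?y - ?q' \<xi>\<bar> \<le> L * \<bar>?y - \<xi>\<bar>" by (rule lip)
      also have "\<dots> \<le> L * (e / L)" using \<xi>(1,2) h(2) L by (intro mult_left_mono) auto
      finally show ?thesis unfolding g using L by simp
    qed
    ultimately show "\<exists>g\<in>ridge_closure d sigmoid. \<forall>x\<in>cube d. \<bar>?q' (dotp d w x + b) - g x\<bar> \<le> e"
      by (intro bexI[of _ ?g] ballI)
  qed
  have "(\<lambda>x. ?q (dotp d w x + b) + (- (1 / real ?j)) * ?q' (dotp d w x + b)) \<in> ridge_closure d sigmoid"
    by (rule ridge_closure_add[OF Suc.IH[OF Suc.prems] ridge_closure_scale[OF deriv]])
  moreover have "?q z + (- (1 / real ?j)) * ?q' z = sigmoid z ^ Suc ?j" for z by simp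
  ultimately show ?case by (simp only:)
qed

lemma sigmoid_continuous_in_closure:
  assumes w: "norm1 d w \<le> 1" and G: "continuous_on {0<..<1} G"
  shows "(\<lambda>x. G (sigmoid (dotp d w x))) \<in> ridge_closure d sigmoid"
proof (rule ridge_closure_limit)
  fix e :: real assume e: "0 < e"
  have mono: "sigmoid y \<le> sigmoid z" if "y \<le> z" for y z
    using that by (auto simp: sigmoid_def intro!: divide_left_mono add_pos_pos mult_pos_pos)
  let ?S = "{sigmoid (-1)..sigmoid 1}"
  have "continuous_on ?S G"
    using sigmoid_range[of 1] sigmoid_range[of "-1"] by (intro continuous_on_subset[OF G]) auto
  then obtain p where p: "real_polynomial_function p" "\<And>s. s \<in> ?S \<Longrightarrow> \<bar>G s - p s\<bar> < e"
    using Stone_Weierstrass_real_polynomial_function[of ?S G e] e by auto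
  obtain a n where pa: "p = (\<lambda>s. \<Sum>i\<le>n. a i * s ^ i)"
    using p(1) unfolding real_polynomial_function_iff_sum by blast
  have "(\<lambda>x. \<Sum>i\<le>n. a i * sigmoid (dotp d w x) ^ i) \<in> ridge_closure d sigmoid"
  proof (intro ridge_closure_sum ridge_closure_scale)
    fix i
    show "(\<lambda>x. sigmoid (dotp d w x) ^ i) \<in> ridge_closure d sigmoid"
    proof (cases i)
      case 0
      have "(\<lambda>x. 2 * sigmoid (dotp d (\<lambda>_. 0) x + 0)) \<in> ridge_span d sigmoid"
        by (rule ridge_span.unit) (auto simp: norm1_def)
      then show ?thesis using ridge_closure_span 0 by (fastforce simp: dotp_def sigmoid_def)
    next
      case (Suc j)
      then show ?thesis using sigmoid_powers_in_closure[OF w, of 0 j] by simp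
    qed
  qed
  moreover have "\<bar>G (sigmoid (dotp d w x)) - (\<Sum>i\<le>n. a i * sigmoid (dotp d w x) ^ i)\<bar> \<le> e" if x: "x \<in> cube d" for x
  proof -
    have "\<bar>dotp d w x\<bar> \<le> 1" using dotp_abs_le[OF x, of w] w by linarith
    then have "sigmoid (dotp d w x) \<in> ?S" by (auto simp: abs_le_iff intro!: mono)
    then show ?thesis using p(2) unfolding pa by (intro less_imp_le) auto
  qed
  ultimately show "\<exists>g\<in>ridge_closure d sigmoid. \<forall>x\<in>cube d. \<bar>G (sigmoid (dotp d w x)) - g x\<bar> \<le> e"
    by (intro bexI[of _ "\<lambda>x. \<Sum>i\<le>n. a i * sigmoid (dotp d w x) ^ i"] ballI)
qed

lemma cos_in_closure_sigmoid: "(\<lambda>x. cos (dotp d v x + \<zeta>)) \<in> ridge_closure d sigmoid"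
proof -
  define r where "r = norm1 d v + 1"
  have r: "0 < r" using norm1_nonneg[of d v] unfolding r_def by linarith
  let ?G = "\<lambda>s. cos (r * ln (s / (1 - s)) + \<zeta>)"
  have "continuous_on {0<..<1} ?G" by (intro continuous_intros) auto
  moreover have "norm1 d (\<lambda>j. v j / r) \<le> 1" using r by (simp add: norm1_divide r_def)
  ultimately have "(\<lambda>x. ?G (sigmoid (dotp d (\<lambda>j. v j / r) x))) \<in> ridge_closure d sigmoid"
    by (intro sigmoid_continuous_in_closure)
  moreover have "ln (sigmoid z / (1 - sigmoid z)) = z" for z
  proof -
    have pos: "1 + exp (- z) \<noteq> 0" using exp_gt_zero[of "- z"] by linarith
    have "sigmoid z / (1 - sigmoid z) = exp z"
      using pos by (simp add: sigmoid_def field_simps exp_minus)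
    then show ?thesis by simp
  qed
  ultimately show ?thesis using r by (simp add: dotp_divide)
qed

text \<open>A single cosine is a Fourier integral with respect to a point mass, so that sampled ReLU units
  approximate it.\<close>

lemma cos_in_closure_relu:
  assumes d: "1 \<le> d"
  shows "(\<lambda>x. cos (dotp d v x + \<zeta>)) \<in> ridge_closure d relu"
proof (rule ridge_closure_limit)
  fix e :: real assume e: "0 < e"
  define u where "u = restrict v {..<d}"
  have u: "u \<in> space (euc d)" by (simp add: u_def space_euc)
  have uv: "dotp d u x = dotp d v x" for x by (simp add: u_def dotp_def)
  let ?T = "return (euc d) u"
  interpret T: prob_space ?T using u by (rule prob_space_return)
  define S where "S = (\<integral>w. (norm1 d w)\<^sup>2 \<partial>?T)"
  have i2: "integrable ?T (\<lambda>w. (norm1 d w)\<^sup>2)" 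
    using u by (intro integrableI_bounded) (auto simp: nn_integral_return)
  have S: "0 \<le> S" unfolding S_def by (rule integral_nonneg_AE) simp
  define n where "n = nat \<lceil>real d * (9 * S / e)\<^sup>2\<rceil> + 1"
  have n: "1 \<le> n" "real d * (9 * S / e)\<^sup>2 \<le> real n" unfolding n_def by (simp, linarith)
  have err: "9 * S * sqrt (real d / real n) \<le> e"
  proof -
    have "(9 * S)\<^sup>2 * (real d / real n) \<le> e\<^sup>2"
      using n e by (simp add: power_divide field_simps)
    then have "sqrt ((9 * S)\<^sup>2 * (real d / real n)) \<le> sqrt (e\<^sup>2)" by (rule real_sqrt_le_mono)
    moreover have "sqrt ((9 * S)\<^sup>2 * (real d / real n)) = 9 * S * sqrt (real d / real n)"
      unfolding real_sqrt_mult[of "(9 * S)\<^sup>2"] real_sqrt_abs using S by simp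
    moreover have "sqrt (e\<^sup>2) = e" using e by simp
    ultimately show ?thesis by (simp only:)
  qed
  define A where "A = (\<integral>w. cos \<zeta> \<partial>?T)"
  define B where "B j = (\<integral>w. w j * sin \<zeta> \<partial>?T)" for j
  obtain c1 c2 a t where b: "\<forall>i<n. \<bar>c1 i\<bar> \<le> 1 \<and> \<bar>c2 i\<bar> \<le> 1 \<and> norm1 d (a i) \<le> 1 \<and> 0 \<le> t i \<and> t i \<le> 1"
    and le: "\<forall>x\<in>cube d. \<bar>(\<integral>w. cos (dotp d w x + \<zeta>) \<partial>?T) - (A - (\<Sum>j<d. B j * x j)
        - S / n * (\<Sum>i<n. c1 i * relu (dotp d (a i) x - t i) + c2 i * relu (dotp d (\<lambda>j. - a i j) x - t i)))\<bar>
      \<le> 9 * S * sqrt (d / n)"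
    using fourier_relu_approximation[OF T.finite_measure_axioms _ _ S_def i2 n(1) d, of "\<lambda>_. \<zeta>"]
    unfolding A_def B_def by auto
  let ?g = "\<lambda>x. A * relu (dotp d (\<lambda>_. 0) x + 1) + (\<Sum>j<d. (- B j) * relu (dotp d (\<lambda>i. if i = j then 1 else 0) x + 0)) +
     (\<Sum>i<n. (- (S / n) * c1 i) * relu (dotp d (a i) x + - t i) + (- (S / n) * c2 i) * relu (dotp d (\<lambda>j. - a i j) x + - t i))"
  have e_norm: "norm1 d (\<lambda>i. if i = j then 1 else 0) \<le> 1" for j
  proof -
    have "norm1 d (\<lambda>i. if i = j then 1 else 0) = (\<Sum>i<d. if i = j then 1 else 0)"
      unfolding norm1_def by (intro sum.cong) auto
    also have "\<dots> \<le> 1" by simp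
    finally show ?thesis .
  qed
  have "?g \<in> ridge_closure d relu"
    by (intro ridge_closure_add ridge_closure_sum ridge_closure_scale ridge_closure_unit)
      (use b e_norm in \<open>auto simp: norm1_uminus norm1_def[of d "\<lambda>_. 0"]\<close>)
  moreover have "\<bar>cos (dotp d v x + \<zeta>) - ?g x\<bar> \<le> e" if x: "x \<in> cube d" for x
  proof -
    have "(\<integral>w. cos (dotp d w x + \<zeta>) \<partial>?T) = cos (dotp d v x + \<zeta>)"
      using u by (subst integral_return) (auto simp: uv)
    moreover have "?g x = A - (\<Sum>j<d. B j * x j)
        - S / n * (\<Sum>i<n. c1 i * relu (dotp d (a i) x - t i) + c2 i * relu (dotp d (\<lambda>j. - a i j) x - t i))"
    proof -
      have "(\<Sum>j<d. (- B j) * relu (dotp d (\<lambda>i. if i = j then 1 else 0) x + 0)) = (\<Sum>j<d. - (B j * x j))"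
      proof (intro sum.cong refl)
        fix j assume "j \<in> {..<d}"
        moreover have "dotp d (\<lambda>i. if i = j then 1 else 0) x = (\<Sum>i<d. if i = j then x j else 0)"
          unfolding dotp_def by (intro sum.cong) auto
        ultimately have "dotp d (\<lambda>i. if i = j then 1 else 0) x = x j" "0 \<le> x j" using cubeD[OF x, of j] by auto
        then show "(- B j) * relu (dotp d (\<lambda>i. if i = j then 1 else 0) x + 0) = - (B j * x j)" by (simp add: relu_def)
      qed
      moreover have "relu (dotp d (\<lambda>_. 0) x + 1) = 1" by (simp add: dotp_def relu_def)
      moreover have "(\<Sum>i<n. (- (S / n) * c1 i) * relu (dotp d (a i) x + - t i) + (- (S / n) * c2 i) * relu (dotp d (\<lambda>j. - a i j) x + - t i))
         = - (S / n * (\<Sum>i<n. c1 i * relu (dotp d (a i) x - t i) + c2 i * relu (dotp d (\<lambda>j. - a i j) x - t i)))"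
        unfolding sum_distrib_left sum_negf[symmetric] by (intro sum.cong refl) (simp add: algebra_simps)
      ultimately show ?thesis by (simp only: sum_negf)
    qed
    ultimately show ?thesis using le x err by force
  qed
  ultimately show "\<exists>g\<in>ridge_closure d relu. \<forall>x\<in>cube d. \<bar>cos (dotp d v x + \<zeta>) - g x\<bar> \<le> e"
    by (intro bexI[of _ ?g] ballI)
qed

inductive_set cos_span :: "nat \<Rightarrow> ((nat \<Rightarrow> real) \<Rightarrow> real) set" for d :: nat where
  unit: "(\<lambda>x. c * cos (dotp d v x + \<zeta>)) \<in> cos_span d"
| add: "f \<in> cos_span d \<Longrightarrow> g \<in> cos_span d \<Longrightarrow> (\<lambda>x. f x + g x) \<in> cos_span d"

lemma cos_span_mult_unit: "f \<in> cos_span d \<Longrightarrow> (\<lambda>x. c * cos (dotp d v x + \<zeta>) * f x) \<in> cos_span d"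
proof (induction rule: cos_span.induct)
  case (unit c' v' \<zeta>')
  have "c * cos (dotp d v x + \<zeta>) * (c' * cos (dotp d v' x + \<zeta>')) =
      (c * c' / 2) * cos (dotp d (\<lambda>j. v j + v' j) x + (\<zeta> + \<zeta>')) + (c * c' / 2) * cos (dotp d (\<lambda>j. v j - v' j) x + (\<zeta> - \<zeta>'))" for x
  proof -
    have dot: "dotp d (\<lambda>j. v j + v' j) x = dotp d v x + dotp d v' x" "dotp d (\<lambda>j. v j - v' j) x = dotp d v x - dotp d v' x"
      by (simp_all add: dotp_def sum.distrib sum_subtractf algebra_simps)
    have arg: "dotp d (\<lambda>j. v j + v' j) x + (\<zeta> + \<zeta>') = (dotp d v x + \<zeta>) + (dotp d v' x + \<zeta>')"
      "dotp d (\<lambda>j. v j - v' j) x + (\<zeta> - \<zeta>') = (dotp d v x + \<zeta>) - (dotp d v' x + \<zeta>')"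
      unfolding dot by linarith+
    have "c * cos A * (c' * cos B) = (c * c' / 2) * cos (A + B) + (c * c' / 2) * cos (A - B)" for A B :: real
      by (simp add: cos_add cos_diff algebra_simps)
    then show ?thesis unfolding arg .
  qed
  then show ?case using cos_span.add[OF cos_span.unit cos_span.unit] by (simp only:)
next
  case (add f g)
  then show ?case using cos_span.add by (simp only: distrib_left)
qed

lemma cos_span_mult: "f \<in> cos_span d \<Longrightarrow> g \<in> cos_span d \<Longrightarrow> (\<lambda>x. f x * g x) \<in> cos_span d"
proof (induction rule: cos_span.induct)
  case (unit c v \<zeta>)
  then show ?case by (rule cos_span_mult_unit)
next
  case (add f f')
  then show ?case using cos_span.add[of "\<lambda>x. f x * g x" d "\<lambda>x. f' x * g x"] by (simp add: distrib_right)
qed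

lemma cos_span_in_closure:
  assumes "\<phi> \<in> {sigmoid, relu}" "1 \<le> d" "f \<in> cos_span d"
  shows "f \<in> ridge_closure d \<phi>"
  using assms(3)
proof (induction rule: cos_span.induct)
  case (unit c v \<zeta>)
  then show ?case
    using assms cos_in_closure_sigmoid cos_in_closure_relu by (intro ridge_closure_scale) auto
qed (rule ridge_closure_add)

lemma compact_cube: "compact (cube d)"
proof -
  have eq: "cube d = (\<Pi>\<^sub>E i\<in>UNIV. if i < d then {0..1} else {undefined})"
    by (fastforce simp: cube_def PiE_def Pi_def extensional_def split: if_splits)
  have "compactin (product_topology (\<lambda>_. euclidean) UNIV) (\<Pi>\<^sub>E i\<in>UNIV. if i < d then {0..1::real} else {undefined})"
    by (subst compactin_PiE) (auto simp: compactin_euclidean_iff)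
  then show ?thesis unfolding eq by (simp only: euclidean_product_topology compactin_euclidean_iff)
qed

lemma continuous_on_dotp: "continuous_on S (\<lambda>x. dotp d v x)"
  unfolding dotp_def
  by (intro continuous_intros continuous_on_subset[OF continuous_on_product_coordinates]) auto

text \<open>By Stone--Weierstrass a continuous function is approximated by a trigonometric sum, which lies in the
  closed span; enlarging \<open>k\<close> only adds units with coefficient \<open>0\<close>.\<close>

lemma nets_star_dense:
  assumes \<phi>: "\<phi> \<in> {sigmoid, relu}" and d: "1 \<le> d" and f: "continuous_on (cube d) f" and e: "0 < e"
  obtains k0 where "\<And>k. k0 \<le> k \<Longrightarrow> \<exists>g\<in>nets_star d k \<phi>. \<forall>x\<in>cube d. \<bar>g x - f x\<bar> \<le> e"
proof -
  have "\<exists>g. g \<in> cos_span d \<and> (\<forall>x\<in>cube d. \<bar>f x - g x\<bar> < e / 2)"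
  proof (rule Stone_Weierstrass_HOL[OF compact_cube, where P = "\<lambda>g. g \<in> cos_span d"])
    show "(\<lambda>x. c) \<in> cos_span d" for c
      using cos_span.unit[of c d "\<lambda>_. 0" 0] by (simp add: dotp_def)
    show "continuous_on (cube d) g" if "g \<in> cos_span d" for g
      using that
    proof (induction rule: cos_span.induct)
      case (unit c v \<zeta>)
      show ?case by (intro continuous_intros continuous_on_dotp)
    qed (intro continuous_intros)
    show "(\<lambda>x. g x + h x) \<in> cos_span d" if "g \<in> cos_span d \<and> h \<in> cos_span d" for g h
      using that cos_span.add by blast
    show "(\<lambda>x. g x * h x) \<in> cos_span d" if "g \<in> cos_span d \<and> h \<in> cos_span d" for g h
      using that cos_span_mult by blast
    fix x y assume xy: "x \<in> cube d \<and> y \<in> cube d \<and> x \<noteq> y"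
    then obtain j where j: "j < d" "x j \<noteq> y j"
      by (auto simp: cube_def PiE_iff extensional_def fun_eq_iff) metis
    let ?v = "\<lambda>i. if i = j then 1 else 0 :: real"
    have dot: "dotp d ?v z = z j" for z
    proof -
      have "dotp d ?v z = (\<Sum>i<d. if i = j then z j else 0)" unfolding dotp_def by (intro sum.cong) auto
      then show ?thesis using j by simp
    qed
    have bounds: "0 \<le> x j" "x j \<le> pi" "0 \<le> y j" "y j \<le> pi"
      using cubeD[of x d j] cubeD[of y d j] xy j pi_ge_two by auto
    have "cos (x j) \<noteq> cos (y j)" using cos_inj_pi[OF bounds] j by blast
    then show "\<exists>g. g \<in> cos_span d \<and> g x \<noteq> g y"
      using cos_span.unit[of 1 d ?v 0] by (intro exI[of _ "\<lambda>x. 1 * cos (dotp d ?v x + 0)"]) (simp add: dot)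
  qed (use f e in auto)
  then obtain g where g: "g \<in> cos_span d" "\<forall>x\<in>cube d. \<bar>f x - g x\<bar> < e / 2" by blast
  have "g \<in> ridge_closure d \<phi>" by (rule cos_span_in_closure[OF \<phi> d g(1)])
  moreover have "0 < e / 2" using e by simp
  ultimately obtain h where h: "h \<in> ridge_span d \<phi>" "\<forall>x\<in>cube d. \<bar>g x - h x\<bar> \<le> e / 2"
    unfolding ridge_closure_def by blast
  obtain k0 where k0: "h \<in> nets d k0 1 1 0 0 \<phi>" using ridge_span_nets[OF h(1)] by blast
  have near: "\<bar>h x - f x\<bar> \<le> e" if "x \<in> cube d" for x
  proof -
    have "\<bar>f x - g x\<bar> < e / 2" "\<bar>g x - h x\<bar> \<le> e / 2" using g(2) h(2) that by auto
    then show ?thesis by linarith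
  qed
  show thesis
  proof (rule that[of k0])
    fix k assume "k0 \<le> k"
    then show "\<exists>g\<in>nets_star d k \<phi>. \<forall>x\<in>cube d. \<bar>g x - f x\<bar> \<le> e" using nets_mono k0 near by blast
  qed
qed


section \<open>Almost sure convergence\<close>

text \<open>The injection \<open>s\<close> selects one of the two samples from the jointly independent family.\<close>

lemma hoeffding_average:
  fixes Z :: "'i \<Rightarrow> 'w \<Rightarrow> 'a" and s :: "nat \<Rightarrow> 'i"
  assumes P: "prob_space P" and ind: "prob_space.indep_vars P N Z UNIV" and s: "inj s"
    and N: "\<And>i. N (s i) = M" and dist: "\<And>i. distr P M (Z (s i)) = M"
    and g [measurable]: "g \<in> borel_measurable M" and gb: "\<And>x. x \<in> space M \<Longrightarrow> \<bar>g x\<bar> \<le> B"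
    and B: "0 < B" and n: "1 \<le> n" and e: "0 \<le> e"
  shows "{\<omega> \<in> space P. e \<le> \<bar>(1 / real n) * (\<Sum>i<n. g (Z (s i) \<omega>)) - (\<integral>x. g x \<partial>M)\<bar>} \<in> sets P"
    and "measure P {\<omega> \<in> space P. e \<le> \<bar>(1 / real n) * (\<Sum>i<n. g (Z (s i) \<omega>)) - (\<integral>x. g x \<partial>M)\<bar>}
      \<le> 2 * exp (- (real n * e\<^sup>2 / (2 * B\<^sup>2)))"
proof -
  interpret prob_space P by fact
  let ?I = "s ` {..<n}"
  have ZM [measurable]: "Z (s i) \<in> P \<rightarrow>\<^sub>M M" for i
    using ind N[of i] unfolding indep_vars_def by (metis UNIV_I)
  show "{\<omega> \<in> space P. e \<le> \<bar>(1 / real n) * (\<Sum>i<n. g (Z (s i) \<omega>)) - (\<integral>x. g x \<partial>M)\<bar>} \<in> sets P"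
    by measurable
  have ind': "indep_vars (\<lambda>_. borel) (\<lambda>i \<omega>. g (Z i \<omega>)) ?I"
  proof (rule indep_vars_compose2[OF indep_vars_subset[OF ind subset_UNIV]])
    fix i assume "i \<in> ?I"
    then show "g \<in> borel_measurable (N i)" using N g by auto
  qed
  interpret H: Hoeffding_ineq P ?I "\<lambda>i \<omega>. g (Z i \<omega>)" "\<lambda>_. - B" "\<lambda>_. B" "\<Sum>i\<in>?I. expectation (\<lambda>\<omega>. g (Z i \<omega>))"
  proof unfold_locales
    show "indep_vars (\<lambda>_. borel) (\<lambda>i \<omega>. g (Z i \<omega>)) ?I" by (rule ind')
    fix i assume "i \<in> ?I"
    then obtain j where i: "i = s j" by auto
    show "AE \<omega> in P. g (Z i \<omega>) \<in> {- B..B}"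
    proof (rule AE_I2)
      fix \<omega> assume "\<omega> \<in> space P"
      then have "Z (s j) \<omega> \<in> space M" using measurable_space[OF ZM] by blast
      then show "g (Z i \<omega>) \<in> {- B..B}" using gb[of "Z i \<omega>"] i by (auto simp: abs_le_iff)
    qed
  qed auto
  have exp: "expectation (\<lambda>\<omega>. g (Z (s i) \<omega>)) = (\<integral>x. g x \<partial>M)" for i
    using integral_distr[OF ZM g, of i] dist[of i] by simp
  have reidx: "(\<Sum>i\<in>?I. h i) = (\<Sum>i<n. h (s i))" for h :: "'i \<Rightarrow> real"
    using s by (subst sum.reindex) (auto intro: inj_on_subset)
  have "prob {\<omega> \<in> space P. real n * e \<le> \<bar>(\<Sum>i\<in>?I. g (Z i \<omega>)) - (\<Sum>i\<in>?I. expectation (\<lambda>\<omega>. g (Z i \<omega>)))\<bar>}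
      \<le> 2 * exp (- 2 * (real n * e)\<^sup>2 / (\<Sum>i\<in>?I. (B - - B)\<^sup>2))"
    using e B n by (intro H.Hoeffding_ineq_abs_ge) (auto simp: card_image[OF inj_on_subset[OF s subset_UNIV]])
  also have "- 2 * (real n * e)\<^sup>2 / (\<Sum>i\<in>?I. (B - - B)\<^sup>2) = - (real n * e\<^sup>2 / (2 * B\<^sup>2))"
    using n B by (simp add: card_image[OF inj_on_subset[OF s subset_UNIV]] power2_eq_square field_simps)
  also have "{\<omega> \<in> space P. real n * e \<le> \<bar>(\<Sum>i\<in>?I. g (Z i \<omega>)) - (\<Sum>i\<in>?I. expectation (\<lambda>\<omega>. g (Z i \<omega>)))\<bar>}
      = {\<omega> \<in> space P. e \<le> \<bar>(1 / real n) * (\<Sum>i<n. g (Z (s i) \<omega>)) - (\<integral>x. g x \<partial>M)\<bar>}"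
  proof -
    have "(1 / real n) * S - m = (S - real n * m) / real n" for S m :: real
      using n by (simp add: diff_divide_distrib)
    then have "\<bar>(1 / real n) * S - m\<bar> = \<bar>S - real n * m\<bar> / real n" for S m :: real by simp
    then have "(e \<le> \<bar>(1 / real n) * S - m\<bar>) = (real n * e \<le> \<bar>S - real n * m\<bar>)" for S m :: real
      using n by (simp add: le_divide_eq mult.commute)
    then show ?thesis by (simp add: reidx exp)
  qed
  finally show "prob {\<omega> \<in> space P. e \<le> \<bar>(1 / real n) * (\<Sum>i<n. g (Z (s i) \<omega>)) - (\<integral>x. g x \<partial>M)\<bar>}
      \<le> 2 * exp (- (real n * e\<^sup>2 / (2 * B\<^sup>2)))" .
qed

lemma measure_finite_union_le:
  assumes "prob_space P" "finite T" "\<And>t. t \<in> T \<Longrightarrow> A t \<in> sets P" "\<And>t. t \<in> T \<Longrightarrow> measure P (A t) \<le> c"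
  shows "measure P (\<Union>t\<in>T. A t) \<le> real (card T) * c"
proof -
  interpret prob_space P by fact
  have "measure P (\<Union>t\<in>T. A t) \<le> (\<Sum>t\<in>T. measure P (A t))"
    using assms by (intro finite_measure_subadditive_finite) auto
  also have "\<dots> \<le> real (card T) * c" using assms by (intro sum_bounded_above) auto
  finally show ?thesis .
qed

lemma sigmoid_relu_props:
  assumes "\<phi> \<in> {sigmoid, relu}"
  shows "\<bar>\<phi> y - \<phi> z\<bar> \<le> \<bar>y - z\<bar>" "\<bar>z\<bar> \<le> 2 \<Longrightarrow> \<bar>\<phi> z\<bar> \<le> 2" "\<phi> \<in> borel_measurable borel"
proof -
  show "\<bar>\<phi> y - \<phi> z\<bar> \<le> \<bar>y - z\<bar>"
    using assms sigmoid_power_lipschitz[of y 1 z] relu_lipschitz[of y z] by auto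
  show "\<bar>\<phi> z\<bar> \<le> 2" if "\<bar>z\<bar> \<le> 2"
    using assms that sigmoid_range[of z] by (auto simp: relu_def)
  have "sigmoid \<in> borel_measurable borel" unfolding sigmoid_def[abs_def] by measurable
  then show "\<phi> \<in> borel_measurable borel" using assms by auto
qed

lemma nets_star_bounded:
  assumes "\<phi> \<in> {sigmoid, relu}" "g \<in> nets_star d k \<phi>" "x \<in> cube d"
  shows "\<bar>g x\<bar> \<le> 2 * real k + 1"
proof -
  have "\<bar>g x\<bar> \<le> real k * (1 * 2) + 0 + 1"
    by (rule nets_bounded[OF assms(2)[unfolded nets_star_def] assms(3)])
      (use sigmoid_relu_props[OF assms(1)] in auto)
  then show ?thesis by simp
qed

lemma tendsto_exponent_at_bot:
  fixes \<rho> D :: real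
  assumes "0 < \<rho>" "0 < D"
  shows "filterlim (\<lambda>n::nat. (ln (real n) + 1) * D * ln (2 * real n + 3) - real n powr (\<rho> / 2) / (2 * exp 2) + 2 * ln (real n)) at_bot sequentially"
  using assms by real_asymp

lemma tendsto_cover_error:
  fixes \<rho> D :: real
  assumes "0 < \<rho>" "0 < D"
  shows "(\<lambda>n::nat. 4 * (exp 1 * real n powr (1 / 2)) * ((ln (real n) * D + D) / (real n + 1)) + 2 * real n powr (- (\<rho> / 4))) \<longlonglongrightarrow> 0"
proof (rule tendsto_add_zero)
  show "(\<lambda>n::nat. 4 * (exp 1 * real n powr (1 / 2)) * ((ln (real n) * D + D) / (real n + 1))) \<longlonglongrightarrow> 0"
    using assms(2) by real_asymp
  have "(\<lambda>n::nat. 2 * real n powr (- (\<rho> / 4))) \<longlonglongrightarrow> 2 * 0"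
    using assms(1) by (intro tendsto_mult tendsto_const tendsto_neg_powr filterlim_real_sequentially) auto
  then show "(\<lambda>n::nat. 2 * real n powr (- (\<rho> / 4))) \<longlonglongrightarrow> 0" by simp
qed

text \<open>The rates that enter are \<open>exp (2 k\<^sub>n + 1) \<le> exp 1 \<cdot> n\<^bsup>(1 - \<rho>) / 2\<^esup>\<close> for the range of \<open>exp \<circ> g\<close>, a cover by
  \<open>n\<^bsup>O(log n)\<^esup>\<close> networks, and Hoeffding's bound \<open>exp (- c n\<^bsup>\<rho> / 2\<^esup>)\<close> for each of them.\<close>

lemma estimator_converges:
  fixes P :: "'w measure"
  assumes d: "1 \<le> d" and pair: "(\<mu>, \<nu>) \<in> KL_pairs d (cube d)" and cont: "continuous_on (cube d) f"
    and ver: "log_density_version \<mu> \<nu> f" and \<phi>: "\<phi> \<in> {sigmoid, relu}" and \<rho>: "0 < \<rho>"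
    and klim: "filterlim k at_top sequentially"
    and kle: "\<forall>\<^sub>F n in sequentially. real (k n) \<le> 1 / 4 * (1 - \<rho>) * ln (real n)"
    and iid: "iid_samples P \<mu> \<nu> X Y"
  shows "AE \<omega> in P. (\<lambda>n. ereal (KL_estimator (nets_star d (k n) \<phi>) n (\<lambda>i. X i \<omega>) (\<lambda>i. Y i \<omega>))) \<longlonglongrightarrow> KL \<mu> \<nu>"
proof -
  have P: "prob_space P" and ind: "prob_space.indep_vars P (case_sum (\<lambda>_. \<mu>) (\<lambda>_. \<nu>)) (case_sum X Y) (UNIV :: (nat + nat) set)"
    and dX: "\<And>i. distr P \<mu> (X i) = \<mu>" and dY: "\<And>i. distr P \<nu> (Y i) = \<nu>"
    using iid by (auto simp: iid_samples_def)
  interpret prob_space P by (rule P)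
  obtain b where fb: "\<And>x. x \<in> cube d \<Longrightarrow> \<bar>f x\<bar> \<le> b"
  proof -
    have "bounded (f ` cube d)" using compact_continuous_image[OF cont compact_cube] by (rule compact_imp_bounded)
    then show thesis using that unfolding bounded_iff by auto
  qed
  interpret L: log_density \<mu> \<nu> f b by (rule KL_pairs_log_density[OF pair ver fb])
  have bm: "borel_prob d (cube d) \<mu>" and bn: "borel_prob d (cube d) \<nu>" using pair by (auto simp: KL_pairs_def)
  have sp: "space \<mu> = cube d" "space \<nu> = cube d" using borel_prob_space bm bn by auto
  have XM: "X i \<in> P \<rightarrow>\<^sub>M \<mu>" and YM: "Y i \<in> P \<rightarrow>\<^sub>M \<nu>" for i
  proof -
    have *: "case_sum X Y p \<in> P \<rightarrow>\<^sub>M case_sum (\<lambda>_. \<mu>) (\<lambda>_. \<nu>) p" for p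
      using ind unfolding indep_vars_def by blast
    show "X i \<in> P \<rightarrow>\<^sub>M \<mu>" "Y i \<in> P \<rightarrow>\<^sub>M \<nu>" using *[of "Inl i"] *[of "Inr i"] by simp_all
  qed
  define E where "E n = (real (k n) * (1 * (real d + 1) + 2) + (real d + 1)) / real (n + 1)" for n
  define c where "c n = 2 * real (k n) + 1" for n
  \<comment> \<open>Slow enough for Hoeffding's bound to be summable, since the range of \<open>exp \<circ> g\<close> is \<open>O(n\<^bsup>(1 - \<rho>) / 2\<^esup>)\<close>.\<close>
  define \<epsilon> where "\<epsilon> n = real n powr (- (\<rho> / 4))" for n
  have "\<exists>T. finite T \<and> T \<subseteq> nets_star d (k n) \<phi> \<and> real (card T) \<le> (2 * 1 * real (n + 1) + 1) ^ ((k n + 1) * (d + 2)) \<and>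
    (\<forall>g\<in>nets_star d (k n) \<phi>. \<exists>t\<in>T. \<forall>x\<in>cube d. \<bar>g x - t x\<bar> \<le> E n)" for n
  proof -
    obtain T where "finite T" "T \<subseteq> nets d (k n) 1 1 1 0 \<phi>" "real (card T) \<le> (2 * 1 * real (n + 1) + 1) ^ ((k n + 1) * (d + 2))"
      "\<And>g. g \<in> nets d (k n) 1 1 1 0 \<phi> \<Longrightarrow> \<exists>t\<in>T. \<forall>x\<in>cube d.
         \<bar>g x - t x\<bar> \<le> (real (k n) * (1 * (real d + 1) + 2) + (real d + 1)) / real (n + 1)"
    proof (rule nets_cover[of 1 1 1 1 0 "n + 1" \<phi> 2 d "k n"])
      show "\<bar>\<phi> y - \<phi> z\<bar> \<le> \<bar>y - z\<bar>" for y z by (rule sigmoid_relu_props(1)[OF \<phi>])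
      show "\<bar>\<phi> z\<bar> \<le> 2" if "\<bar>z\<bar> \<le> 2 * 1" for z using that by (intro sigmoid_relu_props(2)[OF \<phi>]) simp
    qed auto
    moreover have "E n = (real (k n) * (1 * (real d + 1) + 2) + (real d + 1)) / real (n + 1)"
      by (rule E_def)
    ultimately show ?thesis unfolding nets_star_def by (intro exI[of _ T]) auto
  qed
  then obtain T where finT: "\<And>n. finite (T n)" and TG: "\<And>n. T n \<subseteq> nets_star d (k n) \<phi>"
    and cardT: "\<And>n. real (card (T n)) \<le> (2 * 1 * real (n + 1) + 1) ^ ((k n + 1) * (d + 2))"
    and net: "\<And>n g. g \<in> nets_star d (k n) \<phi> \<Longrightarrow> \<exists>t\<in>T n. \<forall>x\<in>cube d. \<bar>g x - t x\<bar> \<le> E n"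
    by metis
  have gm: "g \<in> borel_measurable \<mu>" "g \<in> borel_measurable \<nu>" and gb: "\<And>x. x \<in> cube d \<Longrightarrow> \<bar>g x\<bar> \<le> c n"
    if g: "g \<in> nets_star d (k n) \<phi>" for g n
  proof -
    have "g \<in> borel_measurable (euc d)"
      using g sigmoid_relu_props(3)[OF \<phi>] unfolding nets_star_def by (rule nets_measurable)
    then show "g \<in> borel_measurable \<mu>" "g \<in> borel_measurable \<nu>" using borel_prob_measurable bm bn by blast+
    show "\<bar>g x\<bar> \<le> c n" if "x \<in> cube d" for x unfolding c_def by (rule nets_star_bounded[OF \<phi> g that])
  qed
  define AX where "AX n t = {\<omega> \<in> space P. \<epsilon> n \<le> \<bar>(1 / real n) * (\<Sum>i<n. t (X i \<omega>)) - (\<integral>x. t x \<partial>\<mu>)\<bar>}" for n t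
  define AY where "AY n t = {\<omega> \<in> space P. \<epsilon> n \<le> \<bar>(1 / real n) * (\<Sum>i<n. exp (t (Y i \<omega>))) - (\<integral>x. exp (t x) \<partial>\<nu>)\<bar>}" for n t
  define A where "A n = (\<Union>t\<in>T n. AX n t) \<union> (\<Union>t\<in>T n. AY n t)" for n
  have meas: "AX n t \<in> sets P" "AY n t \<in> sets P" if t: "t \<in> T n" for n t
  proof -
    have [measurable]: "t \<in> borel_measurable \<mu>" "t \<in> borel_measurable \<nu>" using gm[of t n] TG t by auto
    note XM [measurable] YM [measurable]
    show "AX n t \<in> sets P" "AY n t \<in> sets P" unfolding AX_def AY_def by measurable
  qed
  have Asets: "A n \<in> sets P" for n
    unfolding A_def using meas finT by (intro sets.Un sets.finite_UN) auto
  have c1: "1 \<le> c n" for n by (simp add: c_def)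
  have ce: "c n \<le> exp (c n)" for n using exp_ge_add_one_self[of "c n"] by linarith
  have bX: "measure P (AX n t) \<le> 2 * exp (- (real n * (\<epsilon> n)\<^sup>2 / (2 * (exp (c n))\<^sup>2)))"
    and bY: "measure P (AY n t) \<le> 2 * exp (- (real n * (\<epsilon> n)\<^sup>2 / (2 * (exp (c n))\<^sup>2)))"
    if t: "t \<in> T n" and n: "1 \<le> n" for n t
  proof -
    have tG: "t \<in> nets_star d (k n) \<phi>" using TG t by auto
    show "measure P (AX n t) \<le> 2 * exp (- (real n * (\<epsilon> n)\<^sup>2 / (2 * (exp (c n))\<^sup>2)))"
    proof -
      have bd: "\<bar>t x\<bar> \<le> exp (c n)" if "x \<in> space \<mu>" for x
        using gb[OF tG, of x] that sp ce[of n] by auto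
      show ?thesis
        using hoeffding_average(2)[OF P ind, of Inl \<mu> t "exp (c n)" n "\<epsilon> n"] dX gm(1)[OF tG] bd n
        by (simp add: AX_def \<epsilon>_def)
    qed
    show "measure P (AY n t) \<le> 2 * exp (- (real n * (\<epsilon> n)\<^sup>2 / (2 * (exp (c n))\<^sup>2)))"
    proof -
      have bd: "\<bar>exp (t x)\<bar> \<le> exp (c n)" if "x \<in> space \<nu>" for x
        using gb[OF tG, of x] that sp by (auto simp: abs_le_iff)
      have "(\<lambda>x. exp (t x)) \<in> borel_measurable \<nu>" using gm(2)[OF tG] by measurable
      then show ?thesis
        using hoeffding_average(2)[OF P ind, of Inr \<nu> "\<lambda>x. exp (t x)" "exp (c n)" n "\<epsilon> n"] dY bd n
        by (simp add: AY_def \<epsilon>_def)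
    qed
  qed
  have Abound: "measure P (A n) \<le> 4 * real (card (T n)) * exp (- (real n * (\<epsilon> n)\<^sup>2 / (2 * (exp (c n))\<^sup>2)))" if n: "1 \<le> n" for n
  proof -
    have "measure P (A n) \<le> measure P (\<Union>t\<in>T n. AX n t) + measure P (\<Union>t\<in>T n. AY n t)"
      unfolding A_def using meas finT by (intro measure_Un_le sets.finite_UN) auto
    also have "\<dots> \<le> real (card (T n)) * (2 * exp (- (real n * (\<epsilon> n)\<^sup>2 / (2 * (exp (c n))\<^sup>2))))
        + real (card (T n)) * (2 * exp (- (real n * (\<epsilon> n)\<^sup>2 / (2 * (exp (c n))\<^sup>2))))"
      using meas bX[OF _ n] bY[OF _ n] by (intro add_mono measure_finite_union_le[OF P finT]) auto
    finally show ?thesis by simp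
  qed
  have ec: "(exp (c n))\<^sup>2 \<le> exp 2 * real n powr (1 - \<rho>)" "exp (c n) \<le> exp 1 * real n powr (1 / 2)"
    if "1 \<le> n" "real (k n) \<le> 1 / 4 * (1 - \<rho>) * ln (real n)" for n
  proof -
    have ln0: "0 \<le> ln (real n)" using that by simp
    have "(exp (c n))\<^sup>2 = exp (2 + 4 * real (k n))" by (simp add: c_def power2_eq_square exp_add[symmetric] algebra_simps)
    also have "\<dots> \<le> exp (2 + (1 - \<rho>) * ln (real n))" using that by simp
    also have "\<dots> = exp 2 * real n powr (1 - \<rho>)" using that by (simp add: exp_add powr_def)
    finally show "(exp (c n))\<^sup>2 \<le> exp 2 * real n powr (1 - \<rho>)" .
    have "0 \<le> \<rho> * ln (real n)" using \<rho> ln0 by simp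
    then have "c n \<le> 1 + (1 / 2) * ln (real n)" using that unfolding c_def by (simp add: algebra_simps)
    then have "exp (c n) \<le> exp (1 + (1 / 2) * ln (real n))" by simp
    also have "\<dots> = exp 1 * real n powr (1 / 2)" using that by (simp add: exp_add powr_def)
    finally show "exp (c n) \<le> exp 1 * real n powr (1 / 2)" .
  qed
  have kln: "real (k n) \<le> ln (real n)" if "1 \<le> n" "real (k n) \<le> 1 / 4 * (1 - \<rho>) * ln (real n)" for n
  proof -
    have "0 \<le> ln (real n)" using that by simp
    moreover have "1 / 4 * (1 - \<rho>) \<le> 1" using \<rho> by simp
    ultimately have "1 / 4 * (1 - \<rho>) * ln (real n) \<le> 1 * ln (real n)" by (intro mult_right_mono)
    then show ?thesis using that by simp
  qed
  have "eventually (\<lambda>n. measure P (A n) \<le> 4 * inverse (real n ^ 2)) sequentially"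
  proof -
    have lim: "filterlim (\<lambda>n::nat. (ln (real n) + 1) * (real d + 2) * ln (2 * real n + 3) - real n powr (\<rho> / 2) / (2 * exp 2) + 2 * ln (real n)) at_bot sequentially"
      using \<rho> by (intro tendsto_exponent_at_bot) auto
    have "eventually (\<lambda>n. (ln (real n) + 1) * (real d + 2) * ln (2 * real n + 3) - real n powr (\<rho> / 2) / (2 * exp 2) + 2 * ln (real n) \<le> 0) sequentially"
      using lim unfolding filterlim_at_bot by blast
    then show ?thesis
      using kle eventually_ge_at_top[of 1]
    proof eventually_elim
      case (elim n)
      have n: "1 \<le> n" and kn: "real (k n) \<le> 1 / 4 * (1 - \<rho>) * ln (real n)" using elim by auto
      have card: "real (card (T n)) \<le> exp ((ln (real n) + 1) * (real d + 2) * ln (2 * real n + 3))"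
      proof -
        have "(2 * 1 * real (n + 1) + 1) ^ ((k n + 1) * (d + 2)) = exp (real ((k n + 1) * (d + 2)) * ln (2 * real n + 3))"
          by (subst exp_of_nat_mult) (simp add: algebra_simps)
        also have "\<dots> \<le> exp (((ln (real n) + 1) * (real d + 2)) * ln (2 * real n + 3))"
        proof -
          have "real (k n + 1) * real (d + 2) \<le> (ln (real n) + 1) * (real d + 2)"
            using kln[OF n kn] by (intro mult_mono) auto
          then have "real ((k n + 1) * (d + 2)) * ln (2 * real n + 3) \<le> ((ln (real n) + 1) * (real d + 2)) * ln (2 * real n + 3)"
            unfolding of_nat_mult by (rule mult_right_mono) simp
          then show ?thesis by simp
        qed
        finally show ?thesis using cardT[of n] by linarith
      qed
      have expo: "real n powr (\<rho> / 2) / (2 * exp 2) \<le> real n * (\<epsilon> n)\<^sup>2 / (2 * (exp (c n))\<^sup>2)"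
      proof -
        have np: "0 < real n" using n by simp
        have e2: "(\<epsilon> n)\<^sup>2 = real n powr (- (\<rho> / 2))"
          by (simp add: \<epsilon>_def power2_eq_square powr_add[symmetric])
        have "real n powr (\<rho> / 2) / (2 * exp 2) = real n * (\<epsilon> n)\<^sup>2 / (2 * (exp 2 * real n powr (1 - \<rho>)))"
        proof -
          have "real n * (\<epsilon> n)\<^sup>2 = real n powr (1 + - (\<rho> / 2))" unfolding powr_add e2 using np by simp
          also have "1 + - (\<rho> / 2) = \<rho> / 2 + (1 - \<rho>)" by simp
          finally have "real n * (\<epsilon> n)\<^sup>2 = real n powr (\<rho> / 2) * real n powr (1 - \<rho>)" by (simp only: powr_add)
          then show ?thesis using np by simp
        qed
        also have "\<dots> \<le> real n * (\<epsilon> n)\<^sup>2 / (2 * (exp (c n))\<^sup>2)"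
          using ec(1)[OF n kn] np by (intro divide_left_mono mult_left_mono) auto
        finally show ?thesis .
      qed
      have "measure P (A n) \<le> 4 * real (card (T n)) * exp (- (real n * (\<epsilon> n)\<^sup>2 / (2 * (exp (c n))\<^sup>2)))" by (rule Abound[OF n])
      also have "\<dots> \<le> 4 * exp ((ln (real n) + 1) * (real d + 2) * ln (2 * real n + 3)) * exp (- (real n powr (\<rho> / 2) / (2 * exp 2)))"
        using card expo by (intro mult_mono) auto
      also have "\<dots> = 4 * exp ((ln (real n) + 1) * (real d + 2) * ln (2 * real n + 3) - real n powr (\<rho> / 2) / (2 * exp 2))"
        by (simp only: mult.assoc exp_add[symmetric] diff_conv_add_uminus)
      also have "\<dots> \<le> 4 * exp (- (2 * ln (real n)))" using elim by simp
      also have "exp (- (2 * ln (real n))) = inverse (real n ^ 2)"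
      proof -
        have "exp (2 * ln (real n)) = real n ^ 2" using n exp_of_nat_mult[of 2 "ln (real n)"] by simp
        then show ?thesis by (simp only: exp_minus)
      qed
      finally show ?case .
    qed
  qed
  then have "summable (\<lambda>n. measure P (A n))"
    by (intro summable_comparison_test_ev[OF _ summable_mult[OF inverse_power_summable[of 2]]]) auto
  then have "AE \<omega> in P. eventually (\<lambda>n. \<omega> \<in> space P - A n) sequentially"
    using Asets by (intro borel_cantelli_AE1) (auto simp: emeasure_eq_measure)
  then show ?thesis
    using AE_space
  proof eventually_elim
    case (elim \<omega>)
    let ?est = "\<lambda>n. KL_estimator (nets_star d (k n) \<phi>) n (\<lambda>i. X i \<omega>) (\<lambda>i. Y i \<omega>)"
    let ?D = "real_of_ereal (KL \<mu> \<nu>)"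
    have inX: "X i \<omega> \<in> cube d" and inY: "Y i \<omega> \<in> cube d" for i
      using measurable_space[OF XM elim(2)] measurable_space[OF YM elim(2)] sp by auto
    have rate: "(\<lambda>n::nat. 4 * (exp 1 * real n powr (1 / 2)) * ((ln (real n) * (real d + 3) + (real d + 3)) / (real n + 1)) + 2 * real n powr (- (\<rho> / 4))) \<longlonglongrightarrow> 0"
      using \<rho> by (intro tendsto_cover_error) auto
    have "?est \<longlonglongrightarrow> ?D"
    proof (rule LIMSEQ_I)
      fix r :: real assume r: "0 < r"
      define \<delta> where "\<delta> = min 1 (r / 16)"
      have \<delta>: "0 < \<delta>" "\<delta> \<le> 1" "\<delta> \<le> r / 16" using r by (auto simp: \<delta>_def)
      have \<delta>r: "\<delta> + (exp \<delta> - 1) \<le> r / 4"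
      proof -
        have "exp \<delta> - exp 0 \<le> exp 1 * \<bar>\<delta> - 0\<bar>" using exp_diff_le[of \<delta> 1 0] \<delta> by (simp add: abs_le_iff)
        also have "\<dots> \<le> 3 * \<delta>" using exp_le \<delta> by (intro mult_mono) auto
        finally show ?thesis using \<delta> by simp
      qed
      obtain k0 where k0: "\<And>k. k0 \<le> k \<Longrightarrow> \<exists>g\<in>nets_star d k \<phi>. \<forall>x\<in>cube d. \<bar>g x - f x\<bar> \<le> \<delta>"
        using nets_star_dense[OF \<phi> d cont \<delta>(1)] by blast
      have ev_k: "eventually (\<lambda>n. k0 \<le> k n) sequentially" using klim unfolding filterlim_at_top by blast
      have ev_r: "eventually (\<lambda>n. 4 * (exp 1 * real n powr (1 / 2)) * ((ln (real n) * (real d + 3) + (real d + 3)) / (real n + 1)) + 2 * real n powr (- (\<rho> / 4)) < r / 4) sequentially"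
        using order_tendstoD(2)[OF rate, of "r / 4"] r by simp
      have "eventually (\<lambda>n. norm (?est n - ?D) < r) sequentially"
        using elim(1) ev_k ev_r kle eventually_ge_at_top[of 1]
      proof eventually_elim
        case (elim n)
        have n: "1 \<le> n" and kn: "real (k n) \<le> 1 / 4 * (1 - \<rho>) * ln (real n)" using elim by auto
        obtain h where h: "h \<in> nets_star d (k n) \<phi>" "\<forall>x\<in>cube d. \<bar>h x - f x\<bar> \<le> \<delta>" using k0 elim by blast
        have notA: "\<omega> \<in> space P" "\<omega> \<notin> A n" using elim by auto
        have "\<bar>?est n - ?D\<bar> \<le> \<delta> + (exp \<delta> - 1) + \<epsilon> n + \<epsilon> n + 2 * (E n + exp (c n) * E n)"
        proof (rule L.estimator_error[where T = "T n" and h = h])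
          show "\<bar>(1 / real n) * (\<Sum>i<n. t (X i \<omega>)) - (\<integral>z. t z \<partial>\<mu>)\<bar> \<le> \<epsilon> n" if "t \<in> T n" for t
            using notA that unfolding A_def AX_def by force
          show "\<bar>(1 / real n) * (\<Sum>i<n. exp (t (Y i \<omega>))) - (\<integral>z. exp (t z) \<partial>\<nu>)\<bar> \<le> \<epsilon> n" if "t \<in> T n" for t
            using notA that unfolding A_def AY_def by force
          show "g \<in> borel_measurable \<nu>" if "g \<in> nets_star d (k n) \<phi>" for g using gm(2)[OF that] .
          show "\<bar>g x\<bar> \<le> c n" if "g \<in> nets_star d (k n) \<phi>" "x \<in> space \<nu>" for g x using gb[OF that(1)] that(2) sp by simp
          show "\<exists>t\<in>T n. \<forall>x\<in>space \<nu>. \<bar>g x - t x\<bar> \<le> E n" if "g \<in> nets_star d (k n) \<phi>" for g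
            unfolding sp by (rule net[OF that])
          show "\<bar>h x - f x\<bar> \<le> \<delta>" if "x \<in> space \<nu>" for x using h(2) that sp by simp
        qed (use n h TG inX inY sp in auto)
        also have "2 * (E n + exp (c n) * E n) \<le> 4 * (exp 1 * real n powr (1 / 2)) * ((ln (real n) * (real d + 3) + (real d + 3)) / (real n + 1))"
        proof -
          have E0: "0 \<le> E n" by (simp add: E_def)
          have "E n \<le> exp (c n) * E n" using mult_right_mono[of 1 "exp (c n)" "E n"] E0 c1[of n] by simp
          moreover have double: "u \<le> v \<Longrightarrow> 2 * (u + v) \<le> 4 * v" for u v :: real by simp
          ultimately have "2 * (E n + exp (c n) * E n) \<le> 4 * (exp (c n) * E n)" by (intro double)
          also have "exp (c n) * E n \<le> (exp 1 * real n powr (1 / 2)) * ((ln (real n) * (real d + 3) + (real d + 3)) / (real n + 1))"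
          proof (rule mult_mono)
            have "E n = (real (k n) * (real d + 3) + (real d + 1)) / (real n + 1)"
              unfolding E_def by (simp add: field_simps)
            also have "\<dots> \<le> (ln (real n) * (real d + 3) + (real d + 3)) / (real n + 1)"
              using kln[OF n kn] by (intro divide_right_mono add_mono mult_right_mono) auto
            finally show "E n \<le> (ln (real n) * (real d + 3) + (real d + 3)) / (real n + 1)" .
          qed (use ec(2)[OF n kn] E0 in auto)
          finally show ?thesis by (simp only: mult.assoc)
        qed
        finally have "\<bar>?est n - ?D\<bar> \<le> r / 4 + r / 4"
          using \<delta>r elim by (simp add: \<epsilon>_def)
        then show ?case using r by simp
      qed
      then show "\<exists>N. \<forall>n\<ge>N. norm (?est n - ?D) < r" by (simp add: eventually_sequentially)
    qed
    then have "(\<lambda>n. ereal (?est n)) \<longlonglongrightarrow> ereal ?D" by (rule tendsto_ereal)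
    also have "ereal ?D = KL \<mu> \<nu>" by (subst (1 2) KL_finite(1)[OF L.fin]) simp
    finally show ?case .
  qed
qed


section \<open>Consistency and risk of the estimator\<close>

theorem theorem14:
  "(\<forall>(d::nat) \<mu> \<nu> (\<phi> :: real \<Rightarrow> real) (\<rho>::real) (k :: nat \<Rightarrow> nat) (P :: 'w measure) X Y.
      1 \<le> d \<longrightarrow> (\<mu>, \<nu>) \<in> KL_pairs d (cube d) \<longrightarrow>
      (\<exists>f. continuous_on (cube d) f \<and> log_density_version \<mu> \<nu> f) \<longrightarrow>
      \<phi> \<in> {sigmoid, relu} \<longrightarrow> 0 < \<rho> \<longrightarrow> \<rho> < 1 \<longrightarrow>
      filterlim k at_top sequentially \<longrightarrow>
      (\<forall>\<^sub>F n in sequentially. real (k n) \<le> 1 / 4 * (1 - \<rho>) * ln (real n)) \<longrightarrow>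
      iid_samples P \<mu> \<nu> X Y \<longrightarrow>
      (AE \<omega> in P. (\<lambda>n. ereal (KL_estimator (nets_star d (k n) \<phi>) n (\<lambda>i. X i \<omega>) (\<lambda>i. Y i \<omega>)))
          \<longlonglongrightarrow> KL \<mu> \<nu>))
   \<and>
   (\<forall>M::real. 0 \<le> M \<longrightarrow> (\<exists>C::real. \<forall>(d::nat) (k::nat) (n::nat).
      1 \<le> d \<longrightarrow> 1 \<le> k \<longrightarrow> 1 \<le> n \<longrightarrow>
      (SUP (\<mu>, \<nu>)\<in>KL_pairs_bounded M d (cube d).
         \<integral>\<^sup>+(x, y). ennreal \<bar>KL_estimator (nets_relu d k (growth k)) n x y - real_of_ereal (KL \<mu> \<nu>)\<bar>
           \<partial>sample_law n \<mu> \<nu>)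
      \<le> ennreal (C * (real d powr (1/2) * real k powr (-1/2) +
                       real d powr (3/2) * ln (real k) ^ 7 * real n powr (-1/2)))))"
proof (intro conjI allI impI)
  fix d :: nat and \<mu> \<nu> \<phi> \<rho> k and P :: "'w measure" and X Y
  assume *: "1 \<le> d" "(\<mu>, \<nu>) \<in> KL_pairs d (cube d)" and f: "\<exists>f. continuous_on (cube d) f \<and> log_density_version \<mu> \<nu> f"
    and "\<phi> \<in> {sigmoid, relu}" "0 < (\<rho>::real)" "\<rho> < 1" "filterlim k at_top sequentially"
    "\<forall>\<^sub>F n in sequentially. real (k n) \<le> 1 / 4 * (1 - \<rho>) * ln (real n)" "iid_samples P \<mu> \<nu> X Y"
  then show "AE \<omega> in P. (\<lambda>n. ereal (KL_estimator (nets_star d (k n) \<phi>) n (\<lambda>i. X i \<omega>) (\<lambda>i. Y i \<omega>)))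
      \<longlonglongrightarrow> KL \<mu> \<nu>"
    using estimator_converges[OF *] by blast
next
  fix M :: real assume M: "0 \<le> M"
  show "\<exists>C::real. \<forall>(d::nat) (k::nat) (n::nat). 1 \<le> d \<longrightarrow> 1 \<le> k \<longrightarrow> 1 \<le> n \<longrightarrow>
      (SUP (\<mu>, \<nu>)\<in>KL_pairs_bounded M d (cube d).
         \<integral>\<^sup>+(x, y). ennreal \<bar>KL_estimator (nets_relu d k (growth k)) n x y - real_of_ereal (KL \<mu> \<nu>)\<bar>
           \<partial>sample_law n \<mu> \<nu>)
      \<le> ennreal (C * (real d powr (1/2) * real k powr (-1/2) +
                       real d powr (3/2) * ln (real k) ^ 7 * real n powr (-1/2)))"
  proof (intro exI[of _ "risk_constant M"] allI impI SUP_least)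
    fix d k n :: nat and p assume "1 \<le> d" "1 \<le> k" "1 \<le> n" "p \<in> KL_pairs_bounded M d (cube d)"
    then show "(case p of (\<mu>, \<nu>) \<Rightarrow>
         \<integral>\<^sup>+(x, y). ennreal \<bar>KL_estimator (nets_relu d k (growth k)) n x y - real_of_ereal (KL \<mu> \<nu>)\<bar>
           \<partial>sample_law n \<mu> \<nu>)
      \<le> ennreal (risk_constant M * (real d powr (1/2) * real k powr (-1/2) +
                       real d powr (3/2) * ln (real k) ^ 7 * real n powr (-1/2)))"
      using risk_bound[OF M] by (cases p) simp
  qed
qed

end
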